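(* Let $X_\varepsilon=(P_\varepsilon,Q_\varepsilon)$, $\varepsilon\in(0,\varepsilon_0]$, and $X_0=(P_0,Q_0)$ be the planar vector fields $$P_0(u,v)=-\lambda u+f_1(u)+g_1(v),\qquad Q_0(u,v)=-\beta v+f_2(u)+g_2(v),$$ $$P_\varepsilon(u,v)=-\lambda_2^\varepsilon u+\int_0^1 f_1\big(u\varphi^\varepsilon+\theta^\varepsilon(u\varphi^\varepsilon)\big)\varphi^\varepsilon\,dx+g_1(v)\varphi^\varepsilon(0),$$ $$Q_\varepsilon(u,v)=-\beta v+f_2\big(u\varphi^\varepsilon(0)+\theta^\varepsilon(u\varphi^\varepsilon(0))\big)+g_2(v),$$ with the data $\lambda,\beta,f_1,f_2,g_1,g_2,a_\varepsilon,\lambda_2^\varepsilon,\varphi^\varepsilon,\theta^\varepsilon$ as described in the context. Let $\bar X_\varepsilon$ and $\bar X_0$ be the respective Poincaré compactifications of $X_\varepsilon$ and $X_0$ to the Poincaré disk $\mathbb{D}^2$. Then $$\|\bar X_\varepsilon-\bar X_0\|_1\to 0\quad\text{as}\quad \varepsilon\to 0,$$ where $\|\cdot\|_1$ is the $C^1$-norm of vector fields.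
   Context: **The PDE-ODE system.** Let $\lambda,\beta>0$, $\varepsilon_0>0$ (sufficiently small), and for $\varepsilon\in(0,\varepsilon_0]$ let $a_\varepsilon\in C^1([0,1],[m_0,\infty))$ for some $m_0>0$, with $\tau(\varepsilon):=\min_{x\in[0,1]}a_\varepsilon(x)\to\infty$ as $\varepsilon\to0$. Let $f_1,f_2,g_1,g_2$ be real polynomials in one variable such that the maximum $d$ of their degrees satisfies $d-2\ge 0$, $d-1$ is greater than or equal to the degrees of $g_1$ and $f_1$, and $\limsup_{|x|\to\infty}h(x)/x<0$ for $h=f_1,f_2,g_1,g_2$. The system is $$\begin{cases} u_t^\varepsilon-(a_\varepsilon(x)u_x^\varepsilon)_x+\lambda u^\varepsilon=f_1(u^\varepsilon), & (0,1)\times(0,\infty),\\ u_x^\varepsilon(1,t)=0,\quad -a_\varepsilon(0)u_x^\varepsilon(0,t)=g_1(v), & t>0,\\ \dot v+\beta v=f_2(u^\varepsilon(0,t))+g_2(v), & t>0,\\ u^\varepsilon(x,0)=u_0,\quad v(0)=v_0.\end{cases}$$ **Operator and eigenfunctions.** $L^2_c$ denotes the constant functions in $L^2(0,1)$ (identified with $\mathbb{R}$). Let $A_\varepsilon(u,v)=(-(a_\varepsilon u_x)_x+\lambda u,\beta v)$ on $L^2(0,1)\times L^2_c$ with domain $\{(u,v)\in H^1(0,1)\times L^2_c: (a_\varepsilon u_x)_x\in L^2(0,1),\ u_x(1)=0,\ a_\varepsilon(0)u_x(0)=0\}$, and inner product $\langle(u,v),(\varphi,\psi)\rangle=\int_0^1u\varphi\,dx+v\psi$.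 Its eigenvalues are labelled $\lambda_1^\varepsilon,\lambda_2^\varepsilon,\lambda_3^\varepsilon,\dots$, where $\lambda_1^\varepsilon=\beta$ with eigenfunction $(0,1)$; $\lambda_2^\varepsilon\to\lambda$ with eigenfunction $(\varphi^\varepsilon,0)$, $\|\varphi^\varepsilon\|_{L^2(0,1)}=1$, $\varphi^\varepsilon\to1$ as $\varepsilon\to0$; and $\lambda_k^\varepsilon\to\infty$ as $\varepsilon\to 0$ for $k\ge3$. Put $Y_\varepsilon=\mathrm{span}\{(0,1),(\varphi^\varepsilon,0)\}$, let $L_\varepsilon$ be the spectral projection onto $Y_\varepsilon$, and decompose $H^1(0,1)\times L^2_c=Y_\varepsilon\oplus Y_\varepsilon^\perp$. **Truncation.** The planar ODE systems associated with $X_0$ and $X_\varepsilon$ have global attractors $\mathcal A$ (for $\varepsilon=0$) and $\mathcal A_\varepsilon$, whose union is uniformly bounded; let $K=\sup\{\|u\|_{L^\infty}:u\in\bigcup_{\varepsilon\ge0}\mathcal A_\varepsilon\}<\infty$. In the definitions of $X_\varepsilon$, $X_0$, the polynomials $f_1,f_2,g_1,g_2$ are truncated outside $(-2K,2K)$ so as to become globally Lipschitz, and are regarded as retaining their degrees (so $d$ is unchanged); the truncations are still denoted $f_1,f_2,g_1,g_2$. **Invariant manifold and $\theta^\varepsilon$.** With $F(u,v)=(f_1(u)+g_1(v),f_2(u(0))+g_2(v))$, the system is written abstractly as $U_t+A_\varepsilon U=F(U)$. For $\varepsilon_0$ small it has an exponentially attracting invariant manifold $\mathcal M_\varepsilon=\{U\in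 H^1(0,1)\times L^2_c: U=L_\varepsilon U+s_*^\varepsilon(L_\varepsilon U)\}$, where $s_*^\varepsilon:Y_\varepsilon\to Y_\varepsilon^\perp$ is continuously differentiable and $\sup_{V\in Y_\varepsilon}\|s_*^\varepsilon(V)\|_{H^1\times L^2_c}+\sup_{V\in Y_\varepsilon}\|\dot s_*^\varepsilon(V)\|_{\mathcal L(Y_\varepsilon,H^1\times L^2_c)}\to0$ as $\varepsilon\to0$. Elements of $Y_\varepsilon^\perp$ have the form $(w_\perp,0)$. The function $\theta^\varepsilon(u\varphi^\varepsilon)\in H^1(0,1)$ denotes the first component $w_\perp^\varepsilon$ of $s_*^\varepsilon\big(u(\varphi^\varepsilon,0)+v(0,1)\big)$, and $\theta^\varepsilon(u\varphi^\varepsilon(0))$ denotes the value $w_\perp^\varepsilon(0)$ of this function at $x=0$. **Poincaré compactification.** Embed $\mathbb{R}^2$ in $\mathbb{R}^3$ as the plane $\{(u,v,1)\}$ tangent to $\mathbb{S}^2$ at $(0,0,1)$. Let $\mathbb{D}^2=\mathbb{H}^+\cup\mathbb{S}^1$ be the union of the open northern hemisphere and the equator of $\mathbb{S}^2$, and $f^+(u,v)=\big(\tfrac u\Delta,\tfrac v\Delta,\tfrac1\Delta\big)$, $\Delta=\sqrt{u^2+v^2+1}$. The compactification is $\bar X_\varepsilon(Y)=\rho(Y)Df^+(X)X_\varepsilon(X)$, $Y=f^+(X)$, with $\rho$ a bounded correction factor, extended to the equator. The sphere is covered by the charts $U_1=\{y_1>0\}$, $U_2=\{y_2>0\}$, $U_3=\{y_3>0\}$,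 $U_4=\{y_1<0\}$, $U_5=\{y_2<0\}$, $U_6=\{y_3<0\}$, with maps $\phi_1(u,v,w)=(v/u,w/u)$, $\phi_2(u,v,w)=(u/v,w/v)$, $\phi_3(u,v,w)=(u/w,v/w)$, $\phi_4=-\phi_1$, $\phi_5=-\phi_2$, $\phi_6=-\phi_3$ (as formulas). For $\varepsilon\in[0,\varepsilon_0]$ the local expressions of $\bar X_\varepsilon$ in coordinates $(x,y)$ are: - in $(\phi_1,U_1)$: $\dot x=y^d\big[-xP_\varepsilon(\tfrac1y,\tfrac xy)+Q_\varepsilon(\tfrac1y,\tfrac xy)\big]$, $\dot y=-y^{d+1}P_\varepsilon(\tfrac1y,\tfrac xy)$ (change of variables $(u,v)=(1/y,x/y)$); - in $(\phi_2,U_2)$: $\dot x=y^d\big[P_\varepsilon(\tfrac xy,\tfrac1y)-xQ_\varepsilon(\tfrac xy,\tfrac1y)\big]$, $\dot y=-y^{d+1}Q_\varepsilon(\tfrac xy,\tfrac1y)$ (change of variables $(u,v)=(x/y,1/y)$); - in $(\phi_3,U_3)$: $\dot x=P_\varepsilon(x,y)$, $\dot y=Q_\varepsilon(x,y)$; - in $(\phi_4,U_4),(\phi_5,U_5),(\phi_6,U_6)$: the expressions for $U_1,U_2,U_3$ respectively, multiplied by $(-1)^d$. **$C^1$-norm.** For a compact differentiable two-dimensional manifold $M\subset\mathbb{R}^3$ with an open cover $M=V_1\cup\dots\cup V_k$, $V_i$ contained in a local chart $(\phi_i,U_i)$ with $\phi_i(U_i)=B(2)$, $\phi_i(V_i)=B(1)$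 (open balls of radius $2$ and $1$ centered at the origin of $\mathbb{R}^2$), the $C^1$-norm of a vector field $X$ on $M$ is $$\|X\|_1=\max_{1\le i\le k}\ \sup_{(x,y)\in B(1)}\{\|X(\phi_i^{-1}(x,y))\|_{\mathbb{R}^2},\ \|X'(\phi_i^{-1}(x,y))\|_{\mathcal L(\mathbb{R}^2)}\},$$ where $X$ and its derivative $X'$ are read through the local expressions in the charts. It is applied here to vector fields on the Poincaré disk. *)

theory Defs
  imports "HOL-Analysis.Analysis" "HOL-Computational_Algebra.Polynomial"
begin

section \<open>Function spaces on the unit interval\<close>

text \<open>
  A pair \<open>(u, v)\<close> stands for an element of \<open>L\<^sup>2(0,1) \<times> L\<^sup>2\<^sub>c\<close>, the constant function
  being identified with its value.  Only the values of \<open>u\<close> on \<open>[0,1]\<close> matter.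
\<close>

type_synonym state = "(real \<Rightarrow> real) \<times> real"

abbreviation I01 :: "real measure" where
  "I01 \<equiv> lebesgue_on {0..1}"

definition L2 :: "(real \<Rightarrow> real) set" where
  "L2 = {u. u \<in> borel_measurable I01 \<and> integrable I01 (\<lambda>x. (u x)\<^sup>2)}"

definition l2_inner :: "(real \<Rightarrow> real) \<Rightarrow> (real \<Rightarrow> real) \<Rightarrow> real" where
  "l2_inner u w = (LINT x|I01. u x * w x)"

definition l2_norm :: "(real \<Rightarrow> real) \<Rightarrow> real" where
  "l2_norm u = sqrt (l2_inner u u)"

text \<open>
  Elements of \<open>H\<^sup>1(0,1)\<close> are given by their continuous representatives on \<open>[0,1]\<close>, that is, as
  primitives of square integrable functions; so point values such as \<open>u 0\<close> are traces.
\<close>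

definition has_weak_deriv :: "(real \<Rightarrow> real) \<Rightarrow> (real \<Rightarrow> real) \<Rightarrow> bool" where
  "has_weak_deriv u u' \<longleftrightarrow>
     u' \<in> L2 \<and> (\<forall>x\<in>{0..1}. u x = u 0 + (LINT s|lebesgue_on {0..x}. u' s))"

definition H1 :: "(real \<Rightarrow> real) set" where
  "H1 = {u. \<exists>u'. has_weak_deriv u u'}"

definition wderiv :: "(real \<Rightarrow> real) \<Rightarrow> real \<Rightarrow> real" where
  "wderiv u = (SOME u'. has_weak_deriv u u')"

definition h1_norm :: "(real \<Rightarrow> real) \<Rightarrow> real" where
  "h1_norm u = sqrt ((l2_norm u)\<^sup>2 + (l2_norm (wderiv u))\<^sup>2)"

definition st_inner :: "state \<Rightarrow> state \<Rightarrow> real" where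
  "st_inner U V = l2_inner (fst U) (fst V) + snd U * snd V"

text \<open>The norm of \<open>H\<^sup>1(0,1) \<times> L\<^sup>2\<^sub>c\<close>.\<close>

definition st_norm :: "state \<Rightarrow> real" where
  "st_norm U = sqrt ((h1_norm (fst U))\<^sup>2 + (snd U)\<^sup>2)"

definition st_eq :: "state \<Rightarrow> state \<Rightarrow> bool" where
  "st_eq U V \<longleftrightarrow> (\<forall>x\<in>{0..1}. fst U x = fst V x) \<and> snd U = snd V"

text \<open>The linear combination \<open>b U + c V\<close>.\<close>

definition lc :: "real \<Rightarrow> state \<Rightarrow> real \<Rightarrow> state \<Rightarrow> state" where
  "lc b U c V = ((\<lambda>x. b * fst U x + c * fst V x), b * snd U + c * snd V)"

definition st_diff :: "state \<Rightarrow> state \<Rightarrow> state" where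
  "st_diff U V = lc 1 U (-1) V"

definition C1_on_unit :: "(real \<Rightarrow> real) \<Rightarrow> bool" where
  "C1_on_unit a \<longleftrightarrow> (\<exists>a'. continuous_on {0..1} a' \<and>
     (\<forall>x\<in>{0..1}. (a has_real_derivative a' x) (at x within {0..1})))"


section \<open>The operator and its spectral data\<close>

text \<open>
  \<open>A_graph a lam beta U W\<close> says that \<open>U\<close> lies in the domain of the operator and is mapped to \<open>W\<close>.
  Here \<open>ux\<close> is the representative of \<open>u\<^sub>x\<close> for which the flux \<open>a u\<^sub>x\<close> is the continuous
  representative of an element of \<open>H\<^sup>1(0,1)\<close>; this gives a meaning to the values of \<open>u\<^sub>x\<close> at
  \<open>0\<close> and \<open>1\<close>.
\<close>

definition A_graph :: "(real \<Rightarrow> real) \<Rightarrow> real \<Rightarrow> real \<Rightarrow> state \<Rightarrow> state \<Rightarrow> bool" where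
  "A_graph a lam beta U W \<longleftrightarrow>
     (\<exists>ux q. has_weak_deriv (fst U) ux \<and> has_weak_deriv (\<lambda>x. a x * ux x) q \<and>
        ux 1 = 0 \<and> a 0 * ux 0 = 0 \<and>
        fst W \<in> L2 \<and> (AE x in I01. fst W x = - q x + lam * fst U x) \<and>
        snd W = beta * snd U)"

definition eigenpair :: "(real \<Rightarrow> real) \<Rightarrow> real \<Rightarrow> real \<Rightarrow> real \<Rightarrow> state \<Rightarrow> bool" where
  "eigenpair a lam beta mu U \<longleftrightarrow>
     st_inner U U \<noteq> 0 \<and> A_graph a lam beta U ((\<lambda>x. mu * fst U x), mu * snd U)"

text \<open>\<open>Yel phi u v = u (phi, 0) + v (0, 1)\<close>.\<close>

definition Yel :: "(real \<Rightarrow> real) \<Rightarrow> real \<Rightarrow> real \<Rightarrow> state" where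
  "Yel phi u v = ((\<lambda>x. u * phi x), v)"

definition Y :: "(real \<Rightarrow> real) \<Rightarrow> state set" where
  "Y phi = {Yel phi u v | u v. True}"

definition Y_perp :: "(real \<Rightarrow> real) \<Rightarrow> state set" where
  "Y_perp phi = {U. fst U \<in> H1 \<and> (\<forall>V\<in>Y phi. st_inner U V = 0)}"

text \<open>
  The operator is self-adjoint, so its spectral projection onto \<open>Y phi\<close> is the orthogonal one
  (\<open>phi\<close> is normalised in \<open>L\<^sup>2\<close>).
\<close>

definition L_proj :: "(real \<Rightarrow> real) \<Rightarrow> state \<Rightarrow> state" where
  "L_proj phi U = Yel phi (st_inner U (phi, 0)) (st_inner U ((\<lambda>_. 0), 1))"


section \<open>The invariant manifold\<close>

definition Y_opnorm :: "(real \<Rightarrow> real) \<Rightarrow> (state \<Rightarrow> state) \<Rightarrow> ennreal" where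
  "Y_opnorm phi T =
     (SUP H\<in>{H\<in>Y phi. st_norm H \<noteq> 0}. ennreal (st_norm (T H) / st_norm H))"

text \<open>
  \<open>s\<close> maps \<open>Y phi\<close> to \<open>Y_perp phi\<close> and is continuously Frechet differentiable there, with derivative
  \<open>Ds V\<close> at \<open>V\<close>.
\<close>

definition C1_into_Y_perp ::
  "(real \<Rightarrow> real) \<Rightarrow> (state \<Rightarrow> state) \<Rightarrow> (state \<Rightarrow> state \<Rightarrow> state) \<Rightarrow> bool" where
  "C1_into_Y_perp phi s Ds \<longleftrightarrow>
     (\<forall>V\<in>Y phi. s V \<in> Y_perp phi) \<and>
     (\<forall>V\<in>Y phi. \<forall>H\<in>Y phi. fst (Ds V H) \<in> H1) \<and>
     (\<forall>V\<in>Y phi. \<forall>H\<in>Y phi. \<forall>J\<in>Y phi. \<forall>b c.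
        st_eq (Ds V (lc b H c J)) (lc b (Ds V H) c (Ds V J))) \<and>
     (\<forall>V\<in>Y phi. \<forall>e>0. \<exists>\<delta>>0. \<forall>H\<in>Y phi. st_norm H < \<delta> \<longrightarrow>
        st_norm (st_diff (st_diff (s (lc 1 V 1 H)) (s V)) (Ds V H)) \<le> e * st_norm H) \<and>
     (\<forall>V\<in>Y phi. \<forall>e>0. \<exists>\<delta>>0. \<forall>W\<in>Y phi. st_norm (st_diff W V) < \<delta> \<longrightarrow>
        Y_opnorm phi (\<lambda>H. st_diff (Ds W H) (Ds V H)) \<le> ennreal e)"

text \<open>
  Solutions in \<open>H\<^sup>1 \<times> L\<^sup>2\<^sub>c\<close> of the PDE-ODE system (in the abstract form \<open>U\<^sub>t + A U = F(U)\<close>).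
  The flux condition \<open>- a(0) u\<^sub>x(0,t) = g\<^sub>1(v)\<close> appears as the term \<open>G1 v * psi 0\<close> after integration by
  parts: in the abstract equation the entry \<open>g\<^sub>1(v)\<close> of \<open>F\<close> acts as a functional
  at the boundary point \<open>0\<close>.
\<close>

definition weak_solution ::
  "(real \<Rightarrow> real) \<Rightarrow> real \<Rightarrow> real \<Rightarrow> (real \<Rightarrow> real) \<Rightarrow> (real \<Rightarrow> real) \<Rightarrow> (real \<Rightarrow> real) \<Rightarrow> (real \<Rightarrow> real)
    \<Rightarrow> (real \<Rightarrow> state) \<Rightarrow> bool" where
  "weak_solution a lam beta F1 F2 G1 G2 U \<longleftrightarrow>
     (\<forall>t\<ge>0. fst (U t) \<in> H1 \<and>
        ((\<lambda>s. st_norm (st_diff (U s) (U t))) \<longlongrightarrow> 0) (at t within {0..})) \<and>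
     (\<forall>t>0. \<forall>psi\<in>H1.
        ((\<lambda>s. l2_inner (fst (U s)) psi) has_real_derivative
           - l2_inner (\<lambda>x. a x * wderiv (fst (U t)) x) (wderiv psi)
           - lam * l2_inner (fst (U t)) psi
           + l2_inner (\<lambda>x. F1 (fst (U t) x)) psi + G1 (snd (U t)) * psi 0) (at t)) \<and>
     (\<forall>t>0. ((\<lambda>s. snd (U s)) has_real_derivative
           - beta * snd (U t) + F2 (fst (U t) 0) + G2 (snd (U t))) (at t))"

definition manifold :: "(real \<Rightarrow> real) \<Rightarrow> (state \<Rightarrow> state) \<Rightarrow> state set" where
  "manifold phi s =
     {U. fst U \<in> H1 \<and> st_eq U (lc 1 (L_proj phi U) 1 (s (L_proj phi U)))}"

definition exp_attracting_invariant :: "(real \<Rightarrow> state) set \<Rightarrow> state set \<Rightarrow> bool" where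
  "exp_attracting_invariant Sol M \<longleftrightarrow>
     (\<forall>t\<ge>0. {U t | U. U \<in> Sol \<and> U 0 \<in> M} = M) \<and>
     (\<exists>\<kappa>>0. \<forall>R. \<exists>C. \<forall>U\<in>Sol. st_norm (U 0) \<le> R \<longrightarrow>
        (\<forall>t\<ge>0. (INF W\<in>M. st_norm (st_diff (U t) W)) \<le> C * exp (- \<kappa> * t)))"


section \<open>The planar vector fields\<close>

text \<open>
  \<open>F\<close> is a truncation of the polynomial \<open>p\<close> outside \<open>(-2K, 2K)\<close>.  It is taken of class \<open>C\<^sup>1\<close>, as is
  needed for the \<open>C\<^sup>1\<close>-norm to make sense.
\<close>

definition truncation :: "real \<Rightarrow> real poly \<Rightarrow> (real \<Rightarrow> real) \<Rightarrow> bool" where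
  "truncation K p F \<longleftrightarrow>
     (\<forall>x\<in>{-2*K<..<2*K}. F x = poly p x) \<and>
     F C1_differentiable_on UNIV \<and> (\<exists>C. C-lipschitz_on UNIV F)"

type_synonym planar_field = "real \<times> real \<Rightarrow> real \<times> real"

definition X_zero ::
  "real \<Rightarrow> real \<Rightarrow> (real \<Rightarrow> real) \<Rightarrow> (real \<Rightarrow> real) \<Rightarrow> (real \<Rightarrow> real) \<Rightarrow> (real \<Rightarrow> real) \<Rightarrow> planar_field" where
  "X_zero lam beta F1 F2 G1 G2 = (\<lambda>(u, v).
     (- lam * u + F1 u + G1 v, - beta * v + F2 u + G2 v))"

text \<open>
  The first component of \<open>s (u (phi,0) + v (0,1))\<close>; it depends on \<open>v\<close> as well, although the
  usual notation \<open>\<theta>(u phi)\<close> suppresses this.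
\<close>

definition theta :: "(real \<Rightarrow> real) \<Rightarrow> (state \<Rightarrow> state) \<Rightarrow> real \<Rightarrow> real \<Rightarrow> real \<Rightarrow> real" where
  "theta phi s u v = fst (s (Yel phi u v))"

definition X_eps ::
  "real \<Rightarrow> real \<Rightarrow> (real \<Rightarrow> real) \<Rightarrow> (real \<Rightarrow> real) \<Rightarrow> (real \<Rightarrow> real) \<Rightarrow> (real \<Rightarrow> real)
    \<Rightarrow> (real \<Rightarrow> real) \<Rightarrow> (state \<Rightarrow> state) \<Rightarrow> planar_field" where
  "X_eps lam2 beta F1 F2 G1 G2 phi s = (\<lambda>(u, v).
     (- lam2 * u + (LINT x|I01. F1 (u * phi x + theta phi s u v x) * phi x) + G1 v * phi 0,
      - beta * v + F2 (u * phi 0 + theta phi s u v 0) + G2 v))"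

definition ode_solution :: "planar_field \<Rightarrow> (real \<Rightarrow> real \<times> real) \<Rightarrow> bool" where
  "ode_solution X z \<longleftrightarrow> (\<forall>t\<ge>0. (z has_vector_derivative X (z t)) (at t within {0..}))"

definition global_attractor :: "planar_field \<Rightarrow> (real \<times> real) set \<Rightarrow> bool" where
  "global_attractor X A \<longleftrightarrow>
     (\<forall>p. \<exists>z. ode_solution X z \<and> z 0 = p) \<and>
     compact A \<and> A \<noteq> {} \<and>
     (\<forall>t\<ge>0. {z t | z. ode_solution X z \<and> z 0 \<in> A} = A) \<and>
     (\<forall>B. bounded B \<longrightarrow> (\<forall>e>0. \<exists>T. \<forall>z. ode_solution X z \<and> z 0 \<in> B \<longrightarrow>
        (\<forall>t\<ge>0. T \<le> t \<longrightarrow> infdist (z t) A < e)))"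


section \<open>Poincare compactification\<close>

type_synonym r3 = "real \<times> real \<times> real"

definition poincare_disk :: "r3 set" where
  "poincare_disk = {(y1, y2, y3). y1\<^sup>2 + y2\<^sup>2 + y3\<^sup>2 = 1 \<and> 0 \<le> y3}"

definition f_plus :: "real \<times> real \<Rightarrow> r3" where
  "f_plus = (\<lambda>(u, v). let \<Delta> = sqrt (u\<^sup>2 + v\<^sup>2 + 1) in (u / \<Delta>, v / \<Delta>, 1 / \<Delta>))"

datatype chart = U1 | U2 | U3 | U4 | U5 | U6

fun chart_set :: "chart \<Rightarrow> r3 set" where
  "chart_set U1 = {(y1, y2, y3). y1\<^sup>2 + y2\<^sup>2 + y3\<^sup>2 = 1 \<and> y1 > 0}"
| "chart_set U2 = {(y1, y2, y3). y1\<^sup>2 + y2\<^sup>2 + y3\<^sup>2 = 1 \<and> y2 > 0}"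
| "chart_set U3 = {(y1, y2, y3). y1\<^sup>2 + y2\<^sup>2 + y3\<^sup>2 = 1 \<and> y3 > 0}"
| "chart_set U4 = {(y1, y2, y3). y1\<^sup>2 + y2\<^sup>2 + y3\<^sup>2 = 1 \<and> y1 < 0}"
| "chart_set U5 = {(y1, y2, y3). y1\<^sup>2 + y2\<^sup>2 + y3\<^sup>2 = 1 \<and> y2 < 0}"
| "chart_set U6 = {(y1, y2, y3). y1\<^sup>2 + y2\<^sup>2 + y3\<^sup>2 = 1 \<and> y3 < 0}"

fun chart_map :: "chart \<Rightarrow> r3 \<Rightarrow> real \<times> real" where
  "chart_map U1 (u, v, w) = (v / u, w / u)"
| "chart_map U2 (u, v, w) = (u / v, w / v)"
| "chart_map U3 (u, v, w) = (u / w, v / w)"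
| "chart_map U4 (u, v, w) = - (v / u, w / u)"
| "chart_map U5 (u, v, w) = - (u / v, w / v)"
| "chart_map U6 (u, v, w) = - (u / w, v / w)"

definition expr1 :: "nat \<Rightarrow> planar_field \<Rightarrow> planar_field" where
  "expr1 d X = (\<lambda>(x, y).
     (y ^ d * (- x * fst (X (1 / y, x / y)) + snd (X (1 / y, x / y))),
      - (y ^ (d + 1)) * fst (X (1 / y, x / y))))"

definition expr2 :: "nat \<Rightarrow> planar_field \<Rightarrow> planar_field" where
  "expr2 d X = (\<lambda>(x, y).
     (y ^ d * (fst (X (x / y, 1 / y)) - x * snd (X (x / y, 1 / y))),
      - (y ^ (d + 1)) * snd (X (x / y, 1 / y))))"

text \<open>
  In the charts \<open>U4, U5, U6\<close> the expressions of the opposite charts are multiplied by \<open>(-1)^d\<close>.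
  They are written there in terms of the ratios \<open>(v/u, w/u)\<close> etc., which are the negatives of the
  coordinates, because the maps of these charts carry an extra minus sign.
\<close>

fun local_expr :: "nat \<Rightarrow> planar_field \<Rightarrow> chart \<Rightarrow> planar_field" where
  "local_expr d X U1 z = expr1 d X z"
| "local_expr d X U2 z = expr2 d X z"
| "local_expr d X U3 z = X z"
| "local_expr d X U4 z = (-1) ^ d *\<^sub>R expr1 d X (- z)"
| "local_expr d X U5 z = (-1) ^ d *\<^sub>R expr2 d X (- z)"
| "local_expr d X U6 z = (-1) ^ d *\<^sub>R X (- z)"

text \<open>
  The compactified field is represented by its local expressions.  In the charts meeting the
  equator \<open>{y = 0}\<close> it is extended to it by continuity from the side \<open>y > 0\<close> of the disk.
\<close>

definition compactification :: "nat \<Rightarrow> planar_field \<Rightarrow> chart \<Rightarrow> planar_field" where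
  "compactification d X i z =
     (if i \<in> {U1, U2, U4, U5} \<and> snd z = 0
      then Lim (at z within {q. 0 < snd q}) (local_expr d X i)
      else local_expr d X i z)"

text \<open>
  The expressions above are those of the push-forward \<open>Df\<^sup>+ X\<close>, up to the positive correction factor
  \<open>\<rho> = y^(d-1)\<close> in the charts at the equator and \<open>\<rho> = 1\<close> in \<open>U3\<close>.
\<close>

lemma chart_map_f_plus:
  "chart_map U1 (f_plus q) = (snd q / fst q, 1 / fst q)"
  "chart_map U2 (f_plus q) = (fst q / snd q, 1 / snd q)"
  "chart_map U3 (f_plus q) = q"
  "chart_map U4 (f_plus q) = - (snd q / fst q, 1 / fst q)"
  "chart_map U5 (f_plus q) = - (fst q / snd q, 1 / snd q)"
proof -
  have "sqrt ((fst q)\<^sup>2 + (snd q)\<^sup>2 + 1) \<noteq> 0"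
    by (smt (verit) real_sqrt_eq_zero_cancel_iff zero_le_power2)
  then show
    "chart_map U1 (f_plus q) = (snd q / fst q, 1 / fst q)"
    "chart_map U2 (f_plus q) = (fst q / snd q, 1 / snd q)"
    "chart_map U3 (f_plus q) = q"
    "chart_map U4 (f_plus q) = - (snd q / fst q, 1 / fst q)"
    "chart_map U5 (f_plus q) = - (fst q / snd q, 1 / snd q)"
    by (auto simp: f_plus_def case_prod_beta Let_def)
qed

lemma local_expr_pushforward:
  assumes p: "f_plus p \<in> chart_set i"
    and D: "((\<lambda>q. chart_map i (f_plus q)) has_derivative D) (at p)"
    and d: "1 \<le> d"
    and z: "z = chart_map i (f_plus p)"
  shows "local_expr d X i z = (if i = U3 then 1 else snd z ^ (d - 1)) *\<^sub>R D (X p)"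
proof -
  have pos: "0 < sqrt ((fst p)\<^sup>2 + (snd p)\<^sup>2 + 1)"
    by (smt (verit) real_sqrt_gt_zero zero_le_power2)
  obtain n where n: "d = Suc n"
    using d by (cases d) auto
  have der1: "((\<lambda>q::real\<times>real. (snd q / fst q, 1 / fst q)) has_derivative
      (\<lambda>h. (snd h / fst p - snd p * fst h / (fst p)\<^sup>2, - (fst h / (fst p)\<^sup>2)))) (at p)"
    if "fst p \<noteq> 0"
    by (rule has_derivative_eq_rhs, (rule derivative_eq_intros refl that)+)
      (auto simp: fun_eq_iff power2_eq_square field_simps that)
  have der2: "((\<lambda>q::real\<times>real. (fst q / snd q, 1 / snd q)) has_derivative
      (\<lambda>h. (fst h / snd p - fst p * snd h / (snd p)\<^sup>2, - (snd h / (snd p)\<^sup>2)))) (at p)"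
    if "snd p \<noteq> 0"
    by (rule has_derivative_eq_rhs, (rule derivative_eq_intros refl that)+)
      (auto simp: fun_eq_iff power2_eq_square field_simps that)
  have c1: "fst p * (snd p * inverse (fst p)) = snd p" if "fst p \<noteq> 0"
    using that by simp
  have c2: "snd p * (fst p * inverse (snd p)) = fst p" if "snd p \<noteq> 0"
    using that by simp
  show ?thesis
  proof (cases i)
    case U1
    then have nz: "fst p \<noteq> 0"
      using p pos by (auto simp: f_plus_def case_prod_beta Let_def)
    have "D = (\<lambda>h. (snd h / fst p - snd p * fst h / (fst p)\<^sup>2, - (fst h / (fst p)\<^sup>2)))"
      using has_derivative_unique[OF _ der1[OF nz]] D by (simp add: U1 chart_map_f_plus)
    with nz show ?thesis
      by (simp add: U1 z n chart_map_f_plus expr1_def power2_eq_square divide_inverse algebra_simps c1 c2)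
  next
    case U2
    then have nz: "snd p \<noteq> 0"
      using p pos by (auto simp: f_plus_def case_prod_beta Let_def)
    have "D = (\<lambda>h. (fst h / snd p - fst p * snd h / (snd p)\<^sup>2, - (snd h / (snd p)\<^sup>2)))"
      using has_derivative_unique[OF _ der2[OF nz]] D by (simp add: U2 chart_map_f_plus)
    with nz show ?thesis
      by (simp add: U2 z n chart_map_f_plus expr2_def power2_eq_square divide_inverse algebra_simps c1 c2)
  next
    case U3
    have "D = (\<lambda>h. h)"
      using has_derivative_unique[OF _ has_derivative_ident] D by (simp add: U3 chart_map_f_plus)
    then show ?thesis
      by (simp add: U3 z chart_map_f_plus)
  next
    case U4
    then have nz: "fst p \<noteq> 0"
      using p pos by (auto simp: f_plus_def case_prod_beta Let_def)
    have "D = (\<lambda>h. - (snd h / fst p - snd p * fst h / (fst p)\<^sup>2, - (fst h / (fst p)\<^sup>2)))"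
      using has_derivative_unique[OF _ has_derivative_minus[OF der1[OF nz]]] D
      by (simp add: U4 chart_map_f_plus)
    with nz show ?thesis
      by (simp add: U4 z n chart_map_f_plus expr1_def power2_eq_square divide_inverse
          power_minus[of "inverse (fst p)"] algebra_simps c1 c2)
  next
    case U5
    then have nz: "snd p \<noteq> 0"
      using p pos by (auto simp: f_plus_def case_prod_beta Let_def)
    have "D = (\<lambda>h. - (fst h / snd p - fst p * snd h / (snd p)\<^sup>2, - (snd h / (snd p)\<^sup>2)))"
      using has_derivative_unique[OF _ has_derivative_minus[OF der2[OF nz]]] D
      by (simp add: U5 chart_map_f_plus)
    with nz show ?thesis
      by (simp add: U5 z n chart_map_f_plus expr2_def power2_eq_square divide_inverse
          power_minus[of "inverse (snd p)"] algebra_simps c1 c2)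
  next
    case U6
    then show ?thesis
      using p pos by (auto simp: f_plus_def case_prod_beta Let_def)
  qed
qed


section \<open>The C1-norm\<close>

text \<open>
  The norm asks for charts onto the ball of radius 2 with the balls of radius 1 covering the
  manifold.  They are obtained by restricting the charts above to \<open>|chart_map i p| < 2 r\<close> and dividing
  the coordinates by a scaling factor \<open>r\<close>.
\<close>

definition cover_set :: "real \<Rightarrow> chart \<Rightarrow> r3 set" where
  "cover_set r i = {p \<in> chart_set i. norm (chart_map i p) < r}"

lemma cover_set_covers:
  assumes r: "sqrt 2 < r"
  shows "poincare_disk \<subseteq> (\<Union>i. cover_set r i)"
proof
  fix p assume "p \<in> poincare_disk"
  then obtain u v w where p: "p = (u, v, w)" and eq: "u\<^sup>2 + v\<^sup>2 + w\<^sup>2 = 1" and "0 \<le> w"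
    by (cases p) (auto simp: poincare_disk_def)
  have bound: "norm (b / c, e / c) < r" if "\<bar>b\<bar> \<le> \<bar>c\<bar>" "\<bar>e\<bar> \<le> \<bar>c\<bar>" "c \<noteq> 0" for b c e :: real
  proof -
    have "(b / c)\<^sup>2 \<le> 1" "(e / c)\<^sup>2 \<le> 1"
      using that by (simp_all add: abs_square_le_1)
    then have "norm (b / c, e / c) \<le> sqrt 2"
      unfolding norm_Pair real_norm_def power2_abs by (intro real_sqrt_le_mono) linarith
    with r show ?thesis by simp
  qed
  have "u \<noteq> 0 \<or> v \<noteq> 0 \<or> w \<noteq> 0"
    using eq by auto
  then consider "u \<noteq> 0" "\<bar>v\<bar> \<le> \<bar>u\<bar>" "\<bar>w\<bar> \<le> \<bar>u\<bar>" | "v \<noteq> 0" "\<bar>u\<bar> \<le> \<bar>v\<bar>" "\<bar>w\<bar> \<le> \<bar>v\<bar>"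
    | "w \<noteq> 0" "\<bar>u\<bar> \<le> \<bar>w\<bar>" "\<bar>v\<bar> \<le> \<bar>w\<bar>"
    by linarith
  then show "p \<in> (\<Union>i. cover_set r i)"
  proof cases
    case 1
    then have "p \<in> cover_set r (if 0 < u then U1 else U4)"
      using eq bound[of v u w] by (auto simp: cover_set_def p norm_Pair power_divide)
    then show ?thesis by blast
  next
    case 2
    then have "p \<in> cover_set r (if 0 < v then U2 else U5)"
      using eq bound[of u v w] by (auto simp: cover_set_def p norm_Pair power_divide)
    then show ?thesis by blast
  next
    case 3
    then have "p \<in> cover_set r U3"
      using eq bound[of u w v] \<open>0 \<le> w\<close> by (auto simp: cover_set_def p norm_Pair power_divide)
    then show ?thesis by blast
  qed
qed

definition chart_dom :: "real \<Rightarrow> r3 set \<Rightarrow> chart \<Rightarrow> (real \<times> real) set" where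
  "chart_dom r M i = (\<lambda>p. chart_map i p /\<^sub>R r) ` {p \<in> chart_set i \<inter> M. norm (chart_map i p) < 2 * r}"

definition rescaled :: "real \<Rightarrow> planar_field \<Rightarrow> planar_field" where
  "rescaled r E = (\<lambda>z. E (r *\<^sub>R z) /\<^sub>R r)"

text \<open>
  Operator norm of the derivative relative to \<open>S\<close> (one-sided at the points of the equator), with
  value \<open>\<infinity>\<close> where the field is not differentiable.
\<close>

definition deriv_norm :: "planar_field \<Rightarrow> (real \<times> real) set \<Rightarrow> real \<times> real \<Rightarrow> ennreal" where
  "deriv_norm E S z =
     (if E differentiable (at z within S)
      then ennreal (onorm (frechet_derivative E (at z within S))) else \<infinity>)"

definition C1_norm :: "real \<Rightarrow> r3 set \<Rightarrow> (chart \<Rightarrow> planar_field) \<Rightarrow> ennreal" where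
  "C1_norm r M X =
     (SUP i. SUP z\<in>chart_dom r M i \<inter> ball 0 1.
        max (ennreal (norm (rescaled r (X i) z))) (deriv_norm (rescaled r (X i)) (chart_dom r M i) z))"

end

theory Submission
  imports Defs
begin

text \<open>
The compactified fields are compared by means of two facts about the planar fields, a weighted form
of convergence and a count of powers of \<open>y\<close> at the equator.

Weighted convergence. With \<open>mu = ev \<epsilon> 2\<close>, the function \<open>(lam - mu) phi\<close> is the weak derivative of the
flux \<open>a phi'\<close>, which vanishes at \<open>0\<close>, so \<open>|phi'| \<le> |mu - lam| / m0\<close> holds pointwise. With \<open>mu \<longlongrightarrow> lam\<close>
this turns the \<open>L\<^sup>2\<close> convergence \<open>phi \<longlongrightarrow> 1\<close> into uniform convergence on \<open>[0,1]\<close> and gives a bound on \<open>phi\<close> in \<open>H\<^sup>1\<close>. As \<open>H\<^sup>1(0,1)\<close> embeds into the continuous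
functions, the smallness of \<open>s\<close> and \<open>Ds\<close> in \<open>H\<^sup>1\<close> makes \<open>theta\<close> and its derivative in \<open>(u, v)\<close> uniformly
small. Hence the profile \<open>W = u phi + theta\<close> satisfies \<open>|W - u| \<le> \<eta> (1 + |u|)\<close>. The derivatives of the
truncated nonlinearities are continuous and bounded, but need not be uniformly continuous, so
\<open>F'(W) - F'(u)\<close> is small only on bounded sets and merely bounded at infinity. This amounts to
\<open>|DX \<epsilon> q - DX 0 q| \<le> \<kappa> (1 + |q|)\<close> for all \<open>q\<close> once \<open>\<epsilon>\<close> is small (\<open>X_eps_close_to_X_zero\<close>).

The equator. For \<open>Z = X \<epsilon> - X 0\<close> the weighted bound integrates to \<open>|Z q| \<le> \<kappa> (1 + |q|)\<^sup>2\<close>. In a chart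
at the equator \<open>q = (1/y, x/y)\<close>, so \<open>y (1 + |q|)\<close> is bounded, and the local expression \<open>y\<^sup>d M Z(q)\<close>,
where \<open>M\<close> is a matrix with entries \<open>x\<close>, \<open>y\<close> and constants, has a derivative that is controlled by
\<open>y ^ (d - 1) |Z q| + y ^ (d - 2) |DZ q|\<close>. Both terms are \<open>O(\<kappa>)\<close> as soon as \<open>d \<ge> 3\<close>. Moreover
\<open>X \<epsilon>\<close> and \<open>X 0\<close> grow at most linearly, so for \<open>d \<ge> 3\<close> their expressions are \<open>O(y\<^sup>2)\<close>: the extension to
\<open>y = 0\<close> is zero, with derivative zero (\<open>C1_norm_compactification_le\<close>).

The degree. The dissipativity condition forces all four polynomials to have odd degree
(\<open>dissipative_imp_odd_degree\<close>), so \<open>2 \<le> d\<close> improves to \<open>3 \<le> d\<close>. With \<open>d = 2\<close> the factor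
\<open>y ^ (d - 2)\<close> would not damp \<open>DZ\<close>, which need not tend to zero uniformly on the plane.
\<close>

section \<open>Square integrable functions and their primitives\<close>

lemma L2_integrable:
  assumes "u \<in> L2"
  shows "integrable I01 u"
proof (rule Bochner_Integration.integrable_bound)
  interpret finite_measure I01 by (simp add: finite_measure_lebesgue_on)
  show "integrable I01 (\<lambda>x. 1 + (u x)\<^sup>2)"
    using assms by (auto simp: L2_def)
  show "u \<in> borel_measurable I01"
    using assms by (auto simp: L2_def)
  have "\<bar>t\<bar> \<le> \<bar>1 + t\<^sup>2\<bar>" for t :: real
    using sum_squares_bound[of "\<bar>t\<bar>" 1] by (simp add: power2_eq_square)
  then show "AE x in I01. norm (u x) \<le> norm (1 + (u x)\<^sup>2)"
    by simp
qed

lemma measure_I01 [simp]: "measure I01 {0..1} = 1"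
  by (simp add: measure_restrict_space)

text \<open>
The variance of \<open>|u|\<close> on the unit interval, which has measure one, is nonnegative.
\<close>

lemma L2_abs_mean_le:
  assumes "u \<in> L2"
  shows "(LINT x|I01. \<bar>u x\<bar>) \<le> l2_norm u"
proof -
  interpret finite_measure I01 by (simp add: finite_measure_lebesgue_on)
  define m where "m = (LINT x|I01. \<bar>u x\<bar>)"
  have i1: "integrable I01 (\<lambda>x. \<bar>u x\<bar>)" and i2: "integrable I01 (\<lambda>x. (u x)\<^sup>2)"
    using L2_integrable[OF assms] assms by (auto simp: L2_def)
  have "0 \<le> (LINT x|I01. (\<bar>u x\<bar> - m)\<^sup>2)"
    by (intro integral_nonneg_AE) auto
  also have "\<dots> = (LINT x|I01. (u x)\<^sup>2 - 2 * m * \<bar>u x\<bar> + m\<^sup>2)"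
    by (rule arg_cong[where f = "integral\<^sup>L I01"]) (auto simp: power2_eq_square algebra_simps)
  also have "\<dots> = (LINT x|I01. (u x)\<^sup>2) - 2 * m * m + m\<^sup>2"
    using i1 i2 by (simp add: m_def)
  finally have "m\<^sup>2 \<le> (LINT x|I01. (u x)\<^sup>2)"
    by (simp add: power2_eq_square)
  then show ?thesis
    unfolding m_def[symmetric] l2_norm_def l2_inner_def
    by (metis (no_types, lifting) Bochner_Integration.integral_cong power2_eq_square real_le_rsqrt)
qed

lemma L2_lincomb:
  assumes "u \<in> L2" "w \<in> L2"
  shows "(\<lambda>x. b * u x + c * w x) \<in> L2"
proof -
  have [measurable]: "u \<in> borel_measurable I01" "w \<in> borel_measurable I01"
    using assms by (auto simp: L2_def)
  have "integrable I01 (\<lambda>x. (b * u x + c * w x)\<^sup>2)"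
  proof (rule Bochner_Integration.integrable_bound)
    show "integrable I01 (\<lambda>x. 2 * b\<^sup>2 * (u x)\<^sup>2 + 2 * c\<^sup>2 * (w x)\<^sup>2)"
      using assms by (auto simp: L2_def)
    have "(b * s + c * t)\<^sup>2 \<le> 2 * b\<^sup>2 * s\<^sup>2 + 2 * c\<^sup>2 * t\<^sup>2" for s t
      using sum_squares_bound[of "b * s" "c * t"] by (simp add: power2_eq_square algebra_simps)
    then show "AE x in I01. norm ((b * u x + c * w x)\<^sup>2) \<le> norm (2 * b\<^sup>2 * (u x)\<^sup>2 + 2 * c\<^sup>2 * (w x)\<^sup>2)"
      by (auto intro: order_trans[OF _ abs_ge_self])
  qed measurable
  then show ?thesis
    by (auto simp: L2_def)
qed

lemma integrable_lebesgue_on_initial: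
  fixes w :: "real \<Rightarrow> real"
  assumes "integrable I01 w" "x \<in> {0..1}"
  shows "integrable (lebesgue_on {0..x}) w"
  by (rule integrable_subinterval[OF assms(1)]) (use assms(2) in auto)

lemma has_weak_derivD:
  assumes "has_weak_deriv u w"
  shows "w \<in> L2" "x \<in> {0..1} \<Longrightarrow> u x = u 0 + (LINT s|lebesgue_on {0..x}. w s)"
  by (rule assms[unfolded has_weak_deriv_def, THEN conjunct1])
    (rule assms[unfolded has_weak_deriv_def, THEN conjunct2, rule_format])

lemma has_weak_deriv_wderiv:
  assumes "has_weak_deriv u w"
  shows "has_weak_deriv u (wderiv u)"
  unfolding wderiv_def by (rule someI[of "has_weak_deriv u"]) (rule assms)

lemma has_weak_deriv_lincomb:
  assumes "has_weak_deriv u u'" "has_weak_deriv w w'"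
  shows "has_weak_deriv (\<lambda>x. b * u x + c * w x) (\<lambda>x. b * u' x + c * w' x)"
  unfolding has_weak_deriv_def
proof (intro conjI ballI)
  show "(\<lambda>x. b * u' x + c * w' x) \<in> L2"
    using assms by (auto dest: has_weak_derivD(1) intro: L2_lincomb)
  fix x :: real assume x: "x \<in> {0..1}"
  have "integrable (lebesgue_on {0..x}) u'" "integrable (lebesgue_on {0..x}) w'"
    using assms x by (auto dest!: has_weak_derivD(1) intro!: integrable_lebesgue_on_initial L2_integrable)
  moreover note has_weak_derivD(2)[OF assms(1) x] has_weak_derivD(2)[OF assms(2) x]
  ultimately show "b * u x + c * w x = b * u 0 + c * w 0 + (LINT s|lebesgue_on {0..x}. b * u' s + c * w' s)"
    by (simp add: algebra_simps)
qed

lemma H1_lincomb: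
  assumes "u \<in> H1" "w \<in> H1"
  shows "(\<lambda>x. b * u x + c * w x) \<in> H1"
proof -
  obtain u' w' where "has_weak_deriv u u'" "has_weak_deriv w w'"
    using assms by (auto simp: H1_def)
  then have "has_weak_deriv (\<lambda>x. b * u x + c * w x) (\<lambda>x. b * u' x + c * w' x)"
    by (rule has_weak_deriv_lincomb)
  then show ?thesis
    unfolding H1_def by auto
qed

lemma H1_continuous:
  assumes "u \<in> H1"
  shows "continuous_on {0..1} u"
proof -
  obtain w where uw: "has_weak_deriv u w"
    using assms by (auto simp: H1_def)
  note w = has_weak_derivD[OF uw]
  have "continuous_on {0..1} (\<lambda>x. u 0 + (LINT s|lebesgue_on {0..x}. w s))"
    using w(1) by (intro continuous_intros indefinite_integral_continuous_real L2_integrable)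
  then show ?thesis
    by (rule continuous_on_eq) (rule w(2)[symmetric])
qed

lemma continuous_in_L2:
  assumes "continuous_on {0..1} u"
  shows "u \<in> L2"
proof -
  have "integrable I01 u"
    using assms by (rule continuous_imp_integrable_real)
  moreover have "continuous_on {0..1} (\<lambda>x. (u x)\<^sup>2)"
    using assms by (rule continuous_on_power)
  then have "integrable I01 (\<lambda>x. (u x)\<^sup>2)"
    by (rule continuous_imp_integrable_real)
  ultimately show ?thesis
    unfolding L2_def by simp
qed

lemma weak_deriv_increment_le:
  assumes "has_weak_deriv u w" "x \<in> {0..1}"
  shows "\<bar>u x - u 0\<bar> \<le> l2_norm w"
proof -
  note w = has_weak_derivD(1)[OF assms(1)]
  have i: "integrable I01 (\<lambda>s. \<bar>w s\<bar>)"
    using L2_integrable[OF w] by simp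
  have "\<bar>u x - u 0\<bar> = \<bar>LINT s|lebesgue_on {0..x}. w s\<bar>"
    using has_weak_derivD(2)[OF assms] by simp
  also have "\<dots> \<le> (LINT s|lebesgue_on {0..x}. \<bar>w s\<bar>)"
    by (rule integral_abs_bound)
  also have "\<dots> \<le> (LINT s|I01. \<bar>w s\<bar>)"
    using i assms(2) by (intro integral_mono_lebesgue_on_AE) auto
  also have "\<dots> \<le> l2_norm w"
    by (rule L2_abs_mean_le[OF w])
  finally show ?thesis .
qed

lemma l2_norm_nonneg [simp]: "0 \<le> l2_norm u"
  unfolding l2_norm_def l2_inner_def by (intro real_sqrt_ge_zero integral_nonneg_AE) auto

lemma h1_norm_nonneg [simp]: "0 \<le> h1_norm u"
  by (simp add: h1_norm_def)

lemma st_norm_nonneg [simp]: "0 \<le> st_norm U"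
  by (simp add: st_norm_def)

text \<open>
Turns an \<open>L\<^sup>2\<close> bound and a bound on the oscillation into a pointwise bound: the hypothesis is
averaged over \<open>y\<close>.
\<close>

lemma abs_le_l2_norm_plus_oscillation:
  assumes u: "u \<in> L2" and osc: "\<And>y. y \<in> {0..1} \<Longrightarrow> \<bar>t\<bar> \<le> \<bar>u y\<bar> + \<delta>"
  shows "\<bar>t\<bar> \<le> l2_norm u + \<delta>"
proof -
  interpret finite_measure I01 by (simp add: finite_measure_lebesgue_on)
  have "\<bar>t\<bar> = (LINT y|I01. \<bar>t\<bar>)" by simp
  also have "\<dots> \<le> (LINT y|I01. \<bar>u y\<bar> + \<delta>)"
    using L2_integrable[OF u] osc by (intro integral_mono) auto
  also have "\<dots> = (LINT y|I01. \<bar>u y\<bar>) + \<delta>"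
    using L2_integrable[OF u] by simp
  also have "\<dots> \<le> l2_norm u + \<delta>"
    using L2_abs_mean_le[OF u] by simp
  finally show ?thesis .
qed

text \<open>
The embedding of \<open>H\<^sup>1(0,1)\<close> into the continuous functions. Comparing \<open>u x\<close> and \<open>u y\<close> through \<open>u 0\<close>
costs twice the norm of the derivative, whence the constant 3.
\<close>

lemma H1_sup_le:
  assumes "u \<in> H1" "x \<in> {0..1}"
  shows "\<bar>u x\<bar> \<le> 3 * h1_norm u"
proof -
  have w: "has_weak_deriv u (wderiv u)"
    using assms(1) by (auto simp: H1_def intro: has_weak_deriv_wderiv)
  have "\<bar>u x\<bar> \<le> l2_norm u + 2 * l2_norm (wderiv u)"
  proof (rule abs_le_l2_norm_plus_oscillation)
    show "u \<in> L2" using assms(1) by (intro continuous_in_L2 H1_continuous)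
    show "\<bar>u x\<bar> \<le> \<bar>u y\<bar> + 2 * l2_norm (wderiv u)" if "y \<in> {0..1}" for y
      using weak_deriv_increment_le[OF w assms(2)] weak_deriv_increment_le[OF w that] by linarith
  qed
  moreover have "l2_norm u \<le> h1_norm u" "l2_norm (wderiv u) \<le> h1_norm u"
    unfolding h1_norm_def by (simp_all add: real_le_rsqrt)
  ultimately show ?thesis by linarith
qed

text \<open>
The sets over which \<open>g\<close> integrates to zero form a Dynkin system that contains the half-lines, which
generate the Borel sets and are closed under intersection.
\<close>

lemma AE_eq_0_if_initial_integrals_0:
  fixes g :: "real \<Rightarrow> real"
  assumes g: "integrable lebesgue g" and zero: "\<And>x. (LINT s:{..x}|lebesgue. g s) = 0"
    and total: "integral\<^sup>L lebesgue g = 0"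
  shows "AE x in lebesgue. g x = 0"
proof -
  have si: "set_integrable lebesgue A g" if "A \<in> sets lebesgue" for A
    using g that unfolding set_integrable_def by (intro integrable_mult_indicator)
  have sp: "(LINT s:UNIV|lebesgue. g s) = 0"
    using total by (simp add: set_lebesgue_integral_def)
  have borel: "(LINT s:A|lebesgue. g s) = 0" if "A \<in> sets borel" for A
  proof -
    have Int_stable_atMost: "Int_stable (range (\<lambda>a::real. {..a}))"
      by (auto simp: Int_stable_def)
    have subset_Pow_UNIV_atMost: "range (\<lambda>a::real. {..a}) \<subseteq> Pow UNIV"
      by simp
    have "A \<in> sigma_sets UNIV (range (\<lambda>a::real. {..a}))"
      using that by (subst (asm) borel_eq_atMost) simp
    with Int_stable_atMost subset_Pow_UNIV_atMost show ?thesis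
    proof (induction rule: sigma_sets_induct_disjoint[consumes 3, case_names basic empty compl union])
      case (basic A)
      then show ?case using zero by auto
    next
      case empty
      then show ?case by (simp add: set_lebesgue_integral_def)
    next
      case (compl A)
      then have "A \<in> sets borel"
        by (subst borel_eq_atMost) simp
      then have A: "A \<in> sets lebesgue" "UNIV - A \<in> sets lebesgue" by auto
      have "(LINT s:A \<union> (UNIV - A)|lebesgue. g s) = (LINT s:A|lebesgue. g s) + (LINT s:UNIV - A|lebesgue. g s)"
        by (intro set_integral_Un si A) auto
      with compl sp show ?case by simp
    next
      case (union F)
      then have "F i \<in> sets borel" for i
        by (subst borel_eq_atMost) auto
      then have F: "F i \<in> sets lebesgue" for i by auto
      have "(LINT s:(\<Union>i. F i)|lebesgue. g s) = (\<Sum>i. (LINT s:F i|lebesgue. g s))"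
      proof (rule lebesgue_integral_countable_add)
        show "set_integrable lebesgue (\<Union> (range F)) g"
          using F by (intro si) auto
      qed (use F union in \<open>auto simp: disjoint_family_on_def\<close>)
      also have "\<dots> = 0" using union by simp
      finally show ?case .
    qed
  qed
  have "AE x in lebesgue. g x = (\<lambda>_. 0) x"
  proof (rule density_unique_real[OF g])
    fix A :: "real set" assume A: "A \<in> sets lebesgue"
    then obtain B N where BN: "B \<in> sets borel" "N \<in> null_sets lebesgue" "B \<union> N = A"
      by (rule sets_lebesgue_almost_borel) (auto simp: negligible_iff_null_sets)
    have "(LINT s:A|lebesgue. g s) = (LINT s:B|lebesgue. g s)"
    proof (rule set_integral_null_delta[OF g A])
      show "B \<in> sets lebesgue" using BN by auto
      then have "(A - B) \<union> (B - A) \<in> sets lebesgue" using A by auto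
      then show "(A - B) \<union> (B - A) \<in> null_sets lebesgue"
        by (rule null_sets_subset[OF BN(2)]) (use BN in auto)
    qed
    with borel[OF BN(1)] show "(LINT s:A|lebesgue. g s) = (LINT s:A|lebesgue. 0)"
      by simp
  qed simp
  then show ?thesis by simp
qed

text \<open>
\<open>wderiv\<close> is an arbitrary choice among the weak derivatives. By uniqueness the \<open>H\<^sup>1\<close> norm can be
computed from any other of them.
\<close>

lemma weak_deriv_unique_AE:
  assumes "has_weak_deriv u v" "has_weak_deriv u w"
  shows "AE x in I01. v x = w x"
proof -
  define g where "g = (\<lambda>x. if x \<in> {0..1} then v x - w x else 0)"
  have vw: "integrable I01 v" "integrable I01 w"
    using assms by (auto dest: has_weak_derivD(1) intro: L2_integrable)
  then have g: "integrable lebesgue g"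
    unfolding g_def using Lebesgue_Measure.integrable_restrict_UNIV[of "{0..1}" "\<lambda>x. v x - w x"] by simp
  have initial: "(LINT s|lebesgue_on {0..x}. v s - w s) = 0" if "x \<in> {0..1}" for x
    using has_weak_derivD(2)[OF assms(1) that] has_weak_derivD(2)[OF assms(2) that]
      integrable_lebesgue_on_initial[OF vw(1) that] integrable_lebesgue_on_initial[OF vw(2) that]
    by simp
  have "AE x in lebesgue. g x = 0"
  proof (rule AE_eq_0_if_initial_integrals_0[OF g])
    fix x :: real
    have "(LINT s:{..x}|lebesgue. g s) = (LINT s|lebesgue. (if s \<in> {..x} \<inter> {0..1} then v s - w s else 0))"
      unfolding set_lebesgue_integral_def g_def
      by (intro Bochner_Integration.integral_cong) (auto simp: indicator_def)
    also have "\<dots> = (LINT s|lebesgue_on ({..x} \<inter> {0..1}). v s - w s)"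
      by (rule Lebesgue_Measure.integral_restrict_UNIV) auto
    also have "{..x} \<inter> {0..1} = (if x < 0 then {} else {0..min x 1})"
      by auto
    also have "(LINT s|lebesgue_on (if x < 0 then {} else {0..min x 1}). v s - w s) = 0"
      using initial[of "min x 1"] by (auto simp del: lebesgue_on_UNIV_eq)
    finally show "(LINT s:{..x}|lebesgue. g s) = 0" .
  next
    have "integral\<^sup>L lebesgue g = (LINT s|I01. v s - w s)"
      unfolding g_def by (rule Lebesgue_Measure.integral_restrict_UNIV) auto
    with initial[of 1] show "integral\<^sup>L lebesgue g = 0" by simp
  qed
  then show ?thesis
    by (auto simp: AE_restrict_space_iff g_def elim!: eventually_mono)
qed

lemma h1_norm_eq:
  assumes "has_weak_deriv u w"
  shows "h1_norm u = sqrt ((l2_norm u)\<^sup>2 + (l2_norm w)\<^sup>2)"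
proof -
  note wd = has_weak_deriv_wderiv[OF assms]
  have "l2_inner (wderiv u) (wderiv u) = l2_inner w w"
    unfolding l2_inner_def
  proof (rule integral_cong_AE)
    show "AE x in I01. wderiv u x * wderiv u x = w x * w x"
      using weak_deriv_unique_AE[OF wd assms] by eventually_elim simp
  qed (use wd assms in \<open>auto dest!: has_weak_derivD(1) simp: L2_def\<close>)
  then show ?thesis
    by (simp add: h1_norm_def l2_norm_def)
qed

section \<open>The first eigenfunction and the graph of the invariant manifold\<close>

lemma l2_norm_scale: "l2_norm (\<lambda>x. c * u x) = \<bar>c\<bar> * l2_norm u"
proof -
  have "l2_inner (\<lambda>x. c * u x) (\<lambda>x. c * u x) = (LINT x|I01. c\<^sup>2 * (u x * u x))"
    unfolding l2_inner_def by (rule arg_cong[where f = "integral\<^sup>L I01"]) (auto simp: power2_eq_square)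
  then show ?thesis
    by (simp add: l2_norm_def l2_inner_def real_sqrt_mult)
qed

lemma l2_norm_le_sup:
  assumes "u \<in> L2" "\<And>x. x \<in> {0..1} \<Longrightarrow> \<bar>u x\<bar> \<le> \<delta>"
  shows "l2_norm u \<le> \<delta>"
proof -
  interpret finite_measure I01 by (simp add: finite_measure_lebesgue_on)
  have "0 \<le> \<delta>" using assms(2)[of 0] by auto
  have "(LINT x|I01. (u x)\<^sup>2) \<le> (LINT x|I01. \<delta>\<^sup>2)"
  proof (intro integral_mono)
    fix x :: real assume "x \<in> space I01"
    then show "(u x)\<^sup>2 \<le> \<delta>\<^sup>2"
      using assms(2)[of x] by (simp add: abs_le_square_iff[symmetric])
  qed (use assms(1) in \<open>auto simp: L2_def\<close>)
  then have "l2_inner u u \<le> \<delta>\<^sup>2"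
    by (simp add: l2_inner_def power2_eq_square)
  then show ?thesis
    using \<open>0 \<le> \<delta>\<close> by (simp add: l2_norm_def real_le_lsqrt)
qed

text \<open>
The flux \<open>a phi'\<close> vanishes at \<open>0\<close> and has the weak derivative \<open>(lam - mu) phi\<close>, of \<open>L\<^sup>2\<close> norm
\<open>|mu - lam|\<close>, so it is bounded by \<open>|mu - lam|\<close> everywhere; it remains to divide by \<open>a\<close>.
\<close>

lemma eigenfunction_weak_deriv_le:
  assumes eig: "eigenpair a lam beta mu (phi, 0)" and phi: "l2_norm phi = 1"
    and a: "0 < m0" "\<And>x. x \<in> {0..1} \<Longrightarrow> m0 \<le> a x"
  shows "\<exists>ux. has_weak_deriv phi ux \<and> (\<forall>x\<in>{0..1}. \<bar>ux x\<bar> \<le> \<bar>mu - lam\<bar> / m0)"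
proof -
  obtain ux q where ux: "has_weak_deriv phi ux" and q: "has_weak_deriv (\<lambda>x. a x * ux x) q"
    and bc: "a 0 * ux 0 = 0" and ode: "AE x in I01. mu * phi x = - q x + lam * phi x"
    using eig by (auto simp: eigenpair_def A_graph_def)
  have [measurable]: "q \<in> borel_measurable I01"
    using has_weak_derivD(1)[OF q] by (auto simp: L2_def)
  have "phi \<in> L2"
    using ux by (intro continuous_in_L2 H1_continuous) (auto simp: H1_def)
  then have [measurable]: "phi \<in> borel_measurable I01"
    by (auto simp: L2_def)
  have "l2_inner q q = l2_inner (\<lambda>x. (lam - mu) * phi x) (\<lambda>x. (lam - mu) * phi x)"
    unfolding l2_inner_def
  proof (rule integral_cong_AE)
    show "AE x in I01. q x * q x = (lam - mu) * phi x * ((lam - mu) * phi x)"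
      using ode
    proof eventually_elim
      case (elim x)
      then have "q x = (lam - mu) * phi x" by (simp add: algebra_simps)
      then show ?case by simp
    qed
  qed measurable
  then have lq: "l2_norm q = \<bar>mu - lam\<bar>"
    using l2_norm_scale[of "lam - mu" phi] phi by (simp add: l2_norm_def)
  have "\<bar>ux x\<bar> \<le> \<bar>mu - lam\<bar> / m0" if x: "x \<in> {0..1}" for x
  proof -
    have "m0 * \<bar>ux x\<bar> \<le> a x * \<bar>ux x\<bar>"
      using a(2)[OF x] by (intro mult_right_mono) auto
    also have "\<dots> = \<bar>a x * ux x - a 0 * ux 0\<bar>"
      unfolding bc using a(1) a(2)[OF x] by (simp add: abs_mult)
    also have "\<dots> \<le> \<bar>mu - lam\<bar>"
      using weak_deriv_increment_le[OF q x] lq by simp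
    finally show ?thesis
      using a(1) by (simp add: field_simps)
  qed
  with ux show ?thesis by blast
qed

lemma eigenfunction_near_1:
  assumes ux: "has_weak_deriv phi ux" "\<And>x. x \<in> {0..1} \<Longrightarrow> \<bar>ux x\<bar> \<le> \<delta>" and x: "x \<in> {0..1}"
  shows "\<bar>phi x - 1\<bar> \<le> l2_norm (\<lambda>x. phi x - 1) + 2 * \<delta>"
proof (rule abs_le_l2_norm_plus_oscillation)
  have "phi \<in> H1" using ux by (auto simp: H1_def)
  then show "(\<lambda>x. phi x - 1) \<in> L2"
    by (intro continuous_in_L2 continuous_intros H1_continuous)
  have "l2_norm ux \<le> \<delta>"
    using ux by (intro l2_norm_le_sup) (auto dest: has_weak_derivD(1))
  then show "\<bar>phi x - 1\<bar> \<le> \<bar>phi y - 1\<bar> + 2 * \<delta>" if "y \<in> {0..1}" for y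
    using weak_deriv_increment_le[OF ux(1) x] weak_deriv_increment_le[OF ux(1) that] by linarith
qed

text \<open>
On \<open>Y phi\<close> the norm of \<open>H\<^sup>1 \<times> L\<^sup>2\<^sub>c\<close> is equivalent to the Euclidean norm of the coordinates, with
constants that are independent of \<open>phi\<close>.
\<close>

lemma st_norm_Yel_bounds:
  assumes ux: "has_weak_deriv phi ux" and phi: "l2_norm phi = 1" and "l2_norm ux \<le> 1"
  shows "norm (h, k) \<le> st_norm (Yel phi h k)" "st_norm (Yel phi h k) \<le> 2 * norm (h, k)"
proof -
  have "has_weak_deriv (\<lambda>x. h * phi x) (\<lambda>x. h * ux x)"
    using has_weak_deriv_lincomb[OF ux ux, of h 0] by simp
  then have st: "(st_norm (Yel phi h k))\<^sup>2 = h\<^sup>2 + h\<^sup>2 * (l2_norm ux)\<^sup>2 + k\<^sup>2"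
    using phi by (simp add: st_norm_def Yel_def h1_norm_eq l2_norm_scale power_mult_distrib)
  have "(l2_norm ux)\<^sup>2 \<le> 1"
    using assms(3) by (simp add: power_le_one)
  then have "h\<^sup>2 * (l2_norm ux)\<^sup>2 \<le> h\<^sup>2"
    by (simp add: mult_left_le)
  moreover have "(norm (h, k))\<^sup>2 = h\<^sup>2 + k\<^sup>2"
    by (simp add: norm_Pair)
  moreover have "0 \<le> h\<^sup>2 * (l2_norm ux)\<^sup>2" "0 \<le> h\<^sup>2" "0 \<le> k\<^sup>2"
    by simp_all
  moreover have "(2 * norm (h, k))\<^sup>2 = 4 * (norm (h, k))\<^sup>2"
    by (simp add: power_mult_distrib)
  ultimately have "(norm (h, k))\<^sup>2 \<le> (st_norm (Yel phi h k))\<^sup>2"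
    "(st_norm (Yel phi h k))\<^sup>2 \<le> (2 * norm (h, k))\<^sup>2"
    unfolding st by linarith+
  then show "norm (h, k) \<le> st_norm (Yel phi h k)" "st_norm (Yel phi h k) \<le> 2 * norm (h, k)"
    by (auto intro: power2_le_imp_le)
qed

lemma lc_Yel: "lc b (Yel phi u v) c (Yel phi h k) = Yel phi (b * u + c * h) (b * v + c * k)"
  by (auto simp: lc_def Yel_def algebra_simps)

lemma h1_norm_fst_le: "h1_norm (fst U) \<le> st_norm U"
  unfolding st_norm_def by (rule real_le_rsqrt) simp

text \<open>
The derivative of \<open>theta\<close> with respect to its parameters \<open>(u, v)\<close>, given here as a pair.
\<close>

definition theta_deriv ::
    "(real \<Rightarrow> real) \<Rightarrow> (state \<Rightarrow> state \<Rightarrow> state) \<Rightarrow> real \<times> real \<Rightarrow> real \<times> real \<Rightarrow> real \<Rightarrow> real" where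
  "theta_deriv phi Ds q h = fst (Ds (Yel phi (fst q) (snd q)) (Yel phi (fst h) (snd h)))"

text \<open>
\<open>W\<close> is Frechet differentiable at \<open>q\<close> as a map into the continuous functions on \<open>[0,1]\<close> with the
sup norm, and \<open>S\<close> is its derivative. Functions on the line that agree on \<open>[0,1]\<close> are not identified,
which is why all conditions are restricted to \<open>{0..1}\<close>.
\<close>

definition unif_deriv ::
    "('a::euclidean_space \<Rightarrow> real \<Rightarrow> real) \<Rightarrow> ('a \<Rightarrow> real \<Rightarrow> real) \<Rightarrow> 'a \<Rightarrow> bool" where
  "unif_deriv W S q \<longleftrightarrow>
     (\<forall>p. continuous_on {0..1} (W p)) \<and> (\<forall>h. continuous_on {0..1} (S h)) \<and>
     (\<forall>x\<in>{0..1}. linear (\<lambda>h. S h x)) \<and> (\<exists>B\<ge>0. \<forall>h. \<forall>x\<in>{0..1}. \<bar>S h x\<bar> \<le> B * norm h) \<and>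
     (\<forall>e>0. \<exists>\<delta>>0. \<forall>h. norm h < \<delta> \<longrightarrow>
        (\<forall>x\<in>{0..1}. \<bar>W (q + h) x - W q x - S h x\<bar> \<le> e * norm h))"

lemma C1_into_Y_perpD:
  assumes "C1_into_Y_perp phi s Ds" "V \<in> Y phi"
  shows "fst (s V) \<in> H1"
    and "H \<in> Y phi \<Longrightarrow> fst (Ds V H) \<in> H1"
    and "H \<in> Y phi \<Longrightarrow> J \<in> Y phi \<Longrightarrow> st_eq (Ds V (lc b H c J)) (lc b (Ds V H) c (Ds V J))"
    and "0 < e \<Longrightarrow> \<exists>\<delta>>0. \<forall>H\<in>Y phi. st_norm H < \<delta> \<longrightarrow>
        st_norm (st_diff (st_diff (s (lc 1 V 1 H)) (s V)) (Ds V H)) \<le> e * st_norm H"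
  using assms unfolding C1_into_Y_perp_def Y_perp_def by blast+

lemma theta_sup_le:
  assumes "C1_into_Y_perp phi s Ds" "\<And>V. V \<in> Y phi \<Longrightarrow> st_norm (s V) \<le> \<sigma>" "x \<in> {0..1}"
  shows "\<bar>theta phi s u v x\<bar> \<le> 3 * \<sigma>"
proof -
  have Y: "Yel phi u v \<in> Y phi" by (auto simp: Y_def)
  then have "fst (s (Yel phi u v)) \<in> H1"
    by (rule C1_into_Y_perpD(1)[OF assms(1)])
  from H1_sup_le[OF this assms(3)] h1_norm_fst_le[of "s (Yel phi u v)"] assms(2)[OF Y]
  show ?thesis by (simp add: theta_def)
qed

text \<open>
The operator norm bounds the difference quotient only where \<open>st_norm H\<close> is nonzero; at \<open>h = 0\<close> the
value vanishes by linearity. The factor 6 combines the embedding constant 3 with the upper constant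
2 of \<open>st_norm_Yel_bounds\<close>.
\<close>

lemma theta_deriv_sup_le:
  assumes C1: "C1_into_Y_perp phi s Ds"
    and op: "\<And>V. V \<in> Y phi \<Longrightarrow> Y_opnorm phi (Ds V) \<le> ennreal \<sigma>" and "0 \<le> \<sigma>"
    and ux: "has_weak_deriv phi ux" and phi: "l2_norm phi = 1" and "l2_norm ux \<le> 1"
    and x: "x \<in> {0..1}"
  shows "\<bar>theta_deriv phi Ds q h x\<bar> \<le> 6 * \<sigma> * norm h"
proof -
  define V H where "V = Yel phi (fst q) (snd q)" and "H = Yel phi (fst h) (snd h)"
  have Y: "V \<in> Y phi" "H \<in> Y phi" by (auto simp: Y_def V_def H_def)
  have sup: "\<bar>fst (Ds V H) x\<bar> \<le> 3 * st_norm (Ds V H)"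
    using H1_sup_le[OF C1_into_Y_perpD(2)[OF C1 Y] x] h1_norm_fst_le[of "Ds V H"] by linarith
  note bnds = st_norm_Yel_bounds[OF ux phi \<open>l2_norm ux \<le> 1\<close>, of "fst h" "snd h", folded H_def]
  show ?thesis
  proof (cases "h = 0")
    case True
    have "st_eq (Ds V (lc 0 H 0 H)) (lc 0 (Ds V H) 0 (Ds V H))"
      by (rule C1_into_Y_perpD(3)[OF C1 Y Y(2)])
    moreover have "lc 0 H 0 H = H"
      using True by (simp add: H_def lc_Yel)
    ultimately show ?thesis
      using x True by (auto simp: st_eq_def lc_def theta_deriv_def V_def H_def)
  next
    case False
    then have "0 < norm (fst h, snd h)" by simp
    with bnds have pos: "0 < st_norm H" by linarith
    have "ennreal (st_norm (Ds V H) / st_norm H) \<le> Y_opnorm phi (Ds V)"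
      unfolding Y_opnorm_def using pos Y by (intro SUP_upper) auto
    also have "\<dots> \<le> ennreal \<sigma>"
      by (rule op[OF Y(1)])
    finally have "st_norm (Ds V H) \<le> \<sigma> * st_norm H"
      using pos \<open>0 \<le> \<sigma>\<close> by (simp add: ennreal_le_iff divide_le_eq)
    also have "\<dots> \<le> \<sigma> * (2 * norm h)"
      using bnds(2) \<open>0 \<le> \<sigma>\<close> by (intro mult_left_mono) auto
    finally show ?thesis
      using sup by (simp add: theta_deriv_def V_def H_def)
  qed
qed

text \<open>
Differentiability of \<open>s\<close> in \<open>H\<^sup>1 \<times> L\<^sup>2\<^sub>c\<close> passes to the sup norm by the embedding of \<open>H\<^sup>1\<close>.
\<close>

lemma theta_unif_deriv:
  assumes C1: "C1_into_Y_perp phi s Ds"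
    and op: "\<And>V. V \<in> Y phi \<Longrightarrow> Y_opnorm phi (Ds V) \<le> ennreal \<sigma>" and "0 \<le> \<sigma>"
    and ux: "has_weak_deriv phi ux" and phi: "l2_norm phi = 1" and "l2_norm ux \<le> 1"
  shows "unif_deriv (\<lambda>q. theta phi s (fst q) (snd q)) (theta_deriv phi Ds q) q"
  unfolding unif_deriv_def
proof (intro conjI allI ballI impI)
  have Y: "Yel phi u v \<in> Y phi" for u v by (auto simp: Y_def)
  have sH1: "fst (s (Yel phi u v)) \<in> H1" for u v
    by (rule C1_into_Y_perpD(1)[OF C1 Y])
  have DH1: "fst (Ds (Yel phi u v) (Yel phi h k)) \<in> H1" for u v h k
    by (rule C1_into_Y_perpD(2)[OF C1 Y Y])
  show "continuous_on {0..1} (theta phi s (fst p) (snd p))" for p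
    unfolding theta_def by (intro H1_continuous sH1)
  show "continuous_on {0..1} (theta_deriv phi Ds q h)" for h
    unfolding theta_deriv_def by (intro H1_continuous DH1)
  define V where "V = Yel phi (fst q) (snd q)"
  have V: "V \<in> Y phi" by (simp add: V_def Y)
  have lin: "fst (Ds V (lc b H c J)) x = b * fst (Ds V H) x + c * fst (Ds V J) x"
    if "H \<in> Y phi" "J \<in> Y phi" "x \<in> {0..1}" for H J b c x
  proof -
    have "st_eq (Ds V (lc b H c J)) (lc b (Ds V H) c (Ds V J))"
      using C1_into_Y_perpD(3)[OF C1 V that(1,2)] .
    then show ?thesis
      using that(3) by (simp add: st_eq_def lc_def)
  qed
  show "linear (\<lambda>h. theta_deriv phi Ds q h x)" if "x \<in> {0..1}" for x
  proof (rule linearI)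
    fix h k :: "real \<times> real" and c :: real
    show "theta_deriv phi Ds q (h + k) x = theta_deriv phi Ds q h x + theta_deriv phi Ds q k x"
      using lin[OF Y Y that, of 1 "fst h" "snd h" 1 "fst k" "snd k"]
      by (simp add: theta_deriv_def lc_Yel V_def)
    show "theta_deriv phi Ds q (c *\<^sub>R h) x = c *\<^sub>R theta_deriv phi Ds q h x"
      using lin[OF Y Y that, of c "fst h" "snd h" 0 "fst k" "snd k"]
      by (simp add: theta_deriv_def lc_Yel V_def)
  qed
  show "\<exists>B\<ge>0. \<forall>h. \<forall>x\<in>{0..1}. \<bar>theta_deriv phi Ds q h x\<bar> \<le> B * norm h"
    using theta_deriv_sup_le[OF assms] \<open>0 \<le> \<sigma>\<close> by (intro exI[of _ "6 * \<sigma>"]) auto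
  fix e :: real assume "e > 0"
  then have "\<exists>\<delta>>0. \<forall>H\<in>Y phi. st_norm H < \<delta> \<longrightarrow>
        st_norm (st_diff (st_diff (s (lc 1 V 1 H)) (s V)) (Ds V H)) \<le> e / 6 * st_norm H"
    by (intro C1_into_Y_perpD(4)[OF C1 V]) simp
  then obtain \<delta> where "\<delta> > 0" and \<delta>: "\<And>H. H \<in> Y phi \<Longrightarrow> st_norm H < \<delta> \<Longrightarrow>
        st_norm (st_diff (st_diff (s (lc 1 V 1 H)) (s V)) (Ds V H)) \<le> e / 6 * st_norm H"
    by blast
  show "\<exists>\<delta>>0. \<forall>h. norm h < \<delta> \<longrightarrow> (\<forall>x\<in>{0..1}.
      \<bar>theta phi s (fst (q + h)) (snd (q + h)) x - theta phi s (fst q) (snd q) x - theta_deriv phi Ds q h x\<bar>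
        \<le> e * norm h)"
  proof (intro exI[of _ "\<delta> / 2"] conjI allI impI ballI)
    fix h :: "real \<times> real" and x :: real
    assume h: "norm h < \<delta> / 2" and x: "x \<in> {0..1}"
    define H where "H = Yel phi (fst h) (snd h)"
    note bnds = st_norm_Yel_bounds[OF ux phi \<open>l2_norm ux \<le> 1\<close>, of "fst h" "snd h", folded H_def]
    define R where "R = st_diff (st_diff (s (lc 1 V 1 H)) (s V)) (Ds V H)"
    have shift: "lc 1 V 1 H = Yel phi (fst (q + h)) (snd (q + h))"
      by (simp add: V_def H_def lc_Yel)
    have Rx: "fst R x = theta phi s (fst (q + h)) (snd (q + h)) x - theta phi s (fst q) (snd q) x
        - theta_deriv phi Ds q h x"
      unfolding R_def shift by (simp add: st_diff_def lc_def theta_def theta_deriv_def V_def H_def)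
    have "(\<lambda>x. 1 * fst (s (lc 1 V 1 H)) x + (-1) * fst (s V) x) \<in> H1"
      unfolding shift unfolding V_def by (intro H1_lincomb sH1)
    moreover have "fst (Ds V H) \<in> H1"
      unfolding V_def H_def by (rule DH1)
    ultimately have "(\<lambda>x. 1 * (1 * fst (s (lc 1 V 1 H)) x + (-1) * fst (s V) x) + (-1) * fst (Ds V H) x) \<in> H1"
      by (rule H1_lincomb)
    then have "fst R \<in> H1"
      unfolding R_def st_diff_def by (simp add: lc_def)
    then have "\<bar>fst R x\<bar> \<le> 3 * st_norm R"
      using H1_sup_le[of "fst R" x] x h1_norm_fst_le[of R] by fastforce
    also have "st_norm R \<le> e / 6 * st_norm H"
      unfolding R_def using h bnds by (intro \<delta>) (auto simp: H_def Y)
    also have "\<dots> \<le> e / 6 * (2 * norm h)"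
      using bnds \<open>e > 0\<close> by (intro mult_left_mono) auto
    finally show "\<bar>theta phi s (fst (q + h)) (snd (q + h)) x - theta phi s (fst q) (snd q) x
        - theta_deriv phi Ds q h x\<bar> \<le> e * norm h"
      by (simp add: Rx)
  qed (use \<open>\<delta> > 0\<close> in auto)
qed

section \<open>Superposition operators\<close>

text \<open>
Chain rule for the superposition operator \<open>W \<mapsto> F \<circ> W\<close> on continuous functions. By the mean value
theorem the remainder is \<open>(F' w - F' y) (z - y) + F' y (z - y - S h x)\<close> with \<open>w\<close> between \<open>y = W q x\<close>
and \<open>z = W (q + h) x\<close>. The values of \<open>W q\<close> lie in a compact interval, on a neighbourhood of which \<open>F'\<close>
is uniformly continuous, so the estimate is uniform in \<open>x\<close>.
\<close>

lemma unif_deriv_Nemytskii: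
  assumes W: "unif_deriv W S q"
    and F: "\<And>x. (F has_real_derivative F' x) (at x)" and F': "continuous_on UNIV F'"
  shows "unif_deriv (\<lambda>p x. F (W p x)) (\<lambda>h x. F' (W q x) * S h x) q"
  unfolding unif_deriv_def
proof (intro conjI allI ballI impI)
  have Wc: "continuous_on {0..1} (W p)" and Sc: "continuous_on {0..1} (S h)" for p h
    using W by (auto simp: unif_deriv_def)
  obtain B where "B \<ge> 0" and B: "\<And>h x. x \<in> {0..1} \<Longrightarrow> \<bar>S h x\<bar> \<le> B * norm h"
    using W unfolding unif_deriv_def by blast
  have Fc: "continuous_on UNIV F"
    using F by (intro continuous_at_imp_continuous_on) (auto intro: DERIV_isCont)
  show "continuous_on {0..1} (\<lambda>x. F (W p x))" for p
    by (rule continuous_on_compose2[OF Fc Wc]) simp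
  have F'Wc: "continuous_on {0..1} (\<lambda>x. F' (W q x))"
    by (rule continuous_on_compose2[OF F' Wc]) simp
  show "continuous_on {0..1} (\<lambda>x. F' (W q x) * S h x)" for h
    by (intro continuous_intros F'Wc Sc)
  show "linear (\<lambda>h. F' (W q x) * S h x)" if "x \<in> {0..1}" for x
  proof -
    have "linear (\<lambda>h. S h x)" using W that by (auto simp: unif_deriv_def)
    from linear_compose_scale_right[OF this, of "F' (W q x)"] show ?thesis by simp
  qed
  have "compact (W q ` {0..1})"
    by (intro compact_continuous_image Wc) simp
  then obtain R where "R > 0" and R: "\<And>x. x \<in> {0..1} \<Longrightarrow> \<bar>W q x\<bar> \<le> R"
    using compact_imp_bounded[of "W q ` {0..1}"] unfolding bounded_pos by auto
  have cpt: "compact (F' ` {-(R+1)..R+1})"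
    by (intro compact_continuous_image continuous_on_subset[OF F']) auto
  obtain L where "L > 0" and L: "\<And>y. y \<in> {-(R+1)..R+1} \<Longrightarrow> \<bar>F' y\<bar> \<le> L"
    using compact_imp_bounded[OF cpt] unfolding bounded_pos by auto
  have L': "\<bar>F' (W q x)\<bar> \<le> L" if "x \<in> {0..1}" for x
    using R[OF that] by (intro L) auto
  show "\<exists>B\<ge>0. \<forall>h. \<forall>x\<in>{0..1}. \<bar>F' (W q x) * S h x\<bar> \<le> B * norm h"
  proof (intro exI[of _ "L * B"] conjI allI ballI)
    fix h x assume "x \<in> {0..1::real}"
    then show "\<bar>F' (W q x) * S h x\<bar> \<le> L * B * norm h"
      unfolding abs_mult mult.assoc using L' B \<open>L > 0\<close> by (intro mult_mono) auto
  qed (use \<open>L > 0\<close> \<open>B \<ge> 0\<close> in auto)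
  fix e :: real assume "e > 0"
  \<comment> \<open>\<open>e1\<close> and \<open>e2\<close> make each of the two parts of the remainder at most \<open>e / 2 * norm h\<close>;
      \<open>e1 \<le> 1\<close> keeps \<open>z - y\<close> below \<open>(B + 1) * norm h\<close>.\<close>
  define e1 where "e1 = min 1 (e / (2 * L))"
  define e2 where "e2 = e / (2 * (B + 1))"
  have "e1 > 0" "e1 \<le> 1" "L * e1 \<le> e / 2"
    using \<open>L > 0\<close> \<open>e > 0\<close> by (auto simp: e1_def min_def field_simps)
  have "e2 > 0" "e2 * (B + 1) = e / 2"
    using \<open>B \<ge> 0\<close> \<open>e > 0\<close> by (auto simp: e2_def field_simps)
  have "uniformly_continuous_on {-(R+1)..R+1} F'"
    by (intro compact_uniformly_continuous continuous_on_subset[OF F']) auto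
  then obtain d2 where "d2 > 0" and d2:
    "\<And>y z. y \<in> {-(R+1)..R+1} \<Longrightarrow> z \<in> {-(R+1)..R+1} \<Longrightarrow> \<bar>z - y\<bar> < d2 \<Longrightarrow> \<bar>F' z - F' y\<bar> < e2"
    using \<open>e2 > 0\<close> unfolding uniformly_continuous_on_def dist_real_def by (metis abs_minus_commute)
  obtain d1 where "d1 > 0" and d1: "\<And>h x. norm h < d1 \<Longrightarrow> x \<in> {0..1} \<Longrightarrow>
      \<bar>W (q + h) x - W q x - S h x\<bar> \<le> e1 * norm h"
    using W \<open>e1 > 0\<close> unfolding unif_deriv_def by blast
  define d where "d = min d1 (min 1 d2 / (B + 1))"
  show "\<exists>\<delta>>0. \<forall>h. norm h < \<delta> \<longrightarrow> (\<forall>x\<in>{0..1}.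
      \<bar>F (W (q + h) x) - F (W q x) - F' (W q x) * S h x\<bar> \<le> e * norm h)"
  proof (intro exI[of _ d] conjI allI impI ballI)
    show "d > 0" using \<open>d1 > 0\<close> \<open>d2 > 0\<close> \<open>B \<ge> 0\<close> by (simp add: d_def)
    fix h :: 'a and x :: real assume h: "norm h < d" and x: "x \<in> {0..1}"
    define y z where "y = W q x" and "z = W (q + h) x"
    have rem: "\<bar>z - y - S h x\<bar> \<le> e1 * norm h"
      using d1[OF _ x] h by (auto simp: d_def y_def z_def)
    have e1h: "e1 * norm h \<le> 1 * norm h"
      using \<open>e1 \<le> 1\<close> by (rule mult_right_mono) simp
    then have zy: "\<bar>z - y\<bar> \<le> (B + 1) * norm h"
      using rem B[OF x, of h] by (simp add: algebra_simps)
    have "(B + 1) * norm h < min 1 d2"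
      using h \<open>B \<ge> 0\<close> by (simp add: d_def field_simps)
    with zy have zy': "\<bar>z - y\<bar> < 1" "\<bar>z - y\<bar> < d2" by auto
    have y: "\<bar>y\<bar> \<le> R" using R[OF x] by (simp add: y_def)
    have "\<exists>w. F z - F y = F' w * (z - y) \<and> \<bar>w - y\<bar> \<le> \<bar>z - y\<bar>"
    proof (cases y z rule: linorder_cases)
      case less
      from MVT2[OF this F] show ?thesis by (force simp: mult.commute)
    next
      case equal then show ?thesis by auto
    next
      case greater
      from MVT2[OF this F] obtain w where "z < w" "w < y" "F y - F z = (y - z) * F' w" by blast
      then show ?thesis by (intro exI[of _ w]) (auto simp: algebra_simps)
    qed
    then obtain w where w: "F z - F y = F' w * (z - y)" "\<bar>w - y\<bar> \<le> \<bar>z - y\<bar>" by blast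
    have "\<bar>F' w - F' y\<bar> \<le> e2"
      using w(2) zy' y by (intro less_imp_le d2) auto
    then have "\<bar>(F' w - F' y) * (z - y)\<bar> \<le> e2 * ((B + 1) * norm h)"
      unfolding abs_mult using zy by (intro mult_mono) auto
    also have "\<dots> = e / 2 * norm h"
      using \<open>e2 * (B + 1) = e / 2\<close> by (metis mult.assoc)
    finally have t1: "\<bar>(F' w - F' y) * (z - y)\<bar> \<le> e / 2 * norm h" .
    have "\<bar>F' y * (z - y - S h x)\<bar> \<le> L * (e1 * norm h)"
      unfolding abs_mult using rem L'[OF x] by (intro mult_mono) (auto simp: y_def)
    also have "\<dots> \<le> e / 2 * norm h"
      using \<open>L * e1 \<le> e / 2\<close> by (metis mult.assoc mult_right_mono norm_ge_zero)
    finally have t2: "\<bar>F' y * (z - y - S h x)\<bar> \<le> e / 2 * norm h" .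
    have "F z - F y - F' y * S h x = (F' w - F' y) * (z - y) + F' y * (z - y - S h x)"
      using w(1) by (simp add: algebra_simps)
    then show "\<bar>F (W (q + h) x) - F (W q x) - F' (W q x) * S h x\<bar> \<le> e * norm h"
      using t1 t2 unfolding y_def z_def by linarith
  qed
qed

lemma unif_deriv_eval:
  assumes W: "unif_deriv W S q" and x: "x \<in> {0..1}"
  shows "((\<lambda>p. W p x) has_derivative (\<lambda>h. S h x)) (at q)"
  unfolding has_derivative_within_alt
proof (intro conjI allI impI)
  show "bounded_linear (\<lambda>h. S h x)"
    using W x by (auto simp: unif_deriv_def linear_conv_bounded_linear)
next
  fix e :: real assume "e > 0"
  then obtain \<delta> where "\<delta> > 0" and "\<And>h. norm h < \<delta> \<Longrightarrow> \<bar>W (q + h) x - W q x - S h x\<bar> \<le> e * norm h"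
    using W x unfolding unif_deriv_def by meson
  from this(2)[of "_ - q"] this(1)
  show "\<exists>d>0. \<forall>y\<in>UNIV. norm (y - q) < d \<longrightarrow> norm (W y x - W q x - S (y - q) x) \<le> e * norm (y - q)"
    by (intro exI[of _ \<delta>]) auto
qed

lemma unif_deriv_integral:
  assumes W: "unif_deriv W S q" and g: "continuous_on {0..1} g"
  shows "((\<lambda>p. LINT x|I01. W p x * g x) has_derivative (\<lambda>h. LINT x|I01. S h x * g x)) (at q)"
  unfolding has_derivative_within_alt
proof (intro conjI allI impI)
  interpret finite_measure I01 by (simp add: finite_measure_lebesgue_on)
  have iW: "integrable I01 (\<lambda>x. W p x * g x)" and iS: "integrable I01 (\<lambda>x. S h x * g x)" for p h
    using W g unfolding unif_deriv_def by (blast intro: continuous_imp_integrable_real continuous_on_mult)+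
  have lin: "linear (\<lambda>h. S h x)" if "x \<in> {0..1}" for x
    using W that by (auto simp: unif_deriv_def)
  have "linear (\<lambda>h. LINT x|I01. S h x * g x)"
  proof (rule linearI)
    fix h k c
    have "(LINT x|I01. S (h + k) x * g x) = (LINT x|I01. S h x * g x + S k x * g x)"
      using lin by (intro Bochner_Integration.integral_cong) (auto simp: linear_add[OF lin] distrib_right)
    then show "(LINT x|I01. S (h + k) x * g x) = (LINT x|I01. S h x * g x) + (LINT x|I01. S k x * g x)"
      using iS by simp
    have "(LINT x|I01. S (c *\<^sub>R h) x * g x) = (LINT x|I01. c * (S h x * g x))"
      using lin by (intro Bochner_Integration.integral_cong) (auto simp: linear_cmul[OF lin])
    then show "(LINT x|I01. S (c *\<^sub>R h) x * g x) = c *\<^sub>R (LINT x|I01. S h x * g x)"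
      by simp
  qed
  then show "bounded_linear (\<lambda>h. LINT x|I01. S h x * g x)"
    by (simp add: linear_conv_bounded_linear)
  have "compact (g ` {0..1})"
    by (intro compact_continuous_image g) simp
  then obtain G where "G > 0" and G: "\<And>x. x \<in> {0..1} \<Longrightarrow> \<bar>g x\<bar> \<le> G"
    using compact_imp_bounded[of "g ` {0..1}"] unfolding bounded_pos by auto
  fix e :: real assume "e > 0"
  then have "e / G > 0" using \<open>G > 0\<close> by simp
  then obtain \<delta> where "\<delta> > 0" and \<delta>: "\<And>h x. norm h < \<delta> \<Longrightarrow> x \<in> {0..1} \<Longrightarrow>
      \<bar>W (q + h) x - W q x - S h x\<bar> \<le> e / G * norm h"
    using W unfolding unif_deriv_def by meson
  show "\<exists>d>0. \<forall>y\<in>UNIV. norm (y - q) < d \<longrightarrow>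
      norm ((LINT x|I01. W y x * g x) - (LINT x|I01. W q x * g x) - (LINT x|I01. S (y - q) x * g x))
        \<le> e * norm (y - q)"
  proof (intro exI[of _ \<delta>] conjI ballI impI)
    fix y assume y: "norm (y - q) < \<delta>"
    have "(LINT x|I01. W y x * g x) - (LINT x|I01. W q x * g x) - (LINT x|I01. S (y - q) x * g x)
        = (LINT x|I01. W y x * g x - W q x * g x - S (y - q) x * g x)"
      using iW iS by simp
    also have "norm \<dots> \<le> (LINT x|I01. \<bar>W y x * g x - W q x * g x - S (y - q) x * g x\<bar>)"
      unfolding real_norm_def by (rule integral_abs_bound)
    also have "\<dots> \<le> (LINT x|I01. e * norm (y - q))"
    proof (rule integral_mono)
      fix x assume "x \<in> space I01"
      then have x: "x \<in> {0..1}" by simp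
      have "W y x * g x - W q x * g x - S (y - q) x * g x = (W y x - W q x - S (y - q) x) * g x"
        by (simp add: algebra_simps)
      also have "\<bar>\<dots>\<bar> \<le> (e / G * norm (y - q)) * G"
        unfolding abs_mult using \<delta>[OF y x] G[OF x] by (intro mult_mono) auto
      finally show "\<bar>W y x * g x - W q x * g x - S (y - q) x * g x\<bar> \<le> e * norm (y - q)"
        using \<open>G > 0\<close> by simp
    qed (use iW iS in auto)
    finally show "norm ((LINT x|I01. W y x * g x) - (LINT x|I01. W q x * g x)
        - (LINT x|I01. S (y - q) x * g x)) \<le> e * norm (y - q)"
      by simp
  qed fact
qed

text \<open>
A substitute for uniform continuity of a bounded continuous function: where \<open>\<rho>\<close> is large the right
hand side exceeds the oscillation \<open>2 L\<close> of \<open>g\<close>, and elsewhere \<open>g\<close> is uniformly continuous.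
The weight also absorbs the perturbation \<open>u (phi - 1)\<close>, which grows linearly with \<open>u\<close>.
\<close>

lemma bounded_continuous_weighted_modulus:
  fixes g :: "real \<Rightarrow> real"
  assumes g: "continuous_on UNIV g" "\<And>x. \<bar>g x\<bar> \<le> L" and "\<kappa> > 0"
  obtains \<eta> where "\<eta> > 0"
    "\<And>u w \<rho>. \<bar>u\<bar> \<le> \<rho> \<Longrightarrow> \<bar>w - u\<bar> \<le> \<eta> * (1 + \<rho>) \<Longrightarrow> \<bar>g w - g u\<bar> \<le> \<kappa> * (1 + \<rho>)"
proof -
  define R where "R = 2 * L / \<kappa>"
  have "L \<ge> 0" using g(2)[of 0] by simp
  then have "R \<ge> 0" using \<open>\<kappa> > 0\<close> by (simp add: R_def)
  have "uniformly_continuous_on {-(R+1)..R+1} g"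
    by (intro compact_uniformly_continuous continuous_on_subset[OF g(1)]) auto
  then obtain d where "d > 0" and d:
    "\<And>y z. y \<in> {-(R+1)..R+1} \<Longrightarrow> z \<in> {-(R+1)..R+1} \<Longrightarrow> \<bar>z - y\<bar> < d \<Longrightarrow> \<bar>g z - g y\<bar> < \<kappa>"
    using \<open>\<kappa> > 0\<close> unfolding uniformly_continuous_on_def dist_real_def by (metis abs_minus_commute)
  define \<eta> where "\<eta> = min 1 (d / 2) / (1 + R)"
  show ?thesis
  proof (rule that)
    show "\<eta> > 0" using \<open>d > 0\<close> \<open>R \<ge> 0\<close> by (simp add: \<eta>_def)
    fix u w \<rho> assume u: "\<bar>u\<bar> \<le> \<rho>" and w: "\<bar>w - u\<bar> \<le> \<eta> * (1 + \<rho>)"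
    show "\<bar>g w - g u\<bar> \<le> \<kappa> * (1 + \<rho>)"
    proof (cases "\<rho> \<le> R")
      case True
      have "\<eta> * (1 + \<rho>) \<le> \<eta> * (1 + R)"
        using True \<open>\<eta> > 0\<close> by (intro mult_left_mono) auto
      also have "\<dots> = min 1 (d / 2)"
        using \<open>R \<ge> 0\<close> by (simp add: \<eta>_def)
      finally have "\<bar>w - u\<bar> \<le> min 1 (d / 2)" using w by simp
      then have "\<bar>w - u\<bar> < d" "\<bar>w - u\<bar> \<le> 1" using \<open>d > 0\<close> by auto
      then have "\<bar>g w - g u\<bar> < \<kappa>"
        using u True by (intro d) auto
      also have "\<kappa> \<le> \<kappa> * (1 + \<rho>)"
        using \<open>\<kappa> > 0\<close> u by (auto simp: algebra_simps)
      finally show ?thesis by simp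
    next
      case False
      have "\<bar>g w - g u\<bar> \<le> 2 * L" using g(2)[of w] g(2)[of u] by linarith
      also have "2 * L = \<kappa> * R" using \<open>\<kappa> > 0\<close> by (simp add: R_def)
      also have "\<dots> \<le> \<kappa> * (1 + \<rho>)" using False \<open>\<kappa> > 0\<close> by (intro mult_left_mono) auto
      finally show ?thesis .
    qed
  qed
qed

section \<open>Weighted convergence of the planar fields\<close>

text \<open>
The Lipschitz constant bounds the difference quotients and hence the derivative.
\<close>

lemma truncation_derivative:
  assumes "truncation K p F"
  obtains F' L where "\<And>x. (F has_real_derivative F' x) (at x)" "continuous_on UNIV F'"
    "\<And>x. \<bar>F' x\<bar> \<le> L" "\<And>x y. \<bar>F x - F y\<bar> \<le> L * \<bar>x - y\<bar>" "0 \<le> L"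
proof -
  obtain F' where F': "\<And>x. (F has_real_derivative F' x) (at x)" "continuous_on UNIV F'"
    using assms by (auto simp: truncation_def C1_differentiable_on_def has_real_derivative_iff_has_vector_derivative)
  obtain L where L: "L-lipschitz_on UNIV F"
    using assms by (auto simp: truncation_def)
  have lip: "\<bar>F x - F y\<bar> \<le> L * \<bar>x - y\<bar>" for x y
    using lipschitz_onD[OF L, of x y] by (simp add: dist_real_def)
  have "\<bar>F' x\<bar> \<le> L" for x
  proof -
    have "((\<lambda>h. (F (x + h) - F x) / h) \<longlongrightarrow> F' x) (at 0)"
      using F'(1)[of x] by (simp add: DERIV_def)
    then have "norm (F' x) \<le> L"
    proof (rule Lim_norm_ubound[rotated])
      have "norm ((F (x + h) - F x) / h) \<le> L" if "h \<noteq> 0" for h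
        using lip[of "x + h" x] that by (simp add: abs_divide divide_le_eq)
      then show "\<forall>\<^sub>F h in at 0. norm ((F (x + h) - F x) / h) \<le> L"
        by (auto simp: eventually_at_filter)
    qed simp
    then show ?thesis by simp
  qed
  with F' lip lipschitz_on_nonneg[OF L] show ?thesis by (intro that)
qed

text \<open>
The first component of the point of the invariant manifold above \<open>q\<close>.
\<close>

definition profile :: "(real \<Rightarrow> real) \<Rightarrow> (state \<Rightarrow> state) \<Rightarrow> real \<times> real \<Rightarrow> real \<Rightarrow> real" where
  "profile phi s q x = fst q * phi x + theta phi s (fst q) (snd q) x"

definition profile_deriv ::
    "(real \<Rightarrow> real) \<Rightarrow> (state \<Rightarrow> state \<Rightarrow> state) \<Rightarrow> real \<times> real \<Rightarrow> real \<times> real \<Rightarrow> real \<Rightarrow> real" where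
  "profile_deriv phi Ds q h x = fst h * phi x + theta_deriv phi Ds q h x"

lemma abs_components_le:
  "\<bar>fst q\<bar> \<le> norm (q :: real \<times> real)" "\<bar>snd q\<bar> \<le> norm (q :: real \<times> real)"
  using norm_fst_le[of "fst q" "snd q"] norm_snd_le[of "snd q" "fst q"] by simp_all

lemma profile_unif_deriv:
  assumes C1: "C1_into_Y_perp phi s Ds"
    and op: "\<And>V. V \<in> Y phi \<Longrightarrow> Y_opnorm phi (Ds V) \<le> ennreal \<sigma>" and \<sigma>: "0 \<le> \<sigma>"
    and ux: "has_weak_deriv phi ux" and phi: "l2_norm phi = 1" and ux1: "l2_norm ux \<le> 1"
  shows "unif_deriv (profile phi s) (profile_deriv phi Ds q) q"
proof -
  define T where "T = theta_deriv phi Ds q"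
  have \<theta>: "unif_deriv (\<lambda>q. theta phi s (fst q) (snd q)) T q"
    unfolding T_def using C1 op \<sigma> ux phi ux1 by (rule theta_unif_deriv)
  have c: "continuous_on {0..1} phi"
    using ux by (intro H1_continuous) (auto simp: H1_def)
  show ?thesis
    unfolding unif_deriv_def
  proof (intro conjI allI ballI)
    show "continuous_on {0..1} (profile phi s p)" for p
      using \<theta> unfolding profile_def unif_deriv_def by (intro continuous_intros c) auto
    show "continuous_on {0..1} (profile_deriv phi Ds q h)" for h
    proof -
      have "continuous_on {0..1} (T h)" using \<theta> unfolding unif_deriv_def by blast
      then show ?thesis
        unfolding profile_deriv_def T_def[symmetric] by (intro continuous_intros c)
    qed
    show "linear (\<lambda>h. profile_deriv phi Ds q h x)" if "x \<in> {0..1}" for x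
    proof -
      have "linear (\<lambda>h. T h x)" using \<theta> that by (auto simp: unif_deriv_def)
      moreover have "linear (\<lambda>h::real \<times> real. fst h * phi x)"
        by (intro linearI) (auto simp: algebra_simps)
      ultimately show ?thesis
        unfolding profile_deriv_def T_def[symmetric] by (intro linear_compose_add)
    qed
    obtain B where B: "B \<ge> 0" "\<And>h x. x \<in> {0..1} \<Longrightarrow> \<bar>T h x\<bar> \<le> B * norm h"
      using \<theta> unfolding unif_deriv_def by blast
    have "compact (phi ` {0..1})"
      by (intro compact_continuous_image c) simp
    then obtain G where "G > 0" and G: "\<And>x. x \<in> {0..1} \<Longrightarrow> \<bar>phi x\<bar> \<le> G"
      using compact_imp_bounded[of "phi ` {0..1}"] unfolding bounded_pos by auto
    show "\<exists>B\<ge>0. \<forall>h. \<forall>x\<in>{0..1}. \<bar>profile_deriv phi Ds q h x\<bar> \<le> B * norm h"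
    proof (intro exI[of _ "G + B"] conjI allI ballI)
      fix h :: "real \<times> real" and x :: real assume x: "x \<in> {0..1}"
      have "\<bar>fst h * phi x\<bar> \<le> norm h * G"
        unfolding abs_mult using G[OF x] abs_components_le(1)[of h] by (intro mult_mono) auto
      with B(2)[OF x, of h] show "\<bar>profile_deriv phi Ds q h x\<bar> \<le> (G + B) * norm h"
        unfolding profile_deriv_def T_def by (simp add: algebra_simps)
    qed (use B \<open>G > 0\<close> in auto)
    have "profile phi s (q + h) x - profile phi s q x - profile_deriv phi Ds q h x =
      theta phi s (fst (q + h)) (snd (q + h)) x - theta phi s (fst q) (snd q) x - T h x" for h x
      by (simp add: profile_def profile_deriv_def T_def algebra_simps)
    then show "0 < e \<longrightarrow> (\<exists>\<delta>>0. \<forall>h. norm h < \<delta> \<longrightarrow> (\<forall>x\<in>{0..1}.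
        \<bar>profile phi s (q + h) x - profile phi s q x - profile_deriv phi Ds q h x\<bar> \<le> e * norm h))" for e
      using \<theta> unfolding unif_deriv_def by presburger
  qed
qed

definition DX_zero ::
    "real \<Rightarrow> real \<Rightarrow> (real \<Rightarrow> real) \<Rightarrow> (real \<Rightarrow> real) \<Rightarrow> (real \<Rightarrow> real) \<Rightarrow> (real \<Rightarrow> real)
      \<Rightarrow> real \<times> real \<Rightarrow> planar_field" where
  "DX_zero lam beta F1' F2' G1' G2' q h =
     (- lam * fst h + F1' (fst q) * fst h + G1' (snd q) * snd h,
      - beta * snd h + F2' (fst q) * fst h + G2' (snd q) * snd h)"

definition DX_eps ::
    "real \<Rightarrow> real \<Rightarrow> (real \<Rightarrow> real) \<Rightarrow> (real \<Rightarrow> real) \<Rightarrow> (real \<Rightarrow> real) \<Rightarrow> (real \<Rightarrow> real)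
      \<Rightarrow> (real \<Rightarrow> real) \<Rightarrow> (state \<Rightarrow> state) \<Rightarrow> (state \<Rightarrow> state \<Rightarrow> state) \<Rightarrow> real \<times> real \<Rightarrow> planar_field" where
  "DX_eps lam2 beta F1' F2' G1' G2' phi s Ds q h =
     (- lam2 * fst h + (LINT x|I01. F1' (profile phi s q x) * profile_deriv phi Ds q h x * phi x)
        + G1' (snd q) * snd h * phi 0,
      - beta * snd h + F2' (profile phi s q 0) * profile_deriv phi Ds q h 0 + G2' (snd q) * snd h)"

lemma X_zero_has_derivative:
  assumes F: "\<And>x. (F1 has_real_derivative F1' x) (at x)" "\<And>x. (F2 has_real_derivative F2' x) (at x)"
    and G: "\<And>x. (G1 has_real_derivative G1' x) (at x)" "\<And>x. (G2 has_real_derivative G2' x) (at x)"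
  shows "(X_zero lam beta F1 F2 G1 G2 has_derivative DX_zero lam beta F1' F2' G1' G2' q) (at q)"
  unfolding X_zero_def DX_zero_def case_prod_beta
  by (auto intro!: derivative_eq_intros DERIV_compose_FDERIV[OF F(1)] DERIV_compose_FDERIV[OF F(2)]
      DERIV_compose_FDERIV[OF G(1)] DERIV_compose_FDERIV[OF G(2)] simp: mult.commute)

lemma norm_DX_zero_le:
  assumes "\<And>x. \<bar>F1' x\<bar> \<le> L" "\<And>x. \<bar>F2' x\<bar> \<le> L" "\<And>x. \<bar>G1' x\<bar> \<le> L" "\<And>x. \<bar>G2' x\<bar> \<le> L"
  shows "norm (DX_zero lam beta F1' F2' G1' G2' q h) \<le> (\<bar>lam\<bar> + \<bar>beta\<bar> + 4 * L) * norm h"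
proof -
  have L: "0 \<le> L" using assms(1)[of 0] by linarith
  have t: "\<bar>c * fst h\<bar> \<le> M * norm h" "\<bar>c * snd h\<bar> \<le> M * norm h" if "\<bar>c\<bar> \<le> M" for c M
    unfolding abs_mult using that abs_components_le(1)[of h] abs_components_le(2)[of h] by (auto intro!: mult_mono)
  have abs3: "\<bar>- x + y + z\<bar> \<le> a + b + c" if "\<bar>x\<bar> \<le> a" "\<bar>y\<bar> \<le> b" "\<bar>z\<bar> \<le> c" for x y z a b c :: real
    using that by linarith
  have "norm (DX_zero lam beta F1' F2' G1' G2' q h)
      \<le> \<bar>- (lam * fst h) + F1' (fst q) * fst h + G1' (snd q) * snd h\<bar>
        + \<bar>- (beta * snd h) + F2' (fst q) * fst h + G2' (snd q) * snd h\<bar>"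
    unfolding DX_zero_def mult_minus_left
    by (rule order_trans[OF norm_Pair_le]) (simp only: real_norm_def order_refl)
  also have "\<dots> \<le> (\<bar>lam\<bar> * norm h + L * norm h + L * norm h) + (\<bar>beta\<bar> * norm h + L * norm h + L * norm h)"
    by (intro add_mono[OF abs3 abs3] t assms order_refl)
  also have "\<dots> = (\<bar>lam\<bar> + \<bar>beta\<bar> + 4 * L) * norm h"
    by (simp add: algebra_simps)
  finally show ?thesis .
qed

lemma X_eps_has_derivative:
  assumes F: "\<And>x. (F1 has_real_derivative F1' x) (at x)" "continuous_on UNIV F1'"
      "\<And>x. (F2 has_real_derivative F2' x) (at x)" "continuous_on UNIV F2'"
    and G: "\<And>x. (G1 has_real_derivative G1' x) (at x)" "\<And>x. (G2 has_real_derivative G2' x) (at x)"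
    and W: "unif_deriv (profile phi s) (profile_deriv phi Ds q) q" and phi: "continuous_on {0..1} phi"
  shows "(X_eps lam2 beta F1 F2 G1 G2 phi s has_derivative DX_eps lam2 beta F1' F2' G1' G2' phi s Ds q) (at q)"
proof -
  have X: "X_eps lam2 beta F1 F2 G1 G2 phi s = (\<lambda>q.
      (- lam2 * fst q + (LINT x|I01. F1 (profile phi s q x) * phi x) + G1 (snd q) * phi 0,
       - beta * snd q + F2 (profile phi s q 0) + G2 (snd q)))"
    by (simp add: X_eps_def profile_def fun_eq_iff)
  have i: "((\<lambda>p. LINT x|I01. F1 (profile phi s p x) * phi x) has_derivative
      (\<lambda>h. LINT x|I01. F1' (profile phi s q x) * profile_deriv phi Ds q h x * phi x)) (at q)"
    by (rule unif_deriv_integral[OF unif_deriv_Nemytskii[OF W F(1,2)] phi])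
  have ev: "((\<lambda>p. F2 (profile phi s p 0)) has_derivative
      (\<lambda>h. F2' (profile phi s q 0) * profile_deriv phi Ds q h 0)) (at q)"
    by (rule unif_deriv_eval[OF unif_deriv_Nemytskii[OF W F(3,4)]]) simp
  have g1: "((\<lambda>q. G1 (snd q)) has_derivative (\<lambda>h. G1' (snd q) * snd h)) (at q)"
    and g2: "((\<lambda>q. G2 (snd q)) has_derivative (\<lambda>h. G2' (snd q) * snd h)) (at q)"
    by (auto intro!: derivative_eq_intros DERIV_compose_FDERIV[OF G(1)] DERIV_compose_FDERIV[OF G(2)]
        simp: mult.commute)
  show ?thesis
    unfolding X DX_eps_def
    by (auto intro!: derivative_eq_intros i ev g1 g2)
qed

text \<open>
Everything about the data at a fixed \<open>\<epsilon>\<close> that enters the comparison with \<open>X_zero\<close>, measured by one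
parameter \<open>\<eta>\<close>. The factors 3 and 6 are the constants of \<open>theta_sup_le\<close> and \<open>theta_deriv_sup_le\<close>.
\<close>

definition near_limit ::
    "real \<Rightarrow> real \<Rightarrow> real \<Rightarrow> (real \<Rightarrow> real) \<Rightarrow> (state \<Rightarrow> state) \<Rightarrow> (state \<Rightarrow> state \<Rightarrow> state) \<Rightarrow> bool" where
  "near_limit \<eta> lam lam2 phi s Ds \<longleftrightarrow>
     \<bar>lam2 - lam\<bar> \<le> \<eta> \<and> continuous_on {0..1} phi \<and> (\<forall>x\<in>{0..1}. \<bar>phi x - 1\<bar> \<le> \<eta>) \<and>
     (\<forall>q. unif_deriv (profile phi s) (profile_deriv phi Ds q) q) \<and>
     (\<forall>u v. \<forall>x\<in>{0..1}. \<bar>theta phi s u v x\<bar> \<le> 3 * \<eta>) \<and>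
     (\<forall>q h. \<forall>x\<in>{0..1}. \<bar>theta_deriv phi Ds q h x\<bar> \<le> 6 * \<eta> * norm h)"

text \<open>
Weighted convergence of the planar fields in \<open>C\<^sup>1\<close>. The weight \<open>1 + norm q\<close> is there because
\<open>F1'\<close> and \<open>F2'\<close> are evaluated at a distance from \<open>fst q\<close> that grows with \<open>q\<close>. The last clause, whose
constant may depend on the data, yields linear growth of the field.
\<close>

lemma X_eps_close_to_X_zero:
  assumes F1: "\<And>x. (F1 has_real_derivative F1' x) (at x)" "continuous_on UNIV F1'"
      "\<And>x. \<bar>F1' x\<bar> \<le> L" "\<And>x y. \<bar>F1 x - F1 y\<bar> \<le> L * \<bar>x - y\<bar>"
    and F2: "\<And>x. (F2 has_real_derivative F2' x) (at x)" "continuous_on UNIV F2'"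
      "\<And>x. \<bar>F2' x\<bar> \<le> L" "\<And>x y. \<bar>F2 x - F2 y\<bar> \<le> L * \<bar>x - y\<bar>"
    and G1: "\<And>x. \<bar>G1' x\<bar> \<le> L" and G2: "\<And>x. \<bar>G2' x\<bar> \<le> L" and "0 \<le> L"
    and "0 < \<kappa>"
  obtains \<eta> where "0 < \<eta>" "\<eta> \<le> 1"
    "\<And>lam2 phi s Ds. near_limit \<eta> lam lam2 phi s Ds \<Longrightarrow>
      norm (X_eps lam2 beta F1 F2 G1 G2 phi s 0 - X_zero lam beta F1 F2 G1 G2 0) \<le> \<kappa> \<and>
      (\<forall>q h. norm (DX_eps lam2 beta F1' F2' G1' G2' phi s Ds q h - DX_zero lam beta F1' F2' G1' G2' q h)
         \<le> \<kappa> * (1 + norm q) * norm h) \<and>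
      (\<exists>C. \<forall>q h. norm (DX_eps lam2 beta F1' F2' G1' G2' phi s Ds q h) \<le> C * norm h)"
proof -
  interpret finite_measure I01 by (simp add: finite_measure_lebesgue_on)
  \<comment> \<open>\<open>M\<close> exceeds the sum of the constants in all estimates below; the weighted modulus is applied
      with \<open>\<kappa> / M\<close>.\<close>
  define M where "M = 10 + 20 * L + \<bar>F1 0\<bar> + \<bar>G1 0\<bar>"
  have "M > 0" using \<open>0 \<le> L\<close> by (simp add: M_def)
  define k where "k = \<kappa> / M"
  have "k > 0" "k * M = \<kappa>" using \<open>0 < \<kappa>\<close> \<open>M > 0\<close> by (auto simp: k_def)
  obtain \<eta>1 where \<eta>1: "\<eta>1 > 0"
    "\<And>u w \<rho>. \<bar>u\<bar> \<le> \<rho> \<Longrightarrow> \<bar>w - u\<bar> \<le> \<eta>1 * (1 + \<rho>) \<Longrightarrow> \<bar>F1' w - F1' u\<bar> \<le> k * (1 + \<rho>)"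
    using bounded_continuous_weighted_modulus[OF F1(2,3) \<open>k > 0\<close>] by blast
  obtain \<eta>2 where \<eta>2: "\<eta>2 > 0"
    "\<And>u w \<rho>. \<bar>u\<bar> \<le> \<rho> \<Longrightarrow> \<bar>w - u\<bar> \<le> \<eta>2 * (1 + \<rho>) \<Longrightarrow> \<bar>F2' w - F2' u\<bar> \<le> k * (1 + \<rho>)"
    using bounded_continuous_weighted_modulus[OF F2(2,3) \<open>k > 0\<close>] by blast
  \<comment> \<open>\<open>7 * \<eta>\<close> bounds the relative error of \<open>S\<close>, so \<open>\<eta> \<le> 1/7\<close> keeps \<open>S\<close> below \<open>2 * norm h\<close>; the
      distance of \<open>W\<close> from \<open>fst q\<close> is at most \<open>3 * \<eta> * (1 + norm q)\<close>.\<close>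
  define \<eta> where "\<eta> = Min {k, 1/7, \<eta>1 / 3, \<eta>2 / 3}"
  have \<eta>: "\<eta> > 0" "\<eta> \<le> k" "\<eta> \<le> 1/7" "3 * \<eta> \<le> \<eta>1" "3 * \<eta> \<le> \<eta>2"
    using \<open>k > 0\<close> \<eta>1(1) \<eta>2(1) by (auto simp: \<eta>_def)
  show ?thesis
  proof (rule that[of \<eta>])
    fix lam2 phi s Ds
    assume near: "near_limit \<eta> lam lam2 phi s Ds"
    have lam2: "\<bar>lam2 - lam\<bar> \<le> \<eta>" and phic: "continuous_on {0..1} phi"
      and phi: "\<And>x. x \<in> {0..1} \<Longrightarrow> \<bar>phi x - 1\<bar> \<le> \<eta>"
      and ud: "\<And>q. unif_deriv (profile phi s) (profile_deriv phi Ds q) q"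
      and th: "\<And>u v x. x \<in> {0..1} \<Longrightarrow> \<bar>theta phi s u v x\<bar> \<le> 3 * \<eta>"
      and dth: "\<And>q h x. x \<in> {0..1} \<Longrightarrow> \<bar>theta_deriv phi Ds q h x\<bar> \<le> 6 * \<eta> * norm h"
      using near unfolding near_limit_def by blast+
    define W where "W = profile phi s"
    define S where "S = profile_deriv phi Ds"
    have phi2: "\<bar>phi x\<bar> \<le> 2" if "x \<in> {0..1}" for x
      using phi[OF that] \<eta>(3) by linarith
    have WF1c: "continuous_on {0..1} (\<lambda>x. F1 (W q x))"
      and DF1c: "continuous_on {0..1} (\<lambda>x. F1' (W q x) * S q h x)" for q h
      using unif_deriv_Nemytskii[OF ud F1(1,2)] unfolding unif_deriv_def W_def S_def by blast+
    have Wu: "\<bar>W q x - fst q\<bar> \<le> 3 * \<eta> * (1 + norm q)" if x: "x \<in> {0..1}" for q x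
    proof -
      have "W q x - fst q = fst q * (phi x - 1) + theta phi s (fst q) (snd q) x"
        by (simp add: W_def profile_def algebra_simps)
      moreover have "\<bar>fst q * (phi x - 1)\<bar> \<le> norm q * \<eta>"
        unfolding abs_mult using phi[OF x] abs_components_le(1)[of q] by (intro mult_mono) auto
      moreover have "norm q * \<eta> \<le> norm q * (3 * \<eta>)"
        using \<eta>(1) by (intro mult_left_mono) auto
      ultimately show ?thesis
        using th[OF x, of "fst q" "snd q"] by (simp add: algebra_simps)
    qed
    have Sh: "\<bar>S q h x - fst h\<bar> \<le> 7 * \<eta> * norm h" if x: "x \<in> {0..1}" for q h x
    proof -
      have "S q h x - fst h = fst h * (phi x - 1) + theta_deriv phi Ds q h x"
        by (simp add: S_def profile_deriv_def algebra_simps)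
      moreover have "\<bar>fst h * (phi x - 1)\<bar> \<le> norm h * \<eta>"
        unfolding abs_mult using phi[OF x] abs_components_le(1)[of h] by (intro mult_mono) auto
      ultimately show ?thesis
        using dth[OF x, of q h] by (simp add: algebra_simps)
    qed
    have S2: "\<bar>S q h x\<bar> \<le> 2 * norm h" if x: "x \<in> {0..1}" for q h x
    proof -
      have "7 * \<eta> * norm h \<le> 1 * norm h"
        using \<eta>(3) by (intro mult_right_mono) auto
      then show ?thesis
        using Sh[OF x, of q h] abs_components_le(1)[of h] by linarith
    qed
    have F1W: "\<bar>F1' (W q x) - F1' (fst q)\<bar> \<le> k * (1 + norm q)"
      and F2W: "\<bar>F2' (W q x) - F2' (fst q)\<bar> \<le> k * (1 + norm q)" if x: "x \<in> {0..1}" for q x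
    proof -
      have "3 * \<eta> * (1 + norm q) \<le> \<eta>1 * (1 + norm q)" "3 * \<eta> * (1 + norm q) \<le> \<eta>2 * (1 + norm q)"
        using \<eta>(4,5) by (auto intro!: mult_right_mono)
      then show "\<bar>F1' (W q x) - F1' (fst q)\<bar> \<le> k * (1 + norm q)"
        "\<bar>F2' (W q x) - F2' (fst q)\<bar> \<le> k * (1 + norm q)"
        using Wu[OF x, of q] by (auto intro!: \<eta>1(2) \<eta>2(2) abs_components_le(1))
    qed
    have at0: "norm (X_eps lam2 beta F1 F2 G1 G2 phi s 0 - X_zero lam beta F1 F2 G1 G2 0) \<le> \<kappa>"
    proof -
      have W0: "\<bar>W 0 x\<bar> \<le> 3 * \<eta>" if "x \<in> {0..1}" for x
        using th[OF that] by (simp add: W_def profile_def)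
      have "\<bar>(LINT x|I01. F1 (W 0 x) * phi x) - F1 0\<bar> = \<bar>LINT x|I01. F1 (W 0 x) * phi x - F1 0\<bar>"
        using continuous_imp_integrable_real[OF continuous_on_mult[OF WF1c phic]] by simp
      also have "\<dots> \<le> (LINT x|I01. \<bar>F1 (W 0 x) * phi x - F1 0\<bar>)"
        by (rule integral_abs_bound)
      also have "\<dots> \<le> (LINT x|I01. (6 * L + \<bar>F1 0\<bar>) * \<eta>)"
      proof (rule integral_mono)
        show "integrable I01 (\<lambda>x. \<bar>F1 (W 0 x) * phi x - F1 0\<bar>)"
          by (intro continuous_imp_integrable_real continuous_intros WF1c phic)
        fix x assume "x \<in> space I01"
        then have x: "x \<in> {0..1}" by simp
        have "\<bar>F1 (W 0 x) - F1 0\<bar> \<le> L * \<bar>W 0 x - 0\<bar>" by (rule F1(4))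
        also have "\<dots> \<le> L * (3 * \<eta>)" using W0[OF x] \<open>0 \<le> L\<close> by (intro mult_left_mono) auto
        finally have "\<bar>(F1 (W 0 x) - F1 0) * phi x\<bar> \<le> L * (3 * \<eta>) * 2"
          unfolding abs_mult using phi2[OF x] by (intro mult_mono) (use \<open>0 \<le> L\<close> \<eta> in auto)
        moreover have "\<bar>F1 0 * (phi x - 1)\<bar> \<le> \<bar>F1 0\<bar> * \<eta>"
          unfolding abs_mult using phi[OF x] by (intro mult_left_mono) auto
        moreover have "F1 (W 0 x) * phi x - F1 0 = (F1 (W 0 x) - F1 0) * phi x + F1 0 * (phi x - 1)"
          by (simp add: algebra_simps)
        ultimately show "\<bar>F1 (W 0 x) * phi x - F1 0\<bar> \<le> (6 * L + \<bar>F1 0\<bar>) * \<eta>"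
          by (simp add: algebra_simps)
      qed simp
      also have "\<dots> = (6 * L + \<bar>F1 0\<bar>) * \<eta>" by simp
      finally have c1: "\<bar>(LINT x|I01. F1 (W 0 x) * phi x) - F1 0\<bar> \<le> (6 * L + \<bar>F1 0\<bar>) * \<eta>" .
      have c2: "\<bar>G1 0 * phi 0 - G1 0\<bar> \<le> \<bar>G1 0\<bar> * \<eta>"
        using mult_left_mono[OF phi[of 0], of "\<bar>G1 0\<bar>"] by (simp add: abs_mult[symmetric] algebra_simps)
      have "\<bar>F2 (W 0 0) - F2 0\<bar> \<le> L * \<bar>W 0 0 - 0\<bar>" by (rule F2(4))
      also have "\<dots> \<le> L * (3 * \<eta>)" using W0[of 0] \<open>0 \<le> L\<close> by (intro mult_left_mono) auto
      finally have c3: "\<bar>F2 (W 0 0) - F2 0\<bar> \<le> L * (3 * \<eta>)" .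
      have eq: "X_eps lam2 beta F1 F2 G1 G2 phi s 0 - X_zero lam beta F1 F2 G1 G2 0 =
          (((LINT x|I01. F1 (W 0 x) * phi x) - F1 0) + (G1 0 * phi 0 - G1 0), F2 (W 0 0) - F2 0)"
      proof -
        have W0: "W 0 = theta phi s 0 0"
          by (simp add: fun_eq_iff W_def profile_def)
        show ?thesis
          unfolding W0 X_eps_def X_zero_def case_prod_beta fst_zero snd_zero mult_zero_right
            mult_zero_left add_0_left diff_Pair
          by simp
      qed
      have "norm (X_eps lam2 beta F1 F2 G1 G2 phi s 0 - X_zero lam beta F1 F2 G1 G2 0)
          \<le> \<bar>((LINT x|I01. F1 (W 0 x) * phi x) - F1 0) + (G1 0 * phi 0 - G1 0)\<bar> + \<bar>F2 (W 0 0) - F2 0\<bar>"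
        unfolding eq by (rule order_trans[OF norm_Pair_le]) simp
      also have "\<dots> \<le> (9 * L + \<bar>F1 0\<bar> + \<bar>G1 0\<bar>) * \<eta>"
        using c1 c2 c3 by (simp add: algebra_simps)
      also have "\<dots> \<le> M * k"
        using \<eta> \<open>0 \<le> L\<close> \<open>k > 0\<close> by (intro mult_mono) (auto simp: M_def)
      finally show ?thesis using \<open>k * M = \<kappa>\<close> by (simp add: mult.commute)
    qed
    have iDF: "integrable I01 (\<lambda>x. F1' (W q x) * S q h x * phi x)" for q h
      by (intro continuous_imp_integrable_real continuous_on_mult[OF DF1c phic])
    have D: "norm (DX_eps lam2 beta F1' F2' G1' G2' phi s Ds q h - DX_zero lam beta F1' F2' G1' G2' q h)
         \<le> \<kappa> * (1 + norm q) * norm h" for q h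
    proof -
      define N where "N = k * (1 + norm q) * norm h"
      have "N \<ge> 0" using \<open>k > 0\<close> by (simp add: N_def)
      have \<eta>N: "\<eta> * norm h \<le> N"
      proof -
        have "\<eta> * norm h \<le> k * norm h" using \<eta>(2) by (intro mult_right_mono) auto
        also have "k * norm h \<le> N"
          using \<open>k > 0\<close> by (simp add: N_def algebra_simps)
        finally show ?thesis .
      qed
      then have L\<eta>N: "L * (\<eta> * norm h) \<le> L * N" using \<open>0 \<le> L\<close> by (intro mult_left_mono)
      have "\<bar>(LINT x|I01. F1' (W q x) * S q h x * phi x) - F1' (fst q) * fst h\<bar>
          = \<bar>LINT x|I01. F1' (W q x) * S q h x * phi x - F1' (fst q) * fst h\<bar>"
        using iDF by simp
      also have "\<dots> \<le> (LINT x|I01. \<bar>F1' (W q x) * S q h x * phi x - F1' (fst q) * fst h\<bar>)"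
        by (rule integral_abs_bound)
      also have "\<dots> \<le> (LINT x|I01. (4 + 9 * L) * N)"
      proof (rule integral_mono)
        show "integrable I01 (\<lambda>x. \<bar>F1' (W q x) * S q h x * phi x - F1' (fst q) * fst h\<bar>)"
          using iDF by simp
        fix x assume "x \<in> space I01"
        then have x: "x \<in> {0..1}" by simp
        have a1: "\<bar>(F1' (W q x) - F1' (fst q)) * (S q h x * phi x)\<bar> \<le> k * (1 + norm q) * (2 * norm h * 2)"
          unfolding abs_mult using F1W[OF x] S2[OF x] phi2[OF x] \<open>k > 0\<close> by (intro mult_mono) auto
        have a2: "\<bar>S q h x * (phi x - 1)\<bar> \<le> 2 * norm h * \<eta>"
          unfolding abs_mult using S2[OF x] phi[OF x] by (intro mult_mono) auto
        have "\<bar>S q h x * (phi x - 1) + (S q h x - fst h)\<bar> \<le> 9 * (\<eta> * norm h)"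
          using a2 Sh[OF x, of q h] by (simp add: algebra_simps)
        then have "\<bar>F1' (fst q) * (S q h x * (phi x - 1) + (S q h x - fst h))\<bar> \<le> L * (9 * (\<eta> * norm h))"
          unfolding abs_mult using F1(3) \<open>0 \<le> L\<close> by (intro mult_mono) auto
        moreover have "F1' (W q x) * S q h x * phi x - F1' (fst q) * fst h =
            (F1' (W q x) - F1' (fst q)) * (S q h x * phi x)
            + F1' (fst q) * (S q h x * (phi x - 1) + (S q h x - fst h))"
          by (simp add: algebra_simps)
        ultimately have "\<bar>F1' (W q x) * S q h x * phi x - F1' (fst q) * fst h\<bar>
            \<le> k * (1 + norm q) * (2 * norm h * 2) + L * (9 * (\<eta> * norm h))"
          using a1 by linarith
        then show "\<bar>F1' (W q x) * S q h x * phi x - F1' (fst q) * fst h\<bar> \<le> (4 + 9 * L) * N"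
          using L\<eta>N by (simp add: N_def algebra_simps)
      qed simp
      also have "\<dots> = (4 + 9 * L) * N" by simp
      finally have c1: "\<bar>(LINT x|I01. F1' (W q x) * S q h x * phi x) - F1' (fst q) * fst h\<bar> \<le> (4 + 9 * L) * N" .
      have "\<bar>(lam2 - lam) * fst h\<bar> \<le> \<eta> * norm h"
        unfolding abs_mult using lam2 abs_components_le(1)[of h] by (intro mult_mono) auto
      with \<eta>N have c2: "\<bar>(lam2 - lam) * fst h\<bar> \<le> N" by linarith
      have "\<bar>G1' (snd q) * (snd h * (phi 0 - 1))\<bar> \<le> L * (norm h * \<eta>)"
        unfolding abs_mult using G1 abs_components_le(2)[of h] phi[of 0] \<open>0 \<le> L\<close> by (intro mult_mono) auto
      with L\<eta>N have c3: "\<bar>G1' (snd q) * (snd h * (phi 0 - 1))\<bar> \<le> L * N" by (simp add: mult.commute)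
      have "\<bar>(F2' (W q 0) - F2' (fst q)) * S q h 0\<bar> \<le> k * (1 + norm q) * (2 * norm h)"
        unfolding abs_mult using F2W[of 0 q] S2[of 0 q h] \<open>k > 0\<close> by (intro mult_mono) auto
      then have c4: "\<bar>(F2' (W q 0) - F2' (fst q)) * S q h 0\<bar> \<le> 2 * N" by (simp add: N_def)
      have "\<bar>F2' (fst q) * (S q h 0 - fst h)\<bar> \<le> L * (7 * \<eta> * norm h)"
        unfolding abs_mult using F2(3) Sh[of 0 q h] \<open>0 \<le> L\<close> by (intro mult_mono) auto
      with L\<eta>N have c5: "\<bar>F2' (fst q) * (S q h 0 - fst h)\<bar> \<le> 7 * (L * N)" by simp
      have eq: "DX_eps lam2 beta F1' F2' G1' G2' phi s Ds q h - DX_zero lam beta F1' F2' G1' G2' q h =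
          (- ((lam2 - lam) * fst h) + ((LINT x|I01. F1' (W q x) * S q h x * phi x) - F1' (fst q) * fst h)
             + G1' (snd q) * (snd h * (phi 0 - 1)),
           (F2' (W q 0) - F2' (fst q)) * S q h 0 + F2' (fst q) * (S q h 0 - fst h))"
        by (simp add: DX_eps_def DX_zero_def W_def S_def algebra_simps)
      have "norm (DX_eps lam2 beta F1' F2' G1' G2' phi s Ds q h - DX_zero lam beta F1' F2' G1' G2' q h)
          \<le> \<bar>- ((lam2 - lam) * fst h) + ((LINT x|I01. F1' (W q x) * S q h x * phi x) - F1' (fst q) * fst h)
               + G1' (snd q) * (snd h * (phi 0 - 1))\<bar>
            + \<bar>(F2' (W q 0) - F2' (fst q)) * S q h 0 + F2' (fst q) * (S q h 0 - fst h)\<bar>"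
        unfolding eq by (rule order_trans[OF norm_Pair_le]) simp
      also have "\<dots> \<le> (7 + 17 * L) * N"
        using c1 c2 c3 c4 c5 unfolding distrib_right by linarith
      also have "\<dots> \<le> M * N"
        using \<open>N \<ge> 0\<close> \<open>0 \<le> L\<close> by (intro mult_right_mono) (auto simp: M_def)
      also have "\<dots> = \<kappa> * (1 + norm q) * norm h"
        using \<open>k * M = \<kappa>\<close> by (simp add: N_def mult_ac)
      finally show ?thesis .
    qed
    have "norm (DX_eps lam2 beta F1' F2' G1' G2' phi s Ds q h) \<le> (\<bar>lam2\<bar> + \<bar>beta\<bar> + 9 * L) * norm h" for q h
    proof -
      have "\<bar>LINT x|I01. F1' (W q x) * S q h x * phi x\<bar> \<le> (LINT x|I01. \<bar>F1' (W q x) * S q h x * phi x\<bar>)"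
        by (rule integral_abs_bound)
      also have "\<dots> \<le> (LINT x|I01. L * (2 * norm h) * 2)"
      proof (rule integral_mono)
        fix x assume "x \<in> space I01"
        then have x: "x \<in> {0..1}" by simp
        show "\<bar>F1' (W q x) * S q h x * phi x\<bar> \<le> L * (2 * norm h) * 2"
          unfolding abs_mult using F1(3) S2[OF x] phi2[OF x] \<open>0 \<le> L\<close> by (intro mult_mono) auto
      qed (use iDF in auto)
      finally have c1: "\<bar>LINT x|I01. F1' (W q x) * S q h x * phi x\<bar> \<le> 4 * (L * norm h)" by simp
      have c2: "\<bar>lam2 * fst h\<bar> \<le> \<bar>lam2\<bar> * norm h" "\<bar>beta * snd h\<bar> \<le> \<bar>beta\<bar> * norm h"
        unfolding abs_mult using abs_components_le(1)[of h] abs_components_le(2)[of h] by (auto intro: mult_left_mono)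
      have c3: "\<bar>G1' (snd q) * snd h * phi 0\<bar> \<le> L * norm h * 2"
        unfolding abs_mult using G1 abs_components_le(2)[of h] phi2[of 0] \<open>0 \<le> L\<close> by (intro mult_mono) auto
      have c4: "\<bar>G2' (snd q) * snd h\<bar> \<le> L * norm h"
        unfolding abs_mult using G2 abs_components_le(2)[of h] \<open>0 \<le> L\<close> by (intro mult_mono) auto
      have c5: "\<bar>F2' (W q 0) * S q h 0\<bar> \<le> L * (2 * norm h)"
        unfolding abs_mult using F2(3) S2[of 0 q h] \<open>0 \<le> L\<close> by (intro mult_mono) auto
      have abs3: "\<bar>- x + y + z\<bar> \<le> a + b + c" if "\<bar>x\<bar> \<le> a" "\<bar>y\<bar> \<le> b" "\<bar>z\<bar> \<le> c" for x y z a b c :: real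
        using that by linarith
      have "norm (DX_eps lam2 beta F1' F2' G1' G2' phi s Ds q h) \<le>
          \<bar>- (lam2 * fst h) + (LINT x|I01. F1' (W q x) * S q h x * phi x) + G1' (snd q) * snd h * phi 0\<bar>
          + \<bar>- (beta * snd h) + F2' (W q 0) * S q h 0 + G2' (snd q) * snd h\<bar>"
        unfolding DX_eps_def W_def S_def mult_minus_left
        by (rule order_trans[OF norm_Pair_le]) (simp only: real_norm_def order_refl)
      also have "\<dots> \<le> (\<bar>lam2\<bar> * norm h + 4 * (L * norm h) + L * norm h * 2)
          + (\<bar>beta\<bar> * norm h + L * (2 * norm h) + L * norm h)"
        by (rule add_mono[OF abs3[OF c2(1) c1 c3] abs3[OF c2(2) c5 c4]])
      also have "\<dots> = (\<bar>lam2\<bar> + \<bar>beta\<bar> + 9 * L) * norm h"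
        by (simp add: algebra_simps)
      finally show ?thesis .
    qed
    with at0 D show "norm (X_eps lam2 beta F1 F2 G1 G2 phi s 0 - X_zero lam beta F1 F2 G1 G2 0) \<le> \<kappa> \<and>
      (\<forall>q h. norm (DX_eps lam2 beta F1' F2' G1' G2' phi s Ds q h - DX_zero lam beta F1' F2' G1' G2' q h)
         \<le> \<kappa> * (1 + norm q) * norm h) \<and>
      (\<exists>C. \<forall>q h. norm (DX_eps lam2 beta F1' F2' G1' G2' phi s Ds q h) \<le> C * norm h)"
      by blast
  qed (use \<eta> in auto)
qed

section \<open>The compactified field near the equator\<close>

text \<open>
Mean value inequality on the ball of radius \<open>norm q\<close>.
\<close>

lemma weighted_growth:
  fixes Z :: "'a::euclidean_space \<Rightarrow> 'b::real_normed_vector"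
  assumes Z: "\<And>q. (Z has_derivative DZ q) (at q)" and "norm (Z 0) \<le> \<kappa>"
    and DZ: "\<And>q h. norm (DZ q h) \<le> \<kappa> * (1 + norm q) * norm h" and "0 \<le> \<kappa>"
  shows "norm (Z q) \<le> \<kappa> * (1 + norm q)\<^sup>2"
proof -
  have "norm (Z q - Z 0) \<le> \<kappa> * (1 + norm q) * norm (q - 0)"
  proof (rule differentiable_bound)
    show "convex (cball (0::'a) (norm q))" by simp
    fix p :: 'a assume p: "p \<in> cball 0 (norm q)"
    show "(Z has_derivative DZ p) (at p within cball 0 (norm q))"
      by (rule has_derivative_at_withinI[OF Z])
    show "onorm (DZ p) \<le> \<kappa> * (1 + norm q)"
    proof (rule onorm_le)
      fix h :: 'a
      have "\<kappa> * (1 + norm p) * norm h \<le> \<kappa> * (1 + norm q) * norm h"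
        using p \<open>0 \<le> \<kappa>\<close> by (intro mult_right_mono mult_left_mono) auto
      with DZ show "norm (DZ p h) \<le> \<kappa> * (1 + norm q) * norm h" by (rule order_trans)
    qed
  qed auto
  then have "norm (Z q) \<le> \<kappa> + \<kappa> * (1 + norm q) * norm q"
    using assms(2) norm_triangle_sub[of "Z q" "Z 0"] by simp
  also have "\<dots> \<le> \<kappa> * (1 + norm q)\<^sup>2"
    using \<open>0 \<le> \<kappa>\<close> by (simp add: power2_eq_square algebra_simps)
  finally show ?thesis .
qed

lemma linear_growth:
  fixes X :: "'a::euclidean_space \<Rightarrow> 'b::real_normed_vector"
  assumes X: "\<And>q. (X has_derivative DX q) (at q)" and DX: "\<And>q h. norm (DX q h) \<le> C * norm h"
  shows "norm (X q) \<le> (norm (X 0) + \<bar>C\<bar>) * (1 + norm q)"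
proof -
  have "norm (X q - X 0) \<le> C * norm (q - 0)"
    by (rule differentiable_bound[where S = UNIV and f' = DX]) (use X in \<open>auto intro!: onorm_le DX\<close>)
  also have "\<dots> \<le> \<bar>C\<bar> * norm q" by (simp add: mult_right_mono)
  finally have "norm (X q) \<le> norm (X 0) + \<bar>C\<bar> * norm q"
    using norm_triangle_sub[of "X q" "X 0"] by simp
  also have "\<dots> \<le> (norm (X 0) + \<bar>C\<bar>) * (1 + norm q)"
    by (simp add: algebra_simps)
  finally show ?thesis .
qed

text \<open>
The inverse of the chart \<open>U1\<close> in the coordinates of the plane, \<open>(x, y) \<mapsto> (1/y, x/y)\<close>.
\<close>

definition equator_inv :: "real \<times> real \<Rightarrow> real \<times> real" where
  "equator_inv z = (1 / snd z, fst z / snd z)"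

definition equator_inv_deriv :: "real \<times> real \<Rightarrow> real \<times> real \<Rightarrow> real \<times> real" where
  "equator_inv_deriv z h = (- snd h / (snd z)\<^sup>2, fst h / snd z - fst z * snd h / (snd z)\<^sup>2)"

lemma expr1_eq:
  "expr1 d X z = (snd z ^ d * (- fst z * fst (X (equator_inv z)) + snd (X (equator_inv z))),
     - (snd z ^ (d + 1)) * fst (X (equator_inv z)))"
  unfolding expr1_def equator_inv_def case_prod_beta by (rule refl)

lemma norm_le_abs_components: "norm (q :: real \<times> real) \<le> \<bar>fst q\<bar> + \<bar>snd q\<bar>"
  using norm_Pair_le[of "fst q" "snd q"] by simp

text \<open>
A weight \<open>1 + norm q\<close> costs one power of \<open>y\<close> near the equator.
\<close>

lemma equator_inv_weight:
  assumes "0 < snd z" "norm z \<le> r"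
  shows "snd z * (1 + norm (equator_inv z)) \<le> 1 + 2 * r"
proof -
  have "norm (equator_inv z) \<le> 1 / snd z + \<bar>fst z\<bar> / snd z"
    using norm_le_abs_components[of "equator_inv z"] assms(1) by (simp add: equator_inv_def abs_divide)
  then have "snd z * norm (equator_inv z) \<le> 1 + \<bar>fst z\<bar>"
    using assms(1) by (simp add: field_simps)
  then show ?thesis
    using abs_components_le[of z] assms by (simp add: algebra_simps)
qed

lemma expr1_norm_le:
  assumes "0 < snd z" "norm z \<le> r"
  shows "norm (expr1 d X z) \<le> (1 + 2 * r) * (snd z ^ d * norm (X (equator_inv z)))"
proof -
  define a y where "a = X (equator_inv z)" and "y = snd z"
  have r: "\<bar>fst z\<bar> \<le> r" "0 < y" "y \<le> r" "0 \<le> r"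
    using abs_components_le[of z] assms norm_ge_zero[of z] unfolding y_def by linarith+
  have na: "\<bar>fst a\<bar> \<le> norm a" "\<bar>snd a\<bar> \<le> norm a" by (rule abs_components_le)+
  have "\<bar>fst z * fst a\<bar> \<le> r * norm a"
    unfolding abs_mult using r na by (intro mult_mono) auto
  then have "\<bar>- fst z * fst a + snd a\<bar> \<le> (1 + r) * norm a"
    using na by (simp add: algebra_simps)
  then have "\<bar>y ^ d * (- fst z * fst a + snd a)\<bar> \<le> y ^ d * ((1 + r) * norm a)"
    using r by (simp add: abs_mult)
  moreover have "\<bar>- (y ^ (d + 1)) * fst a\<bar> \<le> y ^ d * (r * norm a)"
  proof -
    have "\<bar>- (y ^ (d + 1)) * fst a\<bar> = y ^ d * (y * \<bar>fst a\<bar>)"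
      using r by (simp add: abs_mult)
    also have "\<dots> \<le> y ^ d * (r * norm a)"
      using r na by (intro mult_left_mono mult_mono) auto
    finally show ?thesis .
  qed
  moreover have "norm (expr1 d X z) \<le> \<bar>y ^ d * (- fst z * fst a + snd a)\<bar> + \<bar>- (y ^ (d + 1)) * fst a\<bar>"
    unfolding expr1_eq a_def y_def by (rule order_trans[OF norm_Pair_le]) (simp only: real_norm_def order_refl)
  moreover have "y ^ d * ((1 + r) * norm a) + y ^ d * (r * norm a) = (1 + 2 * r) * (y ^ d * norm a)"
    by (simp add: algebra_simps)
  ultimately show ?thesis
    unfolding a_def y_def by linarith
qed

text \<open>
Linear growth leaves \<open>d - 1 \<ge> 2\<close> of the \<open>d\<close> powers of \<open>y\<close>; two of them give a field that vanishes
together with its derivative on \<open>y = 0\<close>.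
\<close>

lemma expr1_quadratic_at_equator:
  assumes X: "\<And>q. norm (X q) \<le> C * (1 + norm q)" and "3 \<le> d" "0 < snd z" "norm z \<le> r"
  shows "norm (expr1 d X z) \<le> (1 + 2 * r)\<^sup>2 * r ^ (d - 3) * C * (snd z)\<^sup>2"
proof -
  obtain n where d: "d = n + 3" using \<open>3 \<le> d\<close> by (metis le_add_diff_inverse add.commute)
  define y \<rho> where "y = snd z" and "\<rho> = 1 + norm (equator_inv z)"
  have y: "0 < y" "y \<le> r"
    using abs_components_le[of z] assms(3,4) unfolding y_def by linarith+
  have "0 \<le> C" using order_trans[OF norm_ge_zero X[of 0]] by simp
  have w: "y * \<rho> \<le> 1 + 2 * r"
    unfolding y_def \<rho>_def by (rule equator_inv_weight) fact+
  have "y ^ d * norm (X (equator_inv z)) \<le> y ^ d * (C * \<rho>)"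
    using X y unfolding \<rho>_def by (intro mult_left_mono) auto
  also have "\<dots> = y ^ n * (C * y\<^sup>2 * (y * \<rho>))"
    by (simp add: d power_add power2_eq_square power3_eq_cube)
  also have "\<dots> \<le> r ^ n * (C * y\<^sup>2 * (1 + 2 * r))"
    using y w \<open>0 \<le> C\<close> by (intro mult_mono power_mono) (auto simp: \<rho>_def)
  finally have "(1 + 2 * r) * (y ^ d * norm (X (equator_inv z))) \<le> (1 + 2 * r) * (r ^ n * (C * y\<^sup>2 * (1 + 2 * r)))"
    using y by (intro mult_left_mono) auto
  with expr1_norm_le[OF assms(3,4), of d X] show ?thesis
    unfolding y_def by (simp add: d power2_eq_square mult_ac)
qed

lemma expr1_weighted_norm_le:
  assumes X: "\<And>q. norm (X q) \<le> \<kappa> * (1 + norm q)\<^sup>2" and "3 \<le> d" "0 < snd z" "norm z \<le> r" "0 \<le> \<kappa>"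
  shows "norm (expr1 d X z) \<le> (1 + 2 * r) ^ 3 * r ^ (d - 3) * r * \<kappa>"
proof -
  obtain n where d: "d = n + 3" using \<open>3 \<le> d\<close> by (metis le_add_diff_inverse add.commute)
  define y \<rho> where "y = snd z" and "\<rho> = 1 + norm (equator_inv z)"
  have y: "0 < y" "y \<le> r"
    using abs_components_le[of z] assms(3,4) unfolding y_def by linarith+
  have w: "y * \<rho> \<le> 1 + 2 * r"
    unfolding y_def \<rho>_def by (rule equator_inv_weight) fact+
  have "y ^ d * norm (X (equator_inv z)) \<le> y ^ d * (\<kappa> * \<rho>\<^sup>2)"
    using X y unfolding \<rho>_def by (intro mult_left_mono) auto
  also have "\<dots> = y ^ n * (y * (\<kappa> * (y * \<rho>)\<^sup>2))"
    by (simp add: d power_add power2_eq_square power3_eq_cube)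
  also have "\<dots> \<le> r ^ n * (r * (\<kappa> * (1 + 2 * r)\<^sup>2))"
    using y w \<open>0 \<le> \<kappa>\<close> by (intro mult_mono power_mono) (auto simp: \<rho>_def)
  finally have "(1 + 2 * r) * (y ^ d * norm (X (equator_inv z))) \<le> (1 + 2 * r) * (r ^ n * (r * (\<kappa> * (1 + 2 * r)\<^sup>2)))"
    using y by (intro mult_left_mono) auto
  with expr1_norm_le[OF assms(3,4), of d X] show ?thesis
    unfolding y_def by (simp add: d power2_eq_square power3_eq_cube mult_ac)
qed

lemma equator_inv_has_derivative:
  assumes "snd z \<noteq> 0"
  shows "(equator_inv has_derivative equator_inv_deriv z) (at z)"
proof -
  have a: "((\<lambda>z. 1 / snd z) has_derivative (\<lambda>h::real \<times> real. - snd h / (snd z)\<^sup>2)) (at z)"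
    by (rule has_derivative_eq_rhs, (rule derivative_eq_intros refl assms)+)
      (simp add: power2_eq_square divide_inverse)
  have b: "((\<lambda>z. fst z / snd z) has_derivative
      (\<lambda>h::real \<times> real. fst h / snd z - fst z * snd h / (snd z)\<^sup>2)) (at z)"
    by (rule has_derivative_eq_rhs, (rule derivative_eq_intros refl assms)+)
      (use assms in \<open>simp add: power2_eq_square fun_eq_iff field_simps\<close>)
  show ?thesis
    unfolding equator_inv_def[abs_def] equator_inv_deriv_def[abs_def] by (rule has_derivative_Pair[OF a b])
qed

lemma equator_inv_deriv_le:
  assumes "0 < snd z" "norm z \<le> r"
  shows "(snd z)\<^sup>2 * norm (equator_inv_deriv z h) \<le> (1 + 2 * r) * norm h"
proof -
  define y where "y = snd z"
  have y: "0 < y" "y \<le> r" "\<bar>fst z\<bar> \<le> r"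
    using abs_components_le[of z] assms unfolding y_def by linarith+
  have "y\<^sup>2 *\<^sub>R equator_inv_deriv z h = (- snd h, y * fst h - fst z * snd h)"
    using y by (simp add: equator_inv_deriv_def y_def[symmetric] power2_eq_square right_diff_distrib)
  then have "y\<^sup>2 * norm (equator_inv_deriv z h) = norm (- snd h, y * fst h - fst z * snd h)"
    by (metis abs_of_nonneg norm_scaleR zero_le_power2)
  also have "\<dots> \<le> \<bar>- snd h\<bar> + \<bar>y * fst h - fst z * snd h\<bar>"
    by (rule order_trans[OF norm_Pair_le]) (simp only: real_norm_def order_refl)
  also have "\<dots> \<le> norm h + (r * norm h + r * norm h)"
  proof (intro add_mono order_trans[OF abs_triangle_ineq4])
    show "\<bar>y * fst h\<bar> \<le> r * norm h" "\<bar>fst z * snd h\<bar> \<le> r * norm h"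
      unfolding abs_mult using y abs_components_le[of h] by (auto intro: mult_mono)
  qed (use abs_components_le[of h] in auto)
  finally show ?thesis
    unfolding y_def by (simp add: algebra_simps)
qed

text \<open>
The product rule for the shape of \<open>expr1\<close>, with \<open>f\<close> and \<open>g\<close> in place of the components of the
planar field read in the chart.
\<close>

lemma expr1_form_has_derivative:
  fixes f g :: "real \<times> real \<Rightarrow> real"
  assumes f: "(f has_derivative f') (at z)" and g: "(g has_derivative g') (at z)"
  shows "((\<lambda>z. (snd z ^ d * (- fst z * f z + g z), - (snd z ^ (d + 1)) * f z)) has_derivative (\<lambda>h.
     (real d * snd z ^ (d - 1) * snd h * (- fst z * f z + g z)
        + snd z ^ d * (- fst h * f z - fst z * f' h + g' h),
      - (real (d + 1) * snd z ^ d * snd h * f z + snd z ^ (d + 1) * f' h)))) (at z)"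
proof (rule has_derivative_Pair)
  have F: "(fst has_derivative fst) (at z)" and S: "(snd has_derivative snd) (at z)"
    by (auto intro: bounded_linear_imp_has_derivative bounded_linear_fst bounded_linear_snd)
  have A: "((\<lambda>z. - fst z * f z + g z) has_derivative (\<lambda>h. - fst z * f' h + - fst h * f z + g' h)) (at z)"
    by (intro has_derivative_add has_derivative_mult has_derivative_minus F f g)
  show "((\<lambda>z. snd z ^ d * (- fst z * f z + g z)) has_derivative
     (\<lambda>h. real d * snd z ^ (d - 1) * snd h * (- fst z * f z + g z)
        + snd z ^ d * (- fst h * f z - fst z * f' h + g' h))) (at z)"
    by (rule has_derivative_eq_rhs[OF has_derivative_mult[OF has_derivative_power[OF S] A]])
      (simp add: fun_eq_iff algebra_simps)
  show "((\<lambda>z. - (snd z ^ (d + 1)) * f z) has_derivative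
     (\<lambda>h. - (real (d + 1) * snd z ^ d * snd h * f z + snd z ^ (d + 1) * f' h))) (at z)"
    by (rule has_derivative_eq_rhs[OF has_derivative_mult[OF has_derivative_minus[OF has_derivative_power[OF S]] f]])
      (simp add: fun_eq_iff algebra_simps)
qed

lemma expr1_has_derivative:
  assumes X: "(X has_derivative DX) (at (equator_inv z))" and z: "snd z \<noteq> 0"
  defines "a \<equiv> X (equator_inv z)" and "b \<equiv> \<lambda>h. DX (equator_inv_deriv z h)"
  shows "(expr1 d X has_derivative (\<lambda>h.
     (real d * snd z ^ (d - 1) * snd h * (- fst z * fst a + snd a)
        + snd z ^ d * (- fst h * fst a - fst z * fst (b h) + snd (b h)),
      - (real (d + 1) * snd z ^ d * snd h * fst a + snd z ^ (d + 1) * fst (b h))))) (at z)"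
proof -
  have c: "((\<lambda>z. X (equator_inv z)) has_derivative b) (at z)"
    unfolding b_def using equator_inv_has_derivative[OF z] X by (rule has_derivative_compose)
  show ?thesis
    unfolding expr1_eq[abs_def] a_def
    by (rule expr1_form_has_derivative[OF has_derivative_fst[OF c] has_derivative_snd[OF c]])
qed

text \<open>
Differentiating the power of \<open>y\<close> produces \<open>y ^ (d - 1) * norm (X q)\<close>, and differentiating \<open>X\<close>
produces \<open>y ^ d * norm (DX q)\<close> times the derivative of the inverse chart, which is of order
\<open>1 / y\<^sup>2\<close>. Against the weights \<open>(1 + norm q)\<^sup>2\<close> and \<open>1 + norm q\<close> both leave \<open>y ^ (d - 3)\<close>.
\<close>

lemma expr1_weighted_derivative:
  assumes X: "\<And>q. (X has_derivative DX q) (at q)"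
    and X_le: "\<And>q. norm (X q) \<le> \<kappa> * (1 + norm q)\<^sup>2"
    and DX: "\<And>q h. norm (DX q h) \<le> \<kappa> * (1 + norm q) * norm h"
    and "0 \<le> \<kappa>" "3 \<le> d" "0 < snd z" "norm z \<le> r"
  obtains E' where "(expr1 d X has_derivative E') (at z)"
    "\<And>h. norm (E' h) \<le> (2 * real d + 5) * (1 + 2 * r) ^ 3 * r ^ (d - 3) * \<kappa> * norm h"
proof -
  obtain n where d: "d = n + 3" using \<open>3 \<le> d\<close> by (metis le_add_diff_inverse add.commute)
  define y \<rho> M where "y = snd z" and "\<rho> = 1 + norm (equator_inv z)" and "M = 1 + 2 * r"
  have y: "0 < y" "y \<le> r" "\<bar>fst z\<bar> \<le> r" "0 \<le> r"
    using abs_components_le[of z] assms(6,7) unfolding y_def by linarith+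
  have w: "y * \<rho> \<le> M" "0 \<le> \<rho>"
    unfolding y_def \<rho>_def M_def by (rule equator_inv_weight) (use assms in auto)
  define a b where "a = X (equator_inv z)" and "b = (\<lambda>h. DX (equator_inv z) (equator_inv_deriv z h))"
  \<comment> \<open>\<open>N\<close> bounds \<open>y ^ (d - 1) * norm (X q)\<close> and, per unit of \<open>h\<close>, the term that contains \<open>DX\<close>.\<close>
  define N where "N = r ^ n * \<kappa> * M\<^sup>2"
  have "0 \<le> N" using y \<open>0 \<le> \<kappa>\<close> by (simp add: N_def)
  have a: "y ^ (n + 2) * norm a \<le> N"
  proof -
    have "y ^ (n + 2) * norm a \<le> y ^ (n + 2) * (\<kappa> * \<rho>\<^sup>2)"
      unfolding a_def \<rho>_def using X_le y by (intro mult_left_mono) auto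
    also have "\<dots> = y ^ n * (\<kappa> * (y * \<rho>)\<^sup>2)"
      by (simp add: power_add power2_eq_square)
    also have "\<dots> \<le> r ^ n * (\<kappa> * M\<^sup>2)"
      using y w \<open>0 \<le> \<kappa>\<close> by (intro mult_mono power_mono) auto
    finally show ?thesis by (simp add: N_def)
  qed
  have a': "y ^ (n + 3) * norm a \<le> r * N"
  proof -
    have "y ^ (n + 3) * norm a = y * (y ^ (n + 2) * norm a)"
      by (simp add: power_add power2_eq_square power3_eq_cube)
    also have "\<dots> \<le> r * N"
      using y a by (intro mult_mono) auto
    finally show ?thesis .
  qed
  have b: "y ^ (n + 3) * norm (b h) \<le> N * norm h" for h
  proof -
    define t where "t = y\<^sup>2 * norm (equator_inv_deriv z h)"
    have t: "t \<le> M * norm h" "0 \<le> t"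
      using equator_inv_deriv_le[OF assms(6,7)] by (auto simp: t_def M_def y_def)
    have "y ^ (n + 3) * norm (b h) \<le> y ^ (n + 3) * (\<kappa> * \<rho> * norm (equator_inv_deriv z h))"
      unfolding b_def \<rho>_def using DX y by (intro mult_left_mono) auto
    also have "\<dots> = y ^ n * (\<kappa> * (y * \<rho>) * t)"
      by (simp add: t_def power_add power2_eq_square power3_eq_cube)
    also have "\<dots> \<le> r ^ n * (\<kappa> * M * (M * norm h))"
      by (rule mult_mono[OF power_mono mult_mono[OF mult_left_mono]]) (use y w t \<open>0 \<le> \<kappa>\<close> in \<open>auto simp: M_def\<close>)
    finally show ?thesis by (simp add: N_def power2_eq_square mult_ac)
  qed
  have na: "\<bar>fst a\<bar> \<le> norm a" "\<bar>snd a\<bar> \<le> norm a" by (rule abs_components_le)+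
  show ?thesis
  proof (rule that)
    show "(expr1 d X has_derivative (\<lambda>h.
       (real d * snd z ^ (d - 1) * snd h * (- fst z * fst a + snd a)
          + snd z ^ d * (- fst h * fst a - fst z * fst (b h) + snd (b h)),
        - (real (d + 1) * snd z ^ d * snd h * fst a + snd z ^ (d + 1) * fst (b h))))) (at z)"
      unfolding a_def b_def by (rule expr1_has_derivative) (use X assms(6) in auto)
    fix h :: "real \<times> real"
    have nh: "\<bar>fst h\<bar> \<le> norm h" "\<bar>snd h\<bar> \<le> norm h" by (rule abs_components_le)+
    have nb: "\<bar>fst (b h)\<bar> \<le> norm (b h)" "\<bar>snd (b h)\<bar> \<le> norm (b h)" by (rule abs_components_le)+
    have t1: "\<bar>real d * y ^ (d - 1) * snd h * (- fst z * fst a + snd a)\<bar> \<le> real d * ((1 + r) * (N * norm h))"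
    proof -
      have "\<bar>- fst z * fst a + snd a\<bar> \<le> \<bar>fst z\<bar> * \<bar>fst a\<bar> + \<bar>snd a\<bar>"
        using abs_triangle_ineq[of "- fst z * fst a" "snd a"] by (simp add: abs_mult)
      also have "\<dots> \<le> r * norm a + norm a"
        using y na by (intro add_mono mult_mono) auto
      finally have "\<bar>- fst z * fst a + snd a\<bar> \<le> (1 + r) * norm a" by (simp add: algebra_simps)
      then have "\<bar>real d * y ^ (d - 1) * snd h * (- fst z * fst a + snd a)\<bar>
          \<le> real d * y ^ (d - 1) * norm h * ((1 + r) * norm a)"
        unfolding abs_mult using y nh by (intro mult_mono) auto
      also have "\<dots> = real d * ((1 + r) * ((y ^ (n + 2) * norm a) * norm h))"
        by (simp add: d)
      also have "\<dots> \<le> real d * ((1 + r) * (N * norm h))"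
        using a y by (intro mult_left_mono mult_right_mono) auto
      finally show ?thesis .
    qed
    have t2: "\<bar>y ^ d * (- fst h * fst a - fst z * fst (b h) + snd (b h))\<bar> \<le> (1 + 2 * r) * (N * norm h)"
    proof -
      have "\<bar>- fst h * fst a - fst z * fst (b h) + snd (b h)\<bar>
          \<le> \<bar>fst h\<bar> * \<bar>fst a\<bar> + \<bar>fst z\<bar> * \<bar>fst (b h)\<bar> + \<bar>snd (b h)\<bar>"
        unfolding abs_mult[symmetric] by linarith
      also have "\<dots> \<le> norm h * norm a + r * norm (b h) + norm (b h)"
        using y nh na nb by (intro add_mono mult_mono) auto
      finally have "\<bar>y ^ d * (- fst h * fst a - fst z * fst (b h) + snd (b h))\<bar>
          \<le> y ^ d * (norm h * norm a + r * norm (b h) + norm (b h))"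
        using y by (simp add: abs_mult)
      also have "\<dots> = (y ^ (n + 3) * norm a) * norm h + (1 + r) * (y ^ (n + 3) * norm (b h))"
        by (simp add: d algebra_simps)
      also have "\<dots> \<le> (r * N) * norm h + (1 + r) * (N * norm h)"
        using a' b[of h] y by (intro add_mono mult_left_mono mult_right_mono) auto
      also have "\<dots> = (1 + 2 * r) * (N * norm h)"
        by (simp add: algebra_simps)
      finally show ?thesis .
    qed
    have t3: "\<bar>- (real (d + 1) * y ^ d * snd h * fst a + y ^ (d + 1) * fst (b h))\<bar> \<le> (real d + 2) * (r * (N * norm h))"
    proof -
      have "\<bar>real (d + 1) * y ^ d * snd h * fst a\<bar> \<le> real (d + 1) * y ^ d * norm h * norm a"
        unfolding abs_mult using y nh na by (intro mult_mono) auto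
      also have "\<dots> = real (d + 1) * ((y ^ (n + 3) * norm a) * norm h)"
        by (simp add: d)
      also have "\<dots> \<le> real (d + 1) * ((r * N) * norm h)"
        using a' by (intro mult_left_mono mult_right_mono) auto
      finally have u1: "\<bar>real (d + 1) * y ^ d * snd h * fst a\<bar> \<le> real (d + 1) * ((r * N) * norm h)" .
      have "\<bar>y ^ (d + 1) * fst (b h)\<bar> = y * (y ^ (n + 3) * \<bar>fst (b h)\<bar>)"
        using y by (simp add: abs_mult flip: d)
      also have "\<dots> \<le> y * (y ^ (n + 3) * norm (b h))"
        using y nb by (intro mult_left_mono) auto
      also have "\<dots> \<le> r * (N * norm h)"
        by (rule mult_mono[OF y(2) b]) (use y in auto)
      finally have u2: "\<bar>y ^ (d + 1) * fst (b h)\<bar> \<le> r * (N * norm h)" .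
      have "\<bar>- (real (d + 1) * y ^ d * snd h * fst a + y ^ (d + 1) * fst (b h))\<bar>
          \<le> real (d + 1) * ((r * N) * norm h) + r * (N * norm h)"
        unfolding abs_minus_cancel by (rule order_trans[OF abs_triangle_ineq add_mono[OF u1 u2]])
      also have "\<dots> = (real d + 2) * (r * (N * norm h))"
        by (simp add: distrib_right)
      finally show ?thesis .
    qed
    have "norm (real d * y ^ (d - 1) * snd h * (- fst z * fst a + snd a)
          + y ^ d * (- fst h * fst a - fst z * fst (b h) + snd (b h)),
        - (real (d + 1) * y ^ d * snd h * fst a + y ^ (d + 1) * fst (b h)))
      \<le> (real d * ((1 + r) * (N * norm h)) + (1 + 2 * r) * (N * norm h)) + (real d + 2) * (r * (N * norm h))"
      by (rule order_trans[OF norm_Pair_le], unfold real_norm_def)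
        (rule add_mono[OF order_trans[OF abs_triangle_ineq add_mono[OF t1 t2]] t3])
    also have "\<dots> = (real d * (1 + 2 * r) + (1 + 2 * r) + 2 * r) * (N * norm h)"
    proof -
      have "real d * ((1 + r) * P) + (1 + 2 * r) * P + (real d + 2) * (r * P) =
          (real d * (1 + 2 * r) + (1 + 2 * r) + 2 * r) * P" for P
        by (simp add: algebra_simps)
      then show ?thesis .
    qed
    also have "\<dots> \<le> ((2 * real d + 5) * M) * (N * norm h)"
    proof (rule mult_right_mono)
      have "0 \<le> real d * r" using y by simp
      then show "real d * (1 + 2 * r) + (1 + 2 * r) + 2 * r \<le> (2 * real d + 5) * M"
        using y by (simp add: M_def algebra_simps)
    qed (use \<open>0 \<le> N\<close> in simp)
    also have "\<dots> = (2 * real d + 5) * (1 + 2 * r) ^ 3 * r ^ (d - 3) * \<kappa> * norm h"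
    proof -
      have "d - 3 = n" using d by simp
      then show ?thesis
        by (simp only: N_def M_def power2_eq_square power3_eq_cube mult_ac)
    qed
    finally show "norm (real d * snd z ^ (d - 1) * snd h * (- fst z * fst a + snd a)
          + snd z ^ d * (- fst h * fst a - fst z * fst (b h) + snd (b h)),
        - (real (d + 1) * snd z ^ d * snd h * fst a + snd z ^ (d + 1) * fst (b h)))
      \<le> (2 * real d + 5) * (1 + 2 * r) ^ 3 * r ^ (d - 3) * \<kappa> * norm h"
      unfolding y_def .
  qed
qed

section \<open>The charts and the C1-norm\<close>

text \<open>
The isometry of the plane that carries the part of the disk seen by an equatorial chart to the
part seen by \<open>U1\<close>: a reflection for \<open>U2\<close> and \<open>U4\<close>, a quarter turn for \<open>U5\<close>.
\<close>

fun chart_iso :: "chart \<Rightarrow> real \<times> real \<Rightarrow> real \<times> real" where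
  "chart_iso U2 q = (snd q, fst q)"
| "chart_iso U4 q = (- fst q, snd q)"
| "chart_iso U5 q = (- snd q, fst q)"
| "chart_iso _ q = q"

fun chart_iso_inv :: "chart \<Rightarrow> real \<times> real \<Rightarrow> real \<times> real" where
  "chart_iso_inv U2 q = (snd q, fst q)"
| "chart_iso_inv U4 q = (- fst q, snd q)"
| "chart_iso_inv U5 q = (snd q, - fst q)"
| "chart_iso_inv _ q = q"

lemma norm_chart_iso [simp]: "norm (chart_iso i q) = norm q" "norm (chart_iso_inv i q) = norm q"
  by (cases i; simp add: norm_prod_def add.commute)+

lemma linear_chart_iso: "bounded_linear (chart_iso i)" "bounded_linear (chart_iso_inv i)"
proof -
  have "linear (chart_iso i)" by (rule linearI; cases i; simp)
  then show "bounded_linear (chart_iso i)" by (simp add: linear_conv_bounded_linear)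
  have "linear (chart_iso_inv i)" by (rule linearI; cases i; simp)
  then show "bounded_linear (chart_iso_inv i)" by (simp add: linear_conv_bounded_linear)
qed

definition conjugate :: "chart \<Rightarrow> planar_field \<Rightarrow> planar_field" where
  "conjugate i X q = chart_iso i (X (chart_iso_inv i q))"

lemma conjugate_has_derivative:
  assumes "\<And>q. (X has_derivative DX q) (at q)"
  shows "(conjugate i X has_derivative conjugate i (DX (chart_iso_inv i q))) (at q)"
  unfolding conjugate_def[abs_def]
  by (intro bounded_linear.has_derivative[OF linear_chart_iso(1)]
      has_derivative_compose[OF bounded_linear_imp_has_derivative[OF linear_chart_iso(2)] assms])

lemma norm_conjugate: "norm (conjugate i X q) = norm (X (chart_iso_inv i q))"
  by (simp add: conjugate_def)

text \<open>
In \<open>U4\<close> and \<open>U5\<close> the factor \<open>(-1)^d\<close> cancels the sign of \<open>(-y)^d\<close>, so that all four equatorial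
charts reduce to the first one.
\<close>

lemma local_expr_eq_expr1:
  assumes "i \<in> {U1, U2, U4, U5}" "0 < snd z"
  shows "local_expr d X i z = expr1 d (conjugate i X) z"
proof -
  have e: "(- y) ^ d * (- 1) ^ d = y ^ d" for y :: real
    by (simp only: power_mult_distrib[symmetric]) simp
  have e': "(- y) ^ d * ((- 1) ^ d * t) = y ^ d * t" for y t :: real
    by (simp only: mult.assoc[symmetric] e)
  show ?thesis
    using assms by (cases z) (auto simp: expr1_def expr2_def conjugate_def e e' algebra_simps)
qed

lemma expr1_diff: "expr1 d X z - expr1 d Z z = expr1 d (\<lambda>q. X q - Z q) z"
  by (simp add: expr1_eq algebra_simps)

lemma conjugate_diff: "conjugate i X q - conjugate i Z q = conjugate i (\<lambda>q. X q - Z q) q"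
  by (cases i) (simp_all add: conjugate_def)

lemma local_expr_diff:
  assumes "i \<in> {U1, U2, U4, U5}" "0 < snd z"
  shows "local_expr d X i z - local_expr d Z i z = expr1 d (conjugate i (\<lambda>q. X q - Z q)) z"
  using assms by (simp only: local_expr_eq_expr1 expr1_diff conjugate_diff)

text \<open>
The limit that defines the extension exists because of the quadratic decay in \<open>y\<close>, and it is
unique because points of the equator are limits of points with \<open>y > 0\<close>.
\<close>

lemma compactification_equator_eq_0:
  assumes X: "\<And>q. norm (X q) \<le> C * (1 + norm q)" and "3 \<le> d"
    and i: "i \<in> {U1, U2, U4, U5}" and z: "snd z = 0"
  shows "compactification d X i z = 0"
proof -
  define r where "r = norm z + 1"
  define B where "B = (1 + 2 * r)\<^sup>2 * r ^ (d - 3) * C"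
  let ?F = "at z within {q. 0 < snd q}"
  have "(local_expr d X i \<longlongrightarrow> 0) ?F"
  proof (rule Lim_null_comparison)
    have "\<forall>\<^sub>F w in ?F. norm w < r"
    proof -
      have "(norm \<longlongrightarrow> norm z) ?F" by (intro tendsto_norm tendsto_ident_at)
      then show ?thesis by (rule order_tendstoD) (simp add: r_def)
    qed
    moreover have "\<forall>\<^sub>F w in ?F. 0 < snd w"
      by (auto simp: eventually_at_filter)
    ultimately show "\<forall>\<^sub>F w in ?F. norm (local_expr d X i w) \<le> B * (snd w)\<^sup>2"
    proof eventually_elim
      case (elim w)
      have "norm (conjugate i X q) \<le> C * (1 + norm q)" for q
        using X[of "chart_iso_inv i q"] by (simp add: norm_conjugate)
      from expr1_quadratic_at_equator[OF this \<open>3 \<le> d\<close> elim(2)] elim(1)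
      show ?case
        unfolding local_expr_eq_expr1[OF i elim(2)] B_def by simp
    qed
    have "((\<lambda>w. B * (snd w)\<^sup>2) \<longlongrightarrow> B * (snd z)\<^sup>2) ?F"
      by (intro tendsto_intros)
    then show "((\<lambda>w. B * (snd w)\<^sup>2) \<longlongrightarrow> 0) ?F"
      using z by simp
  qed
  moreover have "?F \<noteq> bot"
  proof -
    have "z islimpt {q. 0 < snd q}"
      unfolding islimpt_approachable
    proof (intro allI impI)
      fix e :: real assume "e > 0"
      then show "\<exists>x'\<in>{q. 0 < snd q}. x' \<noteq> z \<and> dist x' z < e"
        using z by (intro bexI[of _ "z + (0, e / 2)"]) (auto simp: dist_norm prod_eq_iff norm_Pair)
    qed
    then show ?thesis by (simp add: trivial_limit_within)
  qed
  ultimately show ?thesis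
    using i z by (simp add: compactification_def tendsto_Lim)
qed

lemma chart_dom_equator:
  assumes "0 < r" and i: "i \<in> {U1, U2, U4, U5}"
  shows "chart_dom r poincare_disk i = {z. norm z < 2 \<and> 0 \<le> snd z}"
proof (intro equalityI subsetI)
  fix z assume "z \<in> chart_dom r poincare_disk i"
  then obtain p where p: "p \<in> chart_set i" "p \<in> poincare_disk" "norm (chart_map i p) < 2 * r"
    and z: "z = chart_map i p /\<^sub>R r"
    by (auto simp: chart_dom_def)
  have "0 \<le> snd (chart_map i p)"
    using i p by (cases p) (auto simp: poincare_disk_def divide_nonneg_neg divide_le_0_iff)
  then show "z \<in> {z. norm z < 2 \<and> 0 \<le> snd z}"
    using p(3) \<open>0 < r\<close> by (auto simp: z field_simps)
next
  fix z :: "real \<times> real" assume "z \<in> {z. norm z < 2 \<and> 0 \<le> snd z}"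
  then have z: "norm z < 2" "0 \<le> snd z" by auto
  define x y where "x = r * fst z" and "y = r * snd z"
  define \<Delta> where "\<Delta> = sqrt (1 + x\<^sup>2 + y\<^sup>2)"
  have \<Delta>: "0 < \<Delta>" "\<Delta>\<^sup>2 = 1 + x\<^sup>2 + y\<^sup>2"
    unfolding \<Delta>_def by (auto simp: add_pos_nonneg)
  have "0 \<le> y" using z \<open>0 < r\<close> by (simp add: y_def)
  define p where "p = (case i of U1 \<Rightarrow> (1 / \<Delta>, x / \<Delta>, y / \<Delta>) | U2 \<Rightarrow> (x / \<Delta>, 1 / \<Delta>, y / \<Delta>)
     | U4 \<Rightarrow> (- 1 / \<Delta>, x / \<Delta>, y / \<Delta>) | _ \<Rightarrow> (x / \<Delta>, - 1 / \<Delta>, y / \<Delta>))"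
  have "(1 + x\<^sup>2 + y\<^sup>2) / \<Delta>\<^sup>2 = 1"
    using \<Delta> by (metis divide_self_if less_irrefl zero_less_power)
  then have sq: "1 / \<Delta>\<^sup>2 + x\<^sup>2 / \<Delta>\<^sup>2 + y\<^sup>2 / \<Delta>\<^sup>2 = 1" "x\<^sup>2 / \<Delta>\<^sup>2 + 1 / \<Delta>\<^sup>2 + y\<^sup>2 / \<Delta>\<^sup>2 = 1"
    unfolding add_divide_distrib by linarith+
  have "p \<in> chart_set i" "p \<in> poincare_disk" "chart_map i p = (x, y)"
    using i \<Delta>(1) sq \<open>0 \<le> y\<close> by (auto simp: p_def poincare_disk_def power_divide)
  moreover have xy: "(x, y) = r *\<^sub>R z" by (cases z) (simp add: x_def y_def)
  ultimately have "p \<in> {p \<in> chart_set i \<inter> poincare_disk. norm (chart_map i p) < 2 * r}"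
    "z = chart_map i p /\<^sub>R r"
    using z \<open>0 < r\<close> by auto
  then show "z \<in> chart_dom r poincare_disk i"
    unfolding chart_dom_def by blast
qed

lemma chart_dom_U3:
  assumes "0 < r"
  shows "chart_dom r poincare_disk U3 = ball 0 2"
proof (intro equalityI subsetI)
  fix z assume "z \<in> chart_dom r poincare_disk U3"
  then obtain p where p: "norm (chart_map U3 p) < 2 * r" and z: "z = chart_map U3 p /\<^sub>R r"
    unfolding chart_dom_def by blast
  have "norm z = norm (chart_map U3 p) / r"
    using \<open>0 < r\<close> unfolding z by (simp add: divide_inverse)
  then show "z \<in> ball 0 2"
    using p \<open>0 < r\<close> by (simp add: divide_less_eq)
next
  fix z :: "real \<times> real" assume z: "z \<in> ball 0 2"
  define x y where "x = r * fst z" and "y = r * snd z"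
  define \<Delta> where "\<Delta> = sqrt (1 + x\<^sup>2 + y\<^sup>2)"
  have \<Delta>: "0 < \<Delta>" "\<Delta>\<^sup>2 = 1 + x\<^sup>2 + y\<^sup>2"
    unfolding \<Delta>_def by (auto simp: add_pos_nonneg)
  define p where "p = (x / \<Delta>, y / \<Delta>, 1 / \<Delta>)"
  have "(1 + x\<^sup>2 + y\<^sup>2) / \<Delta>\<^sup>2 = 1"
    using \<Delta> by (metis divide_self_if less_irrefl zero_less_power)
  then have sq: "x\<^sup>2 / \<Delta>\<^sup>2 + y\<^sup>2 / \<Delta>\<^sup>2 + 1 / \<Delta>\<^sup>2 = 1"
    unfolding add_divide_distrib by linarith
  have "p \<in> chart_set U3" "p \<in> poincare_disk" "chart_map U3 p = (x, y)"
    using \<Delta>(1) sq by (auto simp: p_def poincare_disk_def power_divide)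
  moreover have xy: "(x, y) = r *\<^sub>R z" by (cases z) (simp add: x_def y_def)
  ultimately have "p \<in> {p \<in> chart_set U3 \<inter> poincare_disk. norm (chart_map U3 p) < 2 * r}"
    "z = chart_map U3 p /\<^sub>R r"
    using z \<open>0 < r\<close> by auto
  then show "z \<in> chart_dom r poincare_disk U3"
    unfolding chart_dom_def by blast
qed

lemma chart_dom_U6: "chart_dom r poincare_disk U6 = {}"
  by (auto simp: chart_dom_def poincare_disk_def)

text \<open>
Both kinds of chart domain contain, from each of their points, a short segment in each coordinate
direction, so the derivative relative to the domain is unique, also on the equator.
\<close>

lemma deriv_norm_le:
  assumes E: "(E has_derivative E') (at z within S)" and le: "\<And>h. norm (E' h) \<le> B * norm h"
    and S: "S = ball 0 2 \<or> S = {z. norm z < 2 \<and> 0 \<le> snd z}" and z: "z \<in> S"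
  shows "deriv_norm E S z \<le> ennreal B"
proof -
  have diff: "E differentiable (at z within S)"
    using E by (auto simp: differentiable_def)
  have "frechet_derivative E (at z within S) = E'"
  proof (rule frechet_derivative_unique_within)
    show "(E has_derivative frechet_derivative E (at z within S)) (at z within S)"
      using diff by (simp add: frechet_derivative_works)
    show "(E has_derivative E') (at z within S)" by fact
    fix i :: "real \<times> real" and e :: real
    assume i: "i \<in> Basis" and "e > 0"
    define t where "t = min (e / 2) ((2 - norm z) / 2)"
    have nz: "norm z < 2" using z S by auto
    then have t: "0 < t" "t < e" "t < 2 - norm z"
      using \<open>e > 0\<close> by (auto simp: t_def min_def field_simps)
    have "0 \<le> snd i" using i by (auto simp: Basis_prod_def)
    moreover have "norm (z + t *\<^sub>R i) < 2"
      using norm_triangle_ineq[of z "t *\<^sub>R i"] t i by simp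
    ultimately have "z + t *\<^sub>R i \<in> S"
      using S z t(1) by auto
    with t show "\<exists>d. 0 < \<bar>d\<bar> \<and> \<bar>d\<bar> < e \<and> z + d *\<^sub>R i \<in> S"
      by (intro exI[of _ t]) auto
  qed
  moreover have "onorm E' \<le> B"
    by (rule onorm_le) (rule le)
  ultimately show ?thesis
    using diff by (simp add: deriv_norm_def ennreal_leI)
qed

text \<open>
The factor \<open>r\<close> of the chain rule cancels the division by \<open>r\<close>, so derivatives are insensitive to
the scaling of the charts.
\<close>

lemma has_derivative_rescaled:
  assumes "(E has_derivative E') (at (r *\<^sub>R z))" "0 < r"
  shows "(rescaled r E has_derivative E') (at z)"
proof -
  have lin: "bounded_linear E'" using assms(1) by (rule has_derivative_bounded_linear)
  have "((\<lambda>z. E (r *\<^sub>R z)) has_derivative (\<lambda>h. E' (r *\<^sub>R h))) (at z)"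
    by (rule has_derivative_compose[of "\<lambda>z. r *\<^sub>R z" "\<lambda>h. r *\<^sub>R h" z UNIV E E'])
      (use assms(1) in \<open>auto intro!: derivative_eq_intros\<close>)
  then have "((\<lambda>z. E (r *\<^sub>R z) /\<^sub>R r) has_derivative (\<lambda>h. E' (r *\<^sub>R h) /\<^sub>R r)) (at z)"
    by (rule has_derivative_scaleR_right)
  moreover have "(\<lambda>h. E' (r *\<^sub>R h) /\<^sub>R r) = E'"
    using assms(2) by (simp add: fun_eq_iff linear_simps(5)[OF lin])
  ultimately show ?thesis
    by (simp add: rescaled_def[abs_def])
qed

lemma has_derivative_0_if_quadratic:
  assumes "\<And>w. w \<in> S \<Longrightarrow> norm (E w - E z) \<le> C * (norm (w - z))\<^sup>2"
  shows "(E has_derivative (\<lambda>h. 0)) (at z within S)"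
  unfolding has_derivative_within_alt
proof (intro conjI allI impI)
  fix e :: real assume "e > 0"
  show "\<exists>d>0. \<forall>y\<in>S. norm (y - z) < d \<longrightarrow> norm (E y - E z - 0) \<le> e * norm (y - z)"
  proof (intro exI[of _ "e / (\<bar>C\<bar> + 1)"] conjI ballI impI)
    fix w assume w: "w \<in> S" "norm (w - z) < e / (\<bar>C\<bar> + 1)"
    have "norm (E w - E z) \<le> C * norm (w - z) * norm (w - z)"
      using assms[OF w(1)] by (simp add: power2_eq_square)
    also have "C * norm (w - z) \<le> (\<bar>C\<bar> + 1) * norm (w - z)"
      by (intro mult_right_mono) auto
    also have "\<dots> \<le> e"
      using w(2) by (simp add: field_simps)
    finally show "norm (E w - E z - 0) \<le> e * norm (w - z)"
      by (simp add: mult_right_mono)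
  qed (use \<open>e > 0\<close> in auto)
qed simp

text \<open>
The first summand serves the equatorial charts, where it dominates both the field and its
derivative. The other two bound the field and its derivative in \<open>U3\<close> at points of norm at most
\<open>r\<close>.
\<close>

definition chart_bound :: "nat \<Rightarrow> real \<Rightarrow> real" where
  "chart_bound d r = (2 * real d + 5) * (1 + 2 * r) ^ 3 * r ^ (d - 3) + (1 + r)\<^sup>2 / r + (1 + r)"

text \<open>
The weighted hypotheses on \<open>X - X0\<close> give the size of the norm, while the bounds with \<open>C\<close> and \<open>C0\<close>
make both fields grow linearly, so that the extensions to the equator exist and are differentiable
there.
\<close>

lemma C1_norm_compactification_le:
  assumes X: "\<And>q. (X has_derivative DX q) (at q)" "\<And>q h. norm (DX q h) \<le> C * norm h"
    and X0: "\<And>q. (X0 has_derivative DX0 q) (at q)" "\<And>q h. norm (DX0 q h) \<le> C0 * norm h"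
    and "norm (X 0 - X0 0) \<le> \<kappa>"
    and D: "\<And>q h. norm (DX q h - DX0 q h) \<le> \<kappa> * (1 + norm q) * norm h"
    and "3 \<le> d" "0 < r"
  shows "C1_norm r poincare_disk (\<lambda>i z. compactification d X i z - compactification d X0 i z)
    \<le> ennreal (chart_bound d r * \<kappa>)"
proof -
  have "0 \<le> \<kappa>" using order_trans[OF norm_ge_zero assms(5)] .
  define Z DZ where "Z = (\<lambda>q. X q - X0 q)" and "DZ = (\<lambda>q h. DX q h - DX0 q h)"
  have Z: "(Z has_derivative DZ q) (at q)" for q
    unfolding Z_def DZ_def by (rule has_derivative_diff[OF X(1) X0(1)])
  have Z_le: "norm (Z q) \<le> \<kappa> * (1 + norm q)\<^sup>2" for q
    by (rule weighted_growth[OF Z]) (use assms(5) D \<open>0 \<le> \<kappa>\<close> in \<open>auto simp: Z_def DZ_def\<close>)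
  define G G0 where "G = norm (X 0) + \<bar>C\<bar>" and "G0 = norm (X0 0) + \<bar>C0\<bar>"
  have gX: "norm (X q) \<le> G * (1 + norm q)" and gX0: "norm (X0 q) \<le> G0 * (1 + norm q)" for q
    unfolding G_def G0_def by (rule linear_growth[OF X] linear_growth[OF X0])+
  have gZ: "norm (Z q) \<le> (G + G0) * (1 + norm q)" for q
    using norm_triangle_ineq4[of "X q" "X0 q"] gX[of q] gX0[of q] by (simp add: Z_def algebra_simps)
  define Y where "Y = (\<lambda>i z. compactification d X i z - compactification d X0 i z)"
  have pos: "0 \<le> (2 * real d + 5) * (1 + 2 * r) ^ 3 * r ^ (d - 3)" "0 \<le> (1 + r)\<^sup>2 / r"
    using \<open>0 < r\<close> by auto
  have "max (ennreal (norm (rescaled r (Y i) z))) (deriv_norm (rescaled r (Y i)) (chart_dom r poincare_disk i) z)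
      \<le> ennreal (chart_bound d r * \<kappa>)"
    if z: "z \<in> chart_dom r poincare_disk i \<inter> ball 0 1" for i z
  proof -
    have nz: "norm (r *\<^sub>R z) \<le> r" using z \<open>0 < r\<close> by simp
    consider "i = U3" | "i = U6" | "i \<in> {U1, U2, U4, U5}" by (cases i) auto
    then show ?thesis
    proof cases
      case 1
      have Y: "Y i = Z" using 1 by (simp add: Y_def Z_def fun_eq_iff compactification_def)
      have "norm (Z (r *\<^sub>R z)) \<le> \<kappa> * (1 + r)\<^sup>2"
        using nz \<open>0 \<le> \<kappa>\<close> by (intro order_trans[OF Z_le] mult_left_mono power_mono) auto
      then have "norm (rescaled r Z z) \<le> (1 + r)\<^sup>2 / r * \<kappa>"
        using \<open>0 < r\<close> by (simp add: rescaled_def field_simps)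
      also have "\<dots> \<le> chart_bound d r * \<kappa>"
        using pos \<open>0 < r\<close> \<open>0 \<le> \<kappa>\<close> by (intro mult_right_mono) (auto simp: chart_bound_def)
      finally have a: "norm (rescaled r Z z) \<le> chart_bound d r * \<kappa>" .
      have "deriv_norm (rescaled r Z) (chart_dom r poincare_disk i) z \<le> ennreal (chart_bound d r * \<kappa>)"
      proof (rule deriv_norm_le)
        show "(rescaled r Z has_derivative DZ (r *\<^sub>R z)) (at z within chart_dom r poincare_disk i)"
          by (rule has_derivative_at_withinI[OF has_derivative_rescaled[OF Z \<open>0 < r\<close>]])
        fix h
        have "norm (DZ (r *\<^sub>R z) h) \<le> \<kappa> * (1 + norm (r *\<^sub>R z)) * norm h"
          unfolding DZ_def by (rule D)
        also have "\<dots> \<le> chart_bound d r * \<kappa> * norm h"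
        proof (rule mult_right_mono)
          have "\<kappa> * (1 + norm (r *\<^sub>R z)) \<le> \<kappa> * chart_bound d r"
            using nz pos \<open>0 \<le> \<kappa>\<close> by (intro mult_left_mono) (auto simp: chart_bound_def)
          then show "\<kappa> * (1 + norm (r *\<^sub>R z)) \<le> chart_bound d r * \<kappa>" by (simp add: mult.commute)
        qed simp
        finally show "norm (DZ (r *\<^sub>R z) h) \<le> chart_bound d r * \<kappa> * norm h" .
      qed (use z 1 chart_dom_U3[OF \<open>0 < r\<close>] in auto)
      with a show ?thesis by (simp add: Y ennreal_leI)
    next
      case 2
      then show ?thesis using z by (simp add: chart_dom_U6)
    next
      case 3
      define S where "S = {z::real \<times> real. norm z < 2 \<and> 0 \<le> snd z}"
      have S: "chart_dom r poincare_disk i = S"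
        unfolding S_def by (rule chart_dom_equator[OF \<open>0 < r\<close> 3])
      have Y0: "Y i w = 0" if "snd w = 0" for w
        using compactification_equator_eq_0[OF gX \<open>3 \<le> d\<close> 3 that]
          compactification_equator_eq_0[OF gX0 \<open>3 \<le> d\<close> 3 that] by (simp add: Y_def)
      have Y1: "Y i w = expr1 d (conjugate i Z) w" if "0 < snd w" for w
        unfolding Y_def Z_def local_expr_diff[OF 3 that, symmetric]
        using that by (simp add: compactification_def)
      have cZ: "norm (conjugate i Z q) \<le> \<kappa> * (1 + norm q)\<^sup>2" for q
        using Z_le[of "chart_iso_inv i q"] by (simp add: norm_conjugate)
      have cgZ: "norm (conjugate i Z q) \<le> (G + G0) * (1 + norm q)" for q
        using gZ[of "chart_iso_inv i q"] by (simp add: norm_conjugate)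
      have cD: "norm (conjugate i (DZ (chart_iso_inv i q)) h) \<le> \<kappa> * (1 + norm q) * norm h" for q h
        using D[of "chart_iso_inv i q" "chart_iso_inv i h"] by (simp add: norm_conjugate DZ_def)
      have zS: "z \<in> S" using z S by auto
      have le: "t \<le> chart_bound d r * \<kappa>"
        if "t \<le> (2 * real d + 5) * (1 + 2 * r) ^ 3 * r ^ (d - 3) * \<kappa>" for t
      proof -
        have "(2 * real d + 5) * (1 + 2 * r) ^ 3 * r ^ (d - 3) * \<kappa> \<le> chart_bound d r * \<kappa>"
          using pos \<open>0 < r\<close> \<open>0 \<le> \<kappa>\<close> by (intro mult_right_mono) (auto simp: chart_bound_def)
        with that show ?thesis by linarith
      qed
      show ?thesis
      proof (cases "snd z = 0")
        case True
        have R0: "rescaled r (Y i) z = 0" using True by (simp add: rescaled_def Y0)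
        \<comment> \<open>The derivative is taken relative to all of \<open>S\<close>, whose points scale to norm up to \<open>2 * r\<close>; one
            factor \<open>r\<close> remains of \<open>(r * snd w)\<^sup>2\<close> after the division by \<open>r\<close>.\<close>
        define B where "B = (1 + 2 * (2 * r))\<^sup>2 * (2 * r) ^ (d - 3) * (G + G0) * r"
        have "(rescaled r (Y i) has_derivative (\<lambda>h. 0)) (at z within S)"
        proof (rule has_derivative_0_if_quadratic)
          fix w assume w: "w \<in> S"
          have q: "norm (rescaled r (Y i) w) \<le> B * (snd w)\<^sup>2"
          proof (cases "snd w = 0")
            case True
            then show ?thesis by (simp add: rescaled_def Y0)
          next
            case False
            then have "0 < snd (r *\<^sub>R w)" "norm (r *\<^sub>R w) \<le> 2 * r"
              using w \<open>0 < r\<close> by (auto simp: S_def)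
            from expr1_quadratic_at_equator[OF cgZ \<open>3 \<le> d\<close> this] Y1[OF this(1)]
            have "norm (Y i (r *\<^sub>R w)) \<le> (1 + 2 * (2 * r))\<^sup>2 * (2 * r) ^ (d - 3) * (G + G0) * (snd (r *\<^sub>R w))\<^sup>2"
              by simp
            then show ?thesis
              using \<open>0 < r\<close> by (simp add: rescaled_def B_def power_mult_distrib power2_eq_square[of r] field_simps)
          qed
          have "\<bar>snd w\<bar> \<le> norm (w - z)"
            using abs_components_le(2)[of "w - z"] True by simp
          then have "(snd w)\<^sup>2 \<le> (norm (w - z))\<^sup>2"
            using power_mono[of "\<bar>snd w\<bar>" "norm (w - z)" 2] by simp
          moreover have "0 \<le> B"
            using \<open>0 < r\<close> by (simp add: B_def G_def G0_def)
          ultimately have "B * (snd w)\<^sup>2 \<le> B * (norm (w - z))\<^sup>2"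
            by (intro mult_left_mono)
          with q R0 show "norm (rescaled r (Y i) w - rescaled r (Y i) z) \<le> B * (norm (w - z))\<^sup>2"
            by simp
        qed
        then have "deriv_norm (rescaled r (Y i)) S z \<le> ennreal 0"
          by (rule deriv_norm_le) (use zS in \<open>auto simp: S_def\<close>)
        then show ?thesis using R0 by (simp add: S)
      next
        case False
        then have pos': "0 < snd (r *\<^sub>R z)" using zS \<open>0 < r\<close> by (simp add: S_def)
        have "norm (Y i (r *\<^sub>R z)) \<le> (1 + 2 * r) ^ 3 * r ^ (d - 3) * r * \<kappa>"
          unfolding Y1[OF pos'] by (rule expr1_weighted_norm_le[OF cZ \<open>3 \<le> d\<close> pos' nz \<open>0 \<le> \<kappa>\<close>])
        then have "norm (rescaled r (Y i) z) \<le> (1 + 2 * r) ^ 3 * r ^ (d - 3) * \<kappa>"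
          using \<open>0 < r\<close> by (simp add: rescaled_def field_simps)
        also have "\<dots> \<le> (2 * real d + 5) * ((1 + 2 * r) ^ 3 * r ^ (d - 3) * \<kappa>)"
        proof -
          have "0 \<le> (1 + 2 * r) ^ 3 * r ^ (d - 3) * \<kappa>" using \<open>0 < r\<close> \<open>0 \<le> \<kappa>\<close> by simp
          then show ?thesis by (simp add: mult_le_cancel_right1 mult_right_mono[of 1 "2 * real d + 5", simplified])
        qed
        finally have a: "norm (rescaled r (Y i) z) \<le> chart_bound d r * \<kappa>"
          by (intro le) (simp add: mult.assoc)
        obtain E' where E': "(expr1 d (conjugate i Z) has_derivative E') (at (r *\<^sub>R z))"
          "\<And>h. norm (E' h) \<le> (2 * real d + 5) * (1 + 2 * r) ^ 3 * r ^ (d - 3) * \<kappa> * norm h"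
          using expr1_weighted_derivative[OF conjugate_has_derivative[OF Z] cZ cD \<open>0 \<le> \<kappa>\<close> \<open>3 \<le> d\<close> pos' nz]
          by blast
        have "(Y i has_derivative E') (at (r *\<^sub>R z))"
        proof (rule has_derivative_transform_within_open[OF E'(1)])
          show "open {w::real \<times> real. 0 < snd w}"
            by (intro open_Collect_less continuous_intros)
        qed (use pos' Y1 in auto)
        then have "(rescaled r (Y i) has_derivative E') (at z within S)"
          by (rule has_derivative_at_withinI[OF has_derivative_rescaled[OF _ \<open>0 < r\<close>]])
        then have "deriv_norm (rescaled r (Y i)) S z \<le> ennreal (chart_bound d r * \<kappa>)"
        proof (rule deriv_norm_le)
          show "norm (E' h) \<le> chart_bound d r * \<kappa> * norm h" for h
            using E'(2)[of h] mult_right_mono[OF le[OF order_refl], of "norm h"] by simp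
        qed (use zS in \<open>auto simp: S_def\<close>)
        with a show ?thesis by (simp add: S ennreal_leI)
      qed
    qed
  qed
  then show ?thesis
    unfolding C1_norm_def Y_def by (intro SUP_least)
qed

section \<open>Parity of the degree\<close>

text \<open>
The condition makes \<open>h\<close> negative near \<open>\<infinity>\<close> and positive near \<open>-\<infinity>\<close>, while a polynomial of even
degree has the sign of its leading coefficient at both ends; for a negative leading coefficient this
is applied to \<open>- h (- x)\<close>. The zero polynomial fails the strict inequality.
\<close>

lemma dissipative_imp_odd_degree:
  fixes h :: "real poly"
  assumes "Limsup at_infinity (\<lambda>x. ereal (poly h x / x)) < 0"
  shows "odd (degree h)"
proof
  assume even: "even (degree h)"
  have "\<forall>\<^sub>F x in at_infinity. poly h x / x < 0"
    using Limsup_lessD[OF assms] by simp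
  then obtain B where B: "\<And>x. B \<le> \<bar>x\<bar> \<Longrightarrow> poly h x / x < 0"
    by (auto simp: eventually_at_infinity)
  consider "lead_coeff h = 0" | "lead_coeff h > 0" | "lead_coeff h < 0" by linarith
  then show False
  proof cases
    case 1
    then show False using B[of "\<bar>B\<bar>"] by (simp add: abs_ge_self)
  next
    case 2
    then obtain n where n: "\<And>x. x \<ge> n \<Longrightarrow> poly h x \<ge> lead_coeff h"
      using poly_pinfty_gt_lc by blast
    define x where "x = max 1 (max n \<bar>B\<bar>)"
    have x: "n \<le> x" "1 \<le> x" "\<bar>B\<bar> \<le> x"
      by (simp_all add: x_def)
    have "poly h x > 0" using n[OF x(1)] 2 by linarith
    moreover have "poly h x / x < 0" by (rule B) (use x in linarith)
    moreover have "x > 0" using x by linarith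
    ultimately show False by (simp add: divide_less_0_iff zero_less_divide_iff)
  next
    case 3
    define q where "q = - pcompose h [:0, -1:]"
    have "lead_coeff q = - lead_coeff h"
    proof -
      have "lead_coeff (pcompose h [:0, -1:]) = lead_coeff h * lead_coeff [:0, -1::real:] ^ degree h"
        by (rule lead_coeff_comp) simp
      also have "\<dots> = lead_coeff h" using even by simp
      finally show ?thesis by (simp add: q_def)
    qed
    then have "lead_coeff q > 0" using 3 by simp
    then obtain n where n: "\<And>x. x \<ge> n \<Longrightarrow> poly q x \<ge> lead_coeff q"
      using poly_pinfty_gt_lc by blast
    define x where "x = max 1 (max n \<bar>B\<bar>)"
    have x: "n \<le> x" "1 \<le> x" "\<bar>B\<bar> \<le> x"
      by (simp_all add: x_def)
    have "poly q x > 0" using n[OF x(1)] \<open>lead_coeff q > 0\<close> by linarith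
    then have "poly h (- x) < 0" by (simp add: q_def poly_pcompose)
    moreover have "poly h (- x) / (- x) < 0" by (rule B) (use x in linarith)
    moreover have "x > 0" using x by linarith
    ultimately show False by (simp add: divide_less_0_iff zero_less_divide_iff)
  qed
qed

section \<open>Convergence of the compactified fields\<close>

theorem theorem3p1:
  fixes lam beta eps0 m0 K r :: real
    and a :: "real \<Rightarrow> real \<Rightarrow> real"
    and f1 f2 g1 g2 :: "real poly"
    and F1 F2 G1 G2 :: "real \<Rightarrow> real"
    and d :: nat
    and ev :: "real \<Rightarrow> nat \<Rightarrow> real"
    and phi :: "real \<Rightarrow> real \<Rightarrow> real"
    and s :: "real \<Rightarrow> state \<Rightarrow> state"
    and Ds :: "real \<Rightarrow> state \<Rightarrow> state \<Rightarrow> state"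
    and Att :: "real \<Rightarrow> (real \<times> real) set"
    and X :: "real \<Rightarrow> planar_field"
  assumes pos: "lam > 0" "beta > 0" "eps0 > 0" "m0 > 0"
    and a_C1: "\<And>\<epsilon>. \<epsilon> \<in> {0<..eps0} \<Longrightarrow> C1_on_unit (a \<epsilon>)"
    and a_lower: "\<And>\<epsilon> x. \<epsilon> \<in> {0<..eps0} \<Longrightarrow> x \<in> {0..1} \<Longrightarrow> m0 \<le> a \<epsilon> x"
    and a_large: "filterlim (\<lambda>\<epsilon>. INF x\<in>{0..1}. a \<epsilon> x) at_top (at_right 0)"
    and d_def: "d = Max {degree f1, degree f2, degree g1, degree g2}"
    and degs: "2 \<le> d" "degree g1 \<le> d - 1" "degree f1 \<le> d - 1"
    and dissipative:
      "\<And>h. h \<in> {f1, f2, g1, g2} \<Longrightarrow> Limsup at_infinity (\<lambda>x. ereal (poly h x / x)) < 0"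
    \<comment> \<open>eigenvalues and eigenfunctions\<close>
    and spectrum: "\<And>\<epsilon>. \<epsilon> \<in> {0<..eps0} \<Longrightarrow>
      {ev \<epsilon> k | k. 1 \<le> k} = {mu. \<exists>U. eigenpair (a \<epsilon>) lam beta mu U}"
    and ev1: "\<And>\<epsilon>. \<epsilon> \<in> {0<..eps0} \<Longrightarrow>
      ev \<epsilon> 1 = beta \<and> eigenpair (a \<epsilon>) lam beta (ev \<epsilon> 1) ((\<lambda>_. 0), 1)"
    and ev2: "\<And>\<epsilon>. \<epsilon> \<in> {0<..eps0} \<Longrightarrow>
      eigenpair (a \<epsilon>) lam beta (ev \<epsilon> 2) (phi \<epsilon>, 0) \<and> l2_norm (phi \<epsilon>) = 1"
    and ev2_lim: "((\<lambda>\<epsilon>. ev \<epsilon> 2) \<longlongrightarrow> lam) (at_right 0)"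
    and phi_lim: "((\<lambda>\<epsilon>. l2_norm (\<lambda>x. phi \<epsilon> x - 1)) \<longlongrightarrow> 0) (at_right 0)"
    and ev_large: "\<And>k. 3 \<le> k \<Longrightarrow> filterlim (\<lambda>\<epsilon>. ev \<epsilon> k) at_top (at_right 0)"
    \<comment> \<open>truncated nonlinearities, planar fields and their attractors\<close>
    and trunc: "truncation K f1 F1" "truncation K f2 F2" "truncation K g1 G1" "truncation K g2 G2"
    and X_0: "X 0 = X_zero lam beta F1 F2 G1 G2"
    and X_pos: "\<And>\<epsilon>. \<epsilon> \<in> {0<..eps0} \<Longrightarrow>
      X \<epsilon> = X_eps (ev \<epsilon> 2) beta F1 F2 G1 G2 (phi \<epsilon>) (s \<epsilon>)"
    and attractors: "\<And>\<epsilon>. \<epsilon> \<in> {0..eps0} \<Longrightarrow> global_attractor (X \<epsilon>) (Att \<epsilon>)"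
    and Att_bounded: "bounded (\<Union>\<epsilon>\<in>{0..eps0}. Att \<epsilon>)"
    and K_def: "K = (SUP p\<in>(\<Union>\<epsilon>\<in>{0..eps0}. Att \<epsilon>). max \<bar>fst p\<bar> \<bar>snd p\<bar>)"
    \<comment> \<open>invariant manifold\<close>
    and s_C1: "\<And>\<epsilon>. \<epsilon> \<in> {0<..eps0} \<Longrightarrow> C1_into_Y_perp (phi \<epsilon>) (s \<epsilon>) (Ds \<epsilon>)"
    and s_small: "((\<lambda>\<epsilon>. (SUP V\<in>Y (phi \<epsilon>). ennreal (st_norm (s \<epsilon> V)))
        + (SUP V\<in>Y (phi \<epsilon>). Y_opnorm (phi \<epsilon>) (Ds \<epsilon> V))) \<longlongrightarrow> 0) (at_right 0)"
    and s_manifold: "\<And>\<epsilon>. \<epsilon> \<in> {0<..eps0} \<Longrightarrow> exp_attracting_invariant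
      {U. weak_solution (a \<epsilon>) lam beta F1 F2 G1 G2 U} (manifold (phi \<epsilon>) (s \<epsilon>))"
    \<comment> \<open>admissible scaling of the charts in the C1-norm\<close>
    and r: "0 < r" "poincare_disk \<subseteq> (\<Union>i. cover_set r i)"
  shows "((\<lambda>\<epsilon>. C1_norm r poincare_disk
      (\<lambda>i z. compactification d (X \<epsilon>) i z - compactification d (X 0) i z)) \<longlongrightarrow> 0) (at_right 0)"
proof -
  have "odd d"
  proof -
    have "d \<in> {degree f1, degree f2, degree g1, degree g2}"
      unfolding d_def by (intro Max_in) auto
    then obtain h where "h \<in> {f1, f2, g1, g2}" "d = degree h" by auto
    then show ?thesis using dissipative_imp_odd_degree[OF dissipative] by blast
  qed
  \<comment> \<open>The parity excludes the borderline value \<open>d = 2\<close>.\<close>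
  then have d3: "3 \<le> d"
    using degs(1) by (cases "d = 2") auto
  obtain F1' L1 where F1: "\<And>x. (F1 has_real_derivative F1' x) (at x)" "continuous_on UNIV F1'"
    "\<And>x. \<bar>F1' x\<bar> \<le> L1" "\<And>x y. \<bar>F1 x - F1 y\<bar> \<le> L1 * \<bar>x - y\<bar>" "0 \<le> L1"
    by (rule truncation_derivative[OF trunc(1)]) (rule that)
  obtain F2' L2 where F2: "\<And>x. (F2 has_real_derivative F2' x) (at x)" "continuous_on UNIV F2'"
    "\<And>x. \<bar>F2' x\<bar> \<le> L2" "\<And>x y. \<bar>F2 x - F2 y\<bar> \<le> L2 * \<bar>x - y\<bar>" "0 \<le> L2"
    by (rule truncation_derivative[OF trunc(2)]) (rule that)
  obtain G1' L3 where G1: "\<And>x. (G1 has_real_derivative G1' x) (at x)" "continuous_on UNIV G1'"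
    "\<And>x. \<bar>G1' x\<bar> \<le> L3" "\<And>x y. \<bar>G1 x - G1 y\<bar> \<le> L3 * \<bar>x - y\<bar>" "0 \<le> L3"
    by (rule truncation_derivative[OF trunc(3)]) (rule that)
  obtain G2' L4 where G2: "\<And>x. (G2 has_real_derivative G2' x) (at x)" "continuous_on UNIV G2'"
    "\<And>x. \<bar>G2' x\<bar> \<le> L4" "\<And>x y. \<bar>G2 x - G2 y\<bar> \<le> L4 * \<bar>x - y\<bar>" "0 \<le> L4"
    by (rule truncation_derivative[OF trunc(4)]) (rule that)
  define L where "L = L1 + L2 + L3 + L4"
  have L: "0 \<le> L" "L1 \<le> L" "L2 \<le> L" "L3 \<le> L" "L4 \<le> L"
    using F1(5) F2(5) G1(5) G2(5) by (auto simp: L_def)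
  have bF1: "\<bar>F1' x\<bar> \<le> L" and bF2: "\<bar>F2' x\<bar> \<le> L" and bG1: "\<bar>G1' x\<bar> \<le> L" and bG2: "\<bar>G2' x\<bar> \<le> L" for x
    using order_trans[OF F1(3) L(2)] order_trans[OF F2(3) L(3)] order_trans[OF G1(3) L(4)]
      order_trans[OF G2(3) L(5)] by auto
  have lF1: "\<bar>F1 x - F1 y\<bar> \<le> L * \<bar>x - y\<bar>" and lF2: "\<bar>F2 x - F2 y\<bar> \<le> L * \<bar>x - y\<bar>" for x y
    using order_trans[OF F1(4) mult_right_mono[OF L(2) abs_ge_zero]]
      order_trans[OF F2(4) mult_right_mono[OF L(3) abs_ge_zero]] by auto
  define cb where "cb = chart_bound d r"
  have "0 < cb"
  proof -
    have "0 \<le> (2 * real d + 5) * (1 + 2 * r) ^ 3 * r ^ (d - 3)" "0 \<le> (1 + r)\<^sup>2 / r"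
      using r(1) by auto
    then show ?thesis using r(1) unfolding cb_def chart_bound_def by linarith
  qed
  define D0 where "D0 = DX_zero lam beta F1' F2' G1' G2'"
  have X0: "(X 0 has_derivative D0 q) (at q)" for q
    unfolding X_0 D0_def by (rule X_zero_has_derivative[OF F1(1) F2(1) G1(1) G2(1)])
  have D0_le: "norm (D0 q h) \<le> (\<bar>lam\<bar> + \<bar>beta\<bar> + 4 * L) * norm h" for q h
    unfolding D0_def by (rule norm_DX_zero_le[OF bF1 bF2 bG1 bG2])
  show ?thesis
  proof (rule order_tendstoI)
    fix e :: ennreal assume "0 < e"
    then obtain b where b: "0 < b" "b < e" using dense by blast
    define c where "c = enn2real b"
    have "b < top" using b(2) by (rule order_less_le_trans) simp
    then have c: "0 < c" "ennreal c < e"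
      using b by (auto simp: c_def enn2real_positive_iff)
    define \<kappa> where "\<kappa> = c / cb"
    have \<kappa>: "0 < \<kappa>" "cb * \<kappa> = c" using c(1) \<open>0 < cb\<close> by (auto simp: \<kappa>_def)
    obtain \<eta> where \<eta>: "0 < \<eta>" "\<eta> \<le> 1" and est: "\<And>lam2 phi s Ds. near_limit \<eta> lam lam2 phi s Ds \<Longrightarrow>
      norm (X_eps lam2 beta F1 F2 G1 G2 phi s 0 - X_zero lam beta F1 F2 G1 G2 0) \<le> \<kappa> \<and>
      (\<forall>q h. norm (DX_eps lam2 beta F1' F2' G1' G2' phi s Ds q h - DX_zero lam beta F1' F2' G1' G2' q h)
         \<le> \<kappa> * (1 + norm q) * norm h) \<and>
      (\<exists>C. \<forall>q h. norm (DX_eps lam2 beta F1' F2' G1' G2' phi s Ds q h) \<le> C * norm h)"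
      by (rule X_eps_close_to_X_zero[where lam = lam and beta = beta and ?G1.0 = G1 and ?G2.0 = G2
            and G1' = G1' and G2' = G2', OF F1(1,2) bF1 lF1 F2(1,2) bF2 lF2 bG1 bG2 L(1) \<kappa>(1)])
        blast
    \<comment> \<open>The slope of the eigenfunction is then at most \<open>\<eta> / 4\<close>, which with an \<open>L\<^sup>2\<close> distance below
        \<open>\<eta> / 2\<close> gives \<open>\<bar>phi \<epsilon> x - 1\<bar> \<le> \<eta>\<close>.\<close>
    define \<delta> where "\<delta> = min \<eta> (m0 * \<eta> / 4)"
    have "0 < \<delta>" using \<eta> pos(4) by (simp add: \<delta>_def)
    have ev_eps: "\<forall>\<^sub>F \<epsilon> in at_right 0. \<epsilon> \<in> {0<..eps0}"
      using eventually_at_right_less eventually_at_right_real[OF pos(3)] by eventually_elim auto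
    have ev_lam: "\<forall>\<^sub>F \<epsilon> in at_right 0. \<bar>ev \<epsilon> 2 - lam\<bar> < \<delta>"
      using tendstoD[OF ev2_lim \<open>0 < \<delta>\<close>] by (simp add: dist_real_def)
    have ev_phi: "\<forall>\<^sub>F \<epsilon> in at_right 0. l2_norm (\<lambda>x. phi \<epsilon> x - 1) < \<eta> / 2"
      using order_tendstoD(2)[OF phi_lim, of "\<eta> / 2"] \<eta> by simp
    have ev_s: "\<forall>\<^sub>F \<epsilon> in at_right 0. (SUP V\<in>Y (phi \<epsilon>). ennreal (st_norm (s \<epsilon> V)))
        + (SUP V\<in>Y (phi \<epsilon>). Y_opnorm (phi \<epsilon>) (Ds \<epsilon> V)) < ennreal \<eta>"
      using order_tendstoD(2)[OF s_small, of "ennreal \<eta>"] \<eta> by simp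
    show "\<forall>\<^sub>F \<epsilon> in at_right 0. C1_norm r poincare_disk
        (\<lambda>i z. compactification d (X \<epsilon>) i z - compactification d (X 0) i z) < e"
      using ev_eps ev_lam ev_phi ev_s
    proof eventually_elim
      case (elim \<epsilon>)
      note eps = elim(1)
      obtain ux where ux: "has_weak_deriv (phi \<epsilon>) ux"
        "\<And>x. x \<in> {0..1} \<Longrightarrow> \<bar>ux x\<bar> \<le> \<bar>ev \<epsilon> 2 - lam\<bar> / m0"
        using eigenfunction_weak_deriv_le[OF conjunct1[OF ev2[OF eps]] conjunct2[OF ev2[OF eps]]
            pos(4) a_lower[OF eps]] by blast
      have "\<bar>ev \<epsilon> 2 - lam\<bar> \<le> m0 * \<eta> / 4" using elim(2) by (simp add: \<delta>_def)
      then have small: "\<bar>ev \<epsilon> 2 - lam\<bar> / m0 \<le> \<eta> / 4" using pos(4) by (simp add: field_simps)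
      have l2ux: "l2_norm ux \<le> 1"
      proof (rule l2_norm_le_sup)
        show "\<bar>ux x\<bar> \<le> 1" if "x \<in> {0..1}" for x
          using ux(2)[OF that] small \<eta> by linarith
      qed (rule has_weak_derivD(1)[OF ux(1)])
      have phi1: "\<bar>phi \<epsilon> x - 1\<bar> \<le> \<eta>" if "x \<in> {0..1}" for x
        using eigenfunction_near_1[OF ux that] small elim(3) by linarith
      have phic: "continuous_on {0..1} (phi \<epsilon>)"
        using ux(1) by (intro H1_continuous) (auto simp: H1_def)
      have norm1: "l2_norm (phi \<epsilon>) = 1" using ev2[OF eps] by blast
      have s_le: "st_norm (s \<epsilon> V) \<le> \<eta>" and Ds_le: "Y_opnorm (phi \<epsilon>) (Ds \<epsilon> V) \<le> ennreal \<eta>"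
        if V: "V \<in> Y (phi \<epsilon>)" for V
      proof -
        have "ennreal (st_norm (s \<epsilon> V)) \<le> (SUP V\<in>Y (phi \<epsilon>). ennreal (st_norm (s \<epsilon> V)))"
          using V by (rule SUP_upper)
        also have "\<dots> \<le> (SUP V\<in>Y (phi \<epsilon>). ennreal (st_norm (s \<epsilon> V)))
            + (SUP V\<in>Y (phi \<epsilon>). Y_opnorm (phi \<epsilon>) (Ds \<epsilon> V))" by simp
        also have "\<dots> \<le> ennreal \<eta>" using elim(4) by simp
        finally show "st_norm (s \<epsilon> V) \<le> \<eta>" using \<eta> by (simp add: ennreal_le_iff)
        have "Y_opnorm (phi \<epsilon>) (Ds \<epsilon> V) \<le> (SUP V\<in>Y (phi \<epsilon>). Y_opnorm (phi \<epsilon>) (Ds \<epsilon> V))"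
          using V by (rule SUP_upper)
        also have "\<dots> \<le> (SUP V\<in>Y (phi \<epsilon>). ennreal (st_norm (s \<epsilon> V)))
            + (SUP V\<in>Y (phi \<epsilon>). Y_opnorm (phi \<epsilon>) (Ds \<epsilon> V))" by simp
        also have "\<dots> \<le> ennreal \<eta>" using elim(4) by simp
        finally show "Y_opnorm (phi \<epsilon>) (Ds \<epsilon> V) \<le> ennreal \<eta>" .
      qed
      have "0 \<le> \<eta>" using \<eta> by simp
      note data = s_C1[OF eps] Ds_le \<open>0 \<le> \<eta>\<close> ux(1) norm1 l2ux
      have ud: "unif_deriv (profile (phi \<epsilon>) (s \<epsilon>)) (profile_deriv (phi \<epsilon>) (Ds \<epsilon>) q) q" for q
        by (rule profile_unif_deriv[OF data])
      have lam_near: "\<bar>ev \<epsilon> 2 - lam\<bar> \<le> \<eta>" using elim(2) by (simp add: \<delta>_def)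
      have "near_limit \<eta> lam (ev \<epsilon> 2) (phi \<epsilon>) (s \<epsilon>) (Ds \<epsilon>)"
        unfolding near_limit_def
        using lam_near phic phi1 ud theta_sup_le[OF s_C1[OF eps] s_le] theta_deriv_sup_le[OF data] by blast
      note est' = est[OF this]
      define D where "D = DX_eps (ev \<epsilon> 2) beta F1' F2' G1' G2' (phi \<epsilon>) (s \<epsilon>) (Ds \<epsilon>)"
      have XD: "(X \<epsilon> has_derivative D q) (at q)" for q
        unfolding X_pos[OF eps] D_def by (rule X_eps_has_derivative[OF F1(1,2) F2(1,2) G1(1) G2(1) ud phic])
      obtain C where C: "\<And>q h. norm (D q h) \<le> C * norm h"
        using est' unfolding D_def by blast
      have "C1_norm r poincare_disk (\<lambda>i z. compactification d (X \<epsilon>) i z - compactification d (X 0) i z)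
          \<le> ennreal (chart_bound d r * \<kappa>)"
      proof (rule C1_norm_compactification_le[OF XD C X0 D0_le])
        show "norm (X \<epsilon> 0 - X 0 0) \<le> \<kappa>"
          using est' unfolding X_pos[OF eps] X_0 by blast
        show "norm (D q h - D0 q h) \<le> \<kappa> * (1 + norm q) * norm h" for q h
          using est' unfolding D_def D0_def by blast
      qed (fact d3 r(1))+
      also have "\<dots> = ennreal c" using \<kappa>(2) by (simp add: cb_def)
      finally show ?case using c(2) by (rule order_le_less_trans)
    qed
  qed simp
qed

end
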